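(* Let $D\subset\mathbb{R}^n$, $n\ge2$, be a domain, $x_0\in D$, $\delta>0$, and $Q:D\to[0,\infty]$ Lebesgue measurable. Let $\mathfrak{F}_{Q,\delta}$ be the family of all open discrete mappings $f:D\to\overline{\mathbb{R}^n}\setminus E_f$ which are ring $Q$-mappings at $x_0$, where $E_f\subset\overline{\mathbb{R}^n}$ is a compact set (depending on $f$) with $c(E_f)\ge\delta$. Assume that one of the following holds: (1) $Q\in FMO(x_0)$; (2) there are $C>0$ and $\varepsilon'>0$ such that $q_{x_0}(r)\le C\left(\log\frac1r\right)^{n-1}$ for all $r\in(0,\varepsilon')$; (3) $\int_0^{\varepsilon_0}\frac{dt}{t\,q_{x_0}^{1/(n-1)}(t)}=\infty$ for some $\varepsilon_0=\varepsilon_0(x_0)\in(0,\operatorname{dist}(x_0,\partial D))$. Then $\mathfrak{F}_{Q,\delta}$ is equicontinuous at $x_0$ with respect to the chordal metric $h$.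
   Context: $\overline{\mathbb{R}^n}=\mathbb{R}^n\cup\{\infty\}$ with chordal metric $h(x,y)=\frac{|x-y|}{\sqrt{1+|x|^2}\sqrt{1+|y|^2}}$, $h(x,\infty)=\frac1{\sqrt{1+|x|^2}}$. $M(\Gamma)$ is the conformal modulus of a curve family; $\Gamma(E,F,D)$ is the family of paths $\gamma:[a,b]\to\overline{\mathbb{R}^n}$ with $\gamma(a)\in E$, $\gamma(b)\in F$, $\gamma(t)\in D$ for $a<t<b$, and $\Gamma(E,F)=\Gamma(E,F,\overline{\mathbb{R}^n})$. With $R(r_1,r_2,x_0)=\{r_1<|x-x_0|<r_2\}$, $S(x_0,r)=\{|x-x_0|=r\}$, $r_0=\operatorname{dist}(x_0,\partial D)$: $f:D\to\overline{\mathbb{R}^n}$ is a ring $Q$-mapping at $x_0$ if $M(f(\Gamma(S(x_0,r_1),S(x_0,r_2),R(r_1,r_2,x_0))))\le\int_{R(r_1,r_2,x_0)}Q(x)\eta^n(|x-x_0|)\,dm(x)$ for all $0<r_1<r_2<r_0$ and all measurable $\eta:(r_1,r_2)\to[0,\infty]$ with $\int_{r_1}^{r_2}\eta\,dr\ge1$. Discrete: point preimages consist of isolated points; open: images of open sets are open. Equicontinuity at $x_0$: for every $\sigma>0$ there is $\Delta>0$ with $h(f(x),f(x_0))<\sigma$ for all $f$ in the family and $|x-x_0|<\Delta$. $Q\in FMO(x_0)$ means $\limsup_{\varepsilon\to0}\frac{1}{\Omega_n\varepsilon^n}\int_{B(x_0,\varepsilon)}|Q-\widetilde Q_\varepsilon|\,dm<\infty$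 with $\widetilde Q_\varepsilon$ the mean of $Q$ over $B(x_0,\varepsilon)$. $q_{x_0}(r)=\frac{1}{\omega_{n-1}r^{n-1}}\int_{|x-x_0|=r}Q\,dS$, where $\omega_{n-1}$ is the area of the unit sphere. Set function $c$: for $x\in\overline{\mathbb{R}^n}$, $t>0$, let $B^*(x,t)=\{y:h(x,y)<t\}$; for $E\subset\overline{\mathbb{R}^n}$ let $m(E,x)=M\big(\Gamma(\partial B^*(x,\sqrt3/2),\,E\cap\overline{B^*(x,\sqrt2/2)})\big)$, $c(E,x)=\max\{m(E,x),m(E,\tilde x)\}$ with $\tilde x=-x/|x|^2$ ($\tilde 0=\infty$, $\tilde\infty=0$), and $c(E)=\inf_{x\in\overline{\mathbb{R}^n}}c(E,x)$. *)

theory Defs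
  imports "HOL-Analysis.Analysis" "HOL-Library.Liminf_Limsup"
begin

text \<open>The one-point compactification of R^n is modelled as 'a option,
  where None is the point at infinity and Some x is the finite point x.\<close>

definition chordal :: "'a::euclidean_space option \<Rightarrow> 'a option \<Rightarrow> real" where
  "chordal p q = (case (p, q) of
      (Some x, Some y) \<Rightarrow> norm (x - y) / (sqrt (1 + (norm x)\<^sup>2) * sqrt (1 + (norm y)\<^sup>2))
    | (Some x, None) \<Rightarrow> 1 / sqrt (1 + (norm x)\<^sup>2)
    | (None, Some y) \<Rightarrow> 1 / sqrt (1 + (norm y)\<^sup>2)
    | (None, None) \<Rightarrow> 0)"

definition ch_ball :: "'a::euclidean_space option \<Rightarrow> real \<Rightarrow> 'a option set" where
  "ch_ball x t = {y. chordal x y < t}"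

definition ch_open :: "'a::euclidean_space option set \<Rightarrow> bool" where
  "ch_open S \<longleftrightarrow> (\<forall>y\<in>S. \<exists>e>0. ch_ball y e \<subseteq> S)"

definition ch_closure :: "'a::euclidean_space option set \<Rightarrow> 'a option set" where
  "ch_closure S = {y. \<forall>e>0. \<exists>z\<in>S. chordal y z < e}"

definition ch_interior :: "'a::euclidean_space option set \<Rightarrow> 'a option set" where
  "ch_interior S = {y. \<exists>e>0. ch_ball y e \<subseteq> S}"

definition ch_frontier :: "'a::euclidean_space option set \<Rightarrow> 'a option set" where
  "ch_frontier S = ch_closure S - ch_interior S"

definition ch_compact :: "'a::euclidean_space option set \<Rightarrow> bool" where
  "ch_compact K \<longleftrightarrow> (\<forall>\<U>. (\<forall>U\<in>\<U>. ch_open U) \<and> K \<subseteq> \<Union>\<U> \<longrightarrow>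
       (\<exists>\<V>\<subseteq>\<U>. finite \<V> \<and> K \<subseteq> \<Union>\<V>))"

text \<open>Paths: a path is a triple (a, b, g) standing for g restricted to [a,b],
  continuous with respect to the chordal metric.\<close>

type_synonym 'a ext_path = "real \<times> real \<times> (real \<Rightarrow> 'a option)"

definition ch_path :: "real \<Rightarrow> real \<Rightarrow> (real \<Rightarrow> 'a::euclidean_space option) \<Rightarrow> bool" where
  "ch_path a b g \<longleftrightarrow> a < b \<and> (\<forall>t\<in>{a..b}. \<forall>e>0. \<exists>d>0. \<forall>s\<in>{a..b}.
       \<bar>s - t\<bar> < d \<longrightarrow> chordal (g s) (g t) < e)"

definition Gam :: "'a::euclidean_space option set \<Rightarrow> 'a option set \<Rightarrow> 'a option set \<Rightarrow> 'a ext_path set" where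
  "Gam E F D = {(a, b, g). ch_path a b g \<and> g a \<in> E \<and> g b \<in> F \<and> (\<forall>t\<in>{a<..<b}. g t \<in> D)}"

definition path_length :: "(real \<Rightarrow> 'a::euclidean_space) \<Rightarrow> real \<Rightarrow> real \<Rightarrow> ennreal" where
  "path_length g c d = (SUP ts \<in> {ts. sorted ts \<and> set ts \<subseteq> {c..d}}.
       (\<Sum>i<length ts - 1. ennreal (dist (g (ts ! i)) (g (ts ! Suc i)))))"

text \<open>Line integral with respect to arc length of a rectifiable path on [c,d]:
  the Lebesgue--Stieltjes integral against the length function s(t) = l(g|[c,min t d]).\<close>

definition line_int :: "(real \<Rightarrow> 'a::euclidean_space) \<Rightarrow> real \<Rightarrow> real \<Rightarrow> ('a \<Rightarrow> ennreal) \<Rightarrow> ennreal" where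
  "line_int g c d \<rho> =
     (\<integral>\<^sup>+ t\<in>{c..d}. \<rho> (g t) \<partial>(interval_measure (\<lambda>t. enn2real (path_length g c (min t d)))))"

definition fin_params :: "'a::euclidean_space ext_path \<Rightarrow> real set" where
  "fin_params p = (case p of (a, b, g) \<Rightarrow> {t\<in>{a..b}. g t \<noteq> None})"

definition loc_rectifiable :: "'a::euclidean_space ext_path \<Rightarrow> bool" where
  "loc_rectifiable p \<longleftrightarrow> (case p of (a, b, g) \<Rightarrow>
     (\<forall>c d. c \<le> d \<and> {c..d} \<subseteq> fin_params p \<longrightarrow> path_length (the \<circ> g) c d < \<infinity>))"

definition ext_line_int :: "'a::euclidean_space ext_path \<Rightarrow> ('a \<Rightarrow> ennreal) \<Rightarrow> ennreal" where
  "ext_line_int p \<rho> = (case p of (a, b, g) \<Rightarrow>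
     (SUP F \<in> {F. finite F \<and> (\<forall>(c, d)\<in>F. c \<le> d \<and> {c..d} \<subseteq> fin_params p)
                 \<and> disjoint_family_on (\<lambda>(c, d). {c..d::real}) F}.
        (\<Sum>(c, d)\<in>F. line_int (the \<circ> g) c d \<rho>)))"

definition admissible :: "'a::euclidean_space ext_path set \<Rightarrow> ('a \<Rightarrow> ennreal) \<Rightarrow> bool" where
  "admissible \<Gamma> \<rho> \<longleftrightarrow> \<rho> \<in> borel_measurable borel \<and>
     (\<forall>p\<in>\<Gamma>. loc_rectifiable p \<longrightarrow> ext_line_int p \<rho> \<ge> 1)"

definition modulus :: "'a::euclidean_space ext_path set \<Rightarrow> ennreal" where
  "modulus \<Gamma> = (INF \<rho> \<in> {\<rho>. admissible \<Gamma> \<rho>}. \<integral>\<^sup>+ x. \<rho> x ^ DIM('a) \<partial>lborel)"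

definition path_image_fam :: "('a::euclidean_space \<Rightarrow> 'a option) \<Rightarrow> 'a ext_path set \<Rightarrow> 'a ext_path set" where
  "path_image_fam f \<Gamma> = {(a, b, f \<circ> the \<circ> g) | a b g. (a, b, g) \<in> \<Gamma>}"

definition ring :: "real \<Rightarrow> real \<Rightarrow> 'a::euclidean_space \<Rightarrow> 'a set" where
  "ring r1 r2 x0 = {x. r1 < dist x x0 \<and> dist x x0 < r2}"

definition dist_bd :: "'a::euclidean_space \<Rightarrow> 'a set \<Rightarrow> ereal" where
  "dist_bd x0 D = (if frontier D = {} then \<infinity> else ereal (infdist x0 (frontier D)))"

definition ring_Q_map :: "'a::euclidean_space set \<Rightarrow> ('a \<Rightarrow> ennreal) \<Rightarrow> 'a \<Rightarrow> ('a \<Rightarrow> 'a option) \<Rightarrow> bool" where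
  "ring_Q_map D Q x0 f \<longleftrightarrow>
     (\<forall>r1 r2. 0 < r1 \<and> r1 < r2 \<and> ereal r2 < dist_bd x0 D \<longrightarrow>
       (\<forall>\<eta>::real \<Rightarrow> ennreal. \<eta> \<in> borel_measurable borel \<and> (\<integral>\<^sup>+ r\<in>{r1<..<r2}. \<eta> r \<partial>lborel) \<ge> 1 \<longrightarrow>
          modulus (path_image_fam f (Gam (Some ` sphere x0 r1) (Some ` sphere x0 r2) (Some ` ring r1 r2 x0)))
            \<le> (\<integral>\<^sup>+ x\<in>ring r1 r2 x0. Q x * \<eta> (dist x x0) ^ DIM('a) \<partial>lebesgue)))"

definition ch_continuous_on :: "'a::euclidean_space set \<Rightarrow> ('a \<Rightarrow> 'a option) \<Rightarrow> bool" where
  "ch_continuous_on D f \<longleftrightarrow> (\<forall>x\<in>D. \<forall>e>0. \<exists>d>0. \<forall>y\<in>D. dist y x < d \<longrightarrow> chordal (f y) (f x) < e)"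

definition open_map :: "'a::euclidean_space set \<Rightarrow> ('a \<Rightarrow> 'a option) \<Rightarrow> bool" where
  "open_map D f \<longleftrightarrow> (\<forall>U. open U \<and> U \<subseteq> D \<longrightarrow> ch_open (f ` U))"

definition discrete_map :: "'a::euclidean_space set \<Rightarrow> ('a \<Rightarrow> 'a option) \<Rightarrow> bool" where
  "discrete_map D f \<longleftrightarrow> (\<forall>x\<in>D. \<exists>e>0. \<forall>z\<in>D. f z = f x \<and> dist z x < e \<longrightarrow> z = x)"

definition tilde :: "'a::euclidean_space option \<Rightarrow> 'a option" where
  "tilde p = (case p of None \<Rightarrow> Some 0
                | Some x \<Rightarrow> (if x = 0 then None else Some (- (x /\<^sub>R (norm x)\<^sup>2))))"

definition m_set :: "'a::euclidean_space option set \<Rightarrow> 'a option \<Rightarrow> ennreal" where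
  "m_set E x = modulus (Gam (ch_frontier (ch_ball x (sqrt 3 / 2)))
                           (E \<inter> ch_closure (ch_ball x (sqrt 2 / 2))) UNIV)"

definition c_set :: "'a::euclidean_space option set \<Rightarrow> ennreal" where
  "c_set E = (INF x. max (m_set E x) (m_set E (tilde x)))"

definition fam :: "'a::euclidean_space set \<Rightarrow> ('a \<Rightarrow> ennreal) \<Rightarrow> 'a \<Rightarrow> real \<Rightarrow> ('a \<Rightarrow> 'a option) set" where
  "fam D Q x0 \<delta> = {f. ch_continuous_on D f \<and> open_map D f \<and> discrete_map D f \<and> ring_Q_map D Q x0 f \<and>
      (\<exists>E. ch_compact E \<and> c_set E \<ge> ennreal \<delta> \<and> f ` D \<inter> E = {})}"

definition equicont_at :: "'a::euclidean_space set \<Rightarrow> ('a \<Rightarrow> 'a option) set \<Rightarrow> 'a \<Rightarrow> bool" where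
  "equicont_at D \<F> x0 \<longleftrightarrow> (\<forall>\<sigma>>0. \<exists>\<Delta>>0. \<forall>f\<in>\<F>. \<forall>x\<in>D. dist x x0 < \<Delta> \<longrightarrow> chordal (f x) (f x0) < \<sigma>)"

definition FMO_at :: "('a::euclidean_space \<Rightarrow> ennreal) \<Rightarrow> 'a \<Rightarrow> bool" where
  "FMO_at Q x0 \<longleftrightarrow>
     (\<exists>\<epsilon>0>0. set_integrable lebesgue (ball x0 \<epsilon>0) (\<lambda>x. enn2real (Q x))
              \<and> (AE x\<in>ball x0 \<epsilon>0 in lebesgue. Q x \<noteq> \<infinity>)) \<and>
     Limsup (at_right 0) (\<lambda>\<epsilon>.
        let \<Omega> = measure lebesgue (ball (0::'a) 1);
            mean = (LINT x:ball x0 \<epsilon>|lebesgue. enn2real (Q x)) / (\<Omega> * \<epsilon> ^ DIM('a))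
        in ereal ((LINT x:ball x0 \<epsilon>|lebesgue. \<bar>enn2real (Q x) - mean\<bar>) / (\<Omega> * \<epsilon> ^ DIM('a)))) < \<infinity>"

text \<open>Surface measure on the unit sphere S^{n-1}: the cone measure,
  sigma(A) = n * m({t theta : 0 < t <= 1, theta in A}); equivalently
  the integral of g over S^{n-1} is n times the integral over the unit ball of g(x/|x|).\<close>

definition sphere_int :: "('a::euclidean_space \<Rightarrow> ennreal) \<Rightarrow> ennreal" where
  "sphere_int g = of_nat DIM('a) * (\<integral>\<^sup>+ x\<in>ball 0 1. g (x /\<^sub>R norm x) \<partial>lebesgue)"

definition omega :: "'a::euclidean_space itself \<Rightarrow> ennreal" where
  "omega _ = sphere_int (\<lambda>_::'a. 1)"

definition surf_int :: "('a::euclidean_space \<Rightarrow> ennreal) \<Rightarrow> 'a \<Rightarrow> real \<Rightarrow> ennreal" where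
  "surf_int g x0 r = ennreal (r ^ (DIM('a) - 1)) * sphere_int (\<lambda>\<theta>. g (x0 + r *\<^sub>R \<theta>))"

definition q_mean :: "('a::euclidean_space \<Rightarrow> ennreal) \<Rightarrow> 'a \<Rightarrow> real \<Rightarrow> ennreal" where
  "q_mean Q x0 r = surf_int Q x0 r / (omega TYPE('a) * ennreal (r ^ (DIM('a) - 1)))"

definition enn_root :: "nat \<Rightarrow> ennreal \<Rightarrow> ennreal" where
  "enn_root k x = (if x = \<infinity> then \<infinity> else ennreal (root k (enn2real x)))"

end

theory Submission
  imports Defs
begin

text \<open>
  Let f omit a compact set E with c(E) at least \<delta>. Each of the three conditions on Q yields a ring about x0 and a
  weight \<eta> for which the integral of Q \<eta>^n is as small as we like, so some admissible \<rho> for the images of the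
  paths crossing the ring has tiny L^n norm. Suppose that f(x) and f(x0) are far apart for some x inside the ring, and let F
  be the image of the segment from x0 to x. Since c(E) is at least \<delta>, some path g of \<rho>-length below 1/2
  crosses a fixed spherical shell and ends in E. Both F and g meet all spheres about suitable centres whose radii
  range over a fixed interval. Averaging over these radii and over intermediate points z of the unit ball bounds the
  \<rho>-length of segments from F to z and from z to g in terms of the L^n norm of \<rho>; hence F is joined to E by a path
  of \<rho>-length below 1. As f is open and discrete, this path has a maximal lift starting inside the ring,
  which has to cross the ring because E is omitted, and this contradicts the admissibility of \<rho>.
\<close>

section \<open>The chordal metric\<close>

text \<open>Equicontinuity demands bounds independent of \<open>f\<close>, so the geometry is pinned
  to fixed places: the infimum in \<open>c_set\<close> is used only at the centre 0, whose antipode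
  is infinity, and the shells around these two points do not move with \<open>f\<close>. The
  obstacle is that n is the critical exponent: a small L^n norm of \<open>\<rho>\<close> gives no
  bound on its integrals along segments issuing from one fixed point, since contracting towards that
  point by the factor t costs t^-n. Base points on spheres of varying radii win back one factor t,
  and after a form of Hoelder's inequality the cost is t^(-(n-1)/n), whose integral over [0,1] is n.
  Hence a continuum enters only through a measurable choice of one of its points for each radius.
  The set E may contain no continuum at all; the path that ends in E takes its place. Infinity may
  be a value of \<open>f\<close>, so paths in the image are treated on the sphere and Euclidean
  distances are truncated. In the lifting, openness moves an approximate lift forward, and
  discreteness keeps it from wandering while its image hardly moves.\<close>

text \<open>Stereographic projection onto a sphere of radius 1/2: the chordal metric becomes the Euclidean one.\<close>

definition stereo :: "'a::euclidean_space option \<Rightarrow> 'a \<times> real" where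
  "stereo p = (case p of None \<Rightarrow> (0, 1)
     | Some x \<Rightarrow> (x /\<^sub>R (1 + (norm x)\<^sup>2), (norm x)\<^sup>2 / (1 + (norm x)\<^sup>2)))"

lemma stereo_simps [simp]:
  "stereo None = (0, 1)"
  "stereo (Some x) = (x /\<^sub>R (1 + (norm x)\<^sup>2), (norm x)\<^sup>2 / (1 + (norm x)\<^sup>2))"
  by (simp_all add: stereo_def)

lemma chordal_simps:
  "chordal (Some x) (Some y) = norm (x - y) / (sqrt (1 + (norm x)\<^sup>2) * sqrt (1 + (norm y)\<^sup>2))"
  "chordal (Some x) None = 1 / sqrt (1 + (norm x)\<^sup>2)"
  "chordal None (Some x) = 1 / sqrt (1 + (norm x)\<^sup>2)"
  "chordal None None = 0"
  by (simp_all add: chordal_def)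

lemma one_plus_norm_sq_pos: "0 < 1 + (norm x)\<^sup>2"
  by (rule add_pos_nonneg) auto

lemma one_plus_norm_sq_neq_0 [simp]: "1 + (norm x)\<^sup>2 \<noteq> 0"
  using one_plus_norm_sq_pos[of x] by linarith

text \<open>The image lies on the sphere of radius 1/2 about (0, 1/2), and |w|^2 = (last coordinate
  of w) is the equation of that sphere. It makes squared distances linear in the last coordinates
  and one inner product.\<close>

lemma norm_stereo_sq: "(norm (stereo p))\<^sup>2 = snd (stereo p)"
proof (cases p)
  case None
  then show ?thesis by (simp add: norm_Pair)
next
  case (Some x)
  define A where "A = 1 + (norm x)\<^sup>2"
  have A: "A > 0" unfolding A_def by (rule one_plus_norm_sq_pos)
  have nx: "(norm x)\<^sup>2 = A - 1" by (simp add: A_def)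
  have "(norm (stereo p))\<^sup>2 = (norm (x /\<^sub>R A))\<^sup>2 + ((norm x)\<^sup>2 / A)\<^sup>2"
    by (simp add: Some norm_Pair A_def)
  also have "\<dots> = (A - 1) / A\<^sup>2 + ((A - 1) / A)\<^sup>2"
    using A by (simp add: power_mult_distrib nx power_divide divide_simps)
  also have "\<dots> = (A - 1) / A"
    using A by (simp add: field_simps power2_eq_square)
  finally show ?thesis by (simp add: Some nx flip: A_def)
qed

text \<open>Comparing squares suffices, as both sides are nonnegative. From here on, continuity and
  the triangle inequality for \<open>chordal\<close> are those of a Euclidean space.\<close>

lemma chordal_eq_dist: "chordal p q = dist (stereo p) (stereo q)"
proof -
  have sq: "(dist (stereo p) (stereo q))\<^sup>2 =
      snd (stereo p) + snd (stereo q) - 2 * (stereo p \<bullet> stereo q)" for p q :: "'a option"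
    by (simp add: dist_norm power2_norm_eq_inner inner_diff inner_commute flip: norm_stereo_sq)
  have nonneg: "chordal p q \<ge> 0" by (auto simp: chordal_def split: option.splits)
  have *: "(chordal p q)\<^sup>2 = (dist (stereo p) (stereo q))\<^sup>2"
  proof (cases p; cases q)
    fix x y assume p: "p = Some x" and q: "q = Some y"
    define A where "A = 1 + (norm x)\<^sup>2"
    define B where "B = 1 + (norm y)\<^sup>2"
    have A: "A > 0" and B: "B > 0" unfolding A_def B_def by (rule one_plus_norm_sq_pos)+
    have nx: "(norm x)\<^sup>2 = A - 1" "(norm y)\<^sup>2 = B - 1" by (simp_all add: A_def B_def)
    have "(chordal p q)\<^sup>2 = (norm (x - y))\<^sup>2 / (A * B)"
      using A B by (simp add: p q chordal_simps power_divide power_mult_distrib flip: A_def B_def)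
    also have "(norm (x - y))\<^sup>2 = (A - 1) + (B - 1) - 2 * (x \<bullet> y)"
      unfolding nx[symmetric] by (simp add: power2_norm_eq_inner inner_diff inner_commute)
    also have "((A - 1) + (B - 1) - 2 * (x \<bullet> y)) / (A * B) =
      (A - 1) / A + (B - 1) / B - 2 * ((x \<bullet> y) / (A * B) + ((A - 1) / A) * ((B - 1) / B))"
      using A B by (simp add: divide_simps) (simp add: algebra_simps)
    also have "\<dots> = (dist (stereo p) (stereo q))\<^sup>2"
      unfolding sq using A B by (simp add: p q inner_Pair nx divide_simps flip: A_def B_def)
    finally show ?thesis .
  next
    fix x assume p: "p = Some x" and q: "q = None"
    have A: "1 + (norm x)\<^sup>2 > 0" by (rule one_plus_norm_sq_pos)
    show ?thesis unfolding sq using A by (simp add: p q chordal_simps power_divide inner_Pair) (simp add: divide_simps)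
  next
    fix x assume p: "p = None" and q: "q = Some x"
    have A: "1 + (norm x)\<^sup>2 > 0" by (rule one_plus_norm_sq_pos)
    show ?thesis unfolding sq using A by (simp add: p q chordal_simps power_divide inner_Pair) (simp add: divide_simps)
  qed (simp add: chordal_simps)
  show ?thesis
    using * nonneg by (metis power2_eq_iff_nonneg zero_le_dist)
qed

lemma chordal_commute: "chordal p q = chordal q p"
  by (simp add: chordal_eq_dist dist_commute)

lemma chordal_triangle: "chordal p q \<le> chordal p r + chordal r q"
  by (simp add: chordal_eq_dist dist_triangle)

lemma inj_stereo: "inj stereo"
proof (rule injI)
  fix p q :: "'a option" assume "stereo p = stereo q"
  then have "chordal p q = 0" by (simp add: chordal_eq_dist)
  then show "p = q"
    by (cases p; cases q) (auto simp: chordal_simps)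
qed

lemma chordal_eq_0_iff [simp]: "chordal p q = 0 \<longleftrightarrow> p = q"
  using inj_stereo by (auto simp: chordal_eq_dist inj_def)

text \<open>Both square roots in the denominator are at least 1. Finite points at chordal distance
  \<sigma> are therefore at Euclidean distance at least \<sigma>, which yields an interval of radii
  later.\<close>

lemma chordal_le_dist: "chordal (Some x) (Some y) \<le> dist x y"
proof -
  have "1 \<le> sqrt (1 + (norm z)\<^sup>2)" for z :: 'a by simp
  then have "1 \<le> sqrt (1 + (norm x)\<^sup>2) * sqrt (1 + (norm y)\<^sup>2)"
    by (meson mult_le_one one_le_numeral order_trans mult_ge1_I)
  then show ?thesis
    by (simp add: chordal_simps dist_norm divide_le_eq mult_le_cancel_left1 )
qed

lemma ch_path_iff: "ch_path a b g \<longleftrightarrow> a < b \<and> continuous_on {a..b} (\<lambda>t. stereo (g t))"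
  unfolding ch_path_def continuous_on_iff by (auto simp: chordal_eq_dist dist_real_def)

lemma ch_continuous_on_iff: "ch_continuous_on D f \<longleftrightarrow> continuous_on D (\<lambda>x. stereo (f x))"
  unfolding ch_continuous_on_def continuous_on_iff by (auto simp: chordal_eq_dist)

lemma ch_open_ch_ball: "ch_open (ch_ball y e)"
  unfolding ch_open_def ch_ball_def
proof safe
  fix z assume z: "chordal y z < e"
  show "\<exists>d>0. {x. chordal z x < d} \<subseteq> {z. chordal y z < e}"
    using z chordal_triangle[of y _ z] by (intro exI[of _ "e - chordal y z"]) (smt (verit) mem_Collect_eq subsetI)
qed

lemma continuous_on_stereo_Some: "continuous_on S (\<lambda>x. stereo (Some x))"
proof -
  have "1 + (norm x)\<^sup>2 \<noteq> 0" for x :: 'a using one_plus_norm_sq_pos[of x] by simp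
  then show ?thesis by (auto intro!: continuous_intros)
qed

text \<open>Inverse of the projection; at the image of infinity the division by 0 gives the junk
  value 0.\<close>

definition unstereo :: "'a::euclidean_space \<times> real \<Rightarrow> 'a" where
  "unstereo w = fst w /\<^sub>R (1 - snd w)"

lemma unstereo_stereo: "unstereo (stereo (Some x)) = x"
proof -
  have A: "1 + (norm x)\<^sup>2 > 0" by (rule one_plus_norm_sq_pos)
  then have "1 - (norm x)\<^sup>2 / (1 + (norm x)\<^sup>2) = 1 / (1 + (norm x)\<^sup>2)" by (simp add: field_simps)
  with A show ?thesis by (simp add: unstereo_def)
qed

lemma snd_stereo_eq_1: "snd (stereo p) = 1 \<longleftrightarrow> p = None"
proof (cases p)
  case (Some x)
  have A: "1 + (norm x)\<^sup>2 > 0" by (rule one_plus_norm_sq_pos)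
  then show ?thesis by (auto simp: Some)
qed auto

lemma continuous_on_the_comp:
  assumes "continuous_on S (\<lambda>t. stereo (g t))" "\<And>t. t \<in> S \<Longrightarrow> g t \<noteq> None"
  shows "continuous_on S (the \<circ> g)"
proof -
  have "continuous_on S (\<lambda>t. unstereo (stereo (g t)))"
    unfolding unstereo_def using assms
    by (intro continuous_intros) (auto simp: snd_stereo_eq_1 simp del: stereo_simps)
  moreover have "unstereo (stereo (g t)) = (the \<circ> g) t" if "t \<in> S" for t
    using assms(2)[OF that] by (cases "g t") (auto simp: unstereo_stereo simp del: stereo_simps)
  ultimately show ?thesis by (simp cong: continuous_on_cong)
qed

lemma ch_path_imp_continuous_the:
  assumes "ch_path a b g" "{c..d} \<subseteq> fin_params (a, b, g)"
  shows "continuous_on {c..d} (the \<circ> g)"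
proof (rule continuous_on_the_comp)
  have "{c..d} \<subseteq> {a..b}" using assms(2) by (auto simp: fin_params_def)
  then show "continuous_on {c..d} (\<lambda>t. stereo (g t))"
    using assms(1) unfolding ch_path_iff by (meson continuous_on_subset)
qed (use assms(2) in \<open>auto simp: fin_params_def\<close>)

text \<open>The Euclidean distance to c, truncated at M so that it extends continuously to infinity.\<close>

definition trunc_dist :: "real \<Rightarrow> 'a::euclidean_space \<Rightarrow> 'a option \<Rightarrow> real" where
  "trunc_dist M c p = (case p of None \<Rightarrow> M | Some y \<Rightarrow> min M (dist c y))"

text \<open>Close to infinity every finite point is farther than M from c, so the truncated distance
  is constant there. Its continuity at infinity rests on this.\<close>

lemma open_stereo_far: "\<exists>e>0. \<forall>p. chordal None p < e \<longrightarrow> trunc_dist M c p = M"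
proof -
  define R where "R = \<bar>M\<bar> + norm c + 1"
  have R: "R > 0" unfolding R_def by (smt (verit) norm_ge_zero)
  show ?thesis
  proof (intro exI[of _ "1 / sqrt (1 + R\<^sup>2)"] conjI allI impI)
    show "0 < 1 / sqrt (1 + R\<^sup>2)" by (smt (verit) divide_pos_pos real_sqrt_gt_0_iff zero_le_power2)
    fix p :: "'a option" assume *: "chordal None p < 1 / sqrt (1 + R\<^sup>2)"
    show "trunc_dist M c p = M"
    proof (cases p)
      case (Some y)
      have "norm y > R"
      proof (rule ccontr)
        assume "\<not> norm y > R"
        then have "(norm y)\<^sup>2 \<le> R\<^sup>2" by (intro power_mono) auto
        then have "1 / sqrt (1 + R\<^sup>2) \<le> 1 / sqrt (1 + (norm y)\<^sup>2)"
          by (intro divide_left_mono) (auto intro!: mult_pos_pos add_pos_nonneg)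
        with * show False by (simp add: Some chordal_simps)
      qed
      then have "dist c y \<ge> M" unfolding R_def dist_norm
        by (smt (verit) norm_triangle_ineq2 norm_minus_commute)
      then show ?thesis by (simp add: Some trunc_dist_def)
    qed (simp add: trunc_dist_def)
  qed
qed

lemma continuous_on_trunc_dist:
  fixes g :: "real \<Rightarrow> 'a::euclidean_space option"
  assumes "continuous_on S (\<lambda>t. stereo (g t))"
  shows "continuous_on S (\<lambda>t. trunc_dist M c (g t))"
proof -
  have "continuous (at t within S) (\<lambda>t. trunc_dist M c (g t))" if t: "t \<in> S" for t
  proof (cases "g t")
    case None
    obtain e where e: "e > 0" "\<And>p. chordal None p < e \<Longrightarrow> trunc_dist M c p = M"
      using open_stereo_far by blast
    have "\<forall>\<^sub>F s in at t within S. dist (stereo (g s)) (stereo (g t)) < e"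
      using assms t e(1) unfolding continuous_on_def tendsto_iff by blast
    then have "\<forall>\<^sub>F s in at t within S. trunc_dist M c (g s) = M"
      by eventually_elim (auto simp: None chordal_eq_dist dist_commute intro!: e(2))
    then have "((\<lambda>t. trunc_dist M c (g t)) \<longlongrightarrow> M) (at t within S)"
      by (rule tendsto_eventually)
    then show ?thesis by (simp add: continuous_within None trunc_dist_def)
  next
    case (Some y)
    have lim: "((\<lambda>s. stereo (g s)) \<longlongrightarrow> stereo (Some y)) (at t within S)"
      using assms t Some unfolding continuous_on_def by metis
    have ne: "\<forall>\<^sub>F s in at t within S. g s \<noteq> None"
    proof -
      have "((\<lambda>s. snd (stereo (g s))) \<longlongrightarrow> snd (stereo (Some y))) (at t within S)"
        by (intro tendsto_intros lim)
      moreover have "snd (stereo (Some y)) \<noteq> 1" by (simp only: snd_stereo_eq_1) simp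
      ultimately have "\<forall>\<^sub>F s in at t within S. snd (stereo (g s)) \<noteq> 1"
        by (rule tendsto_imp_eventually_ne)
      then show ?thesis by eventually_elim (simp only: snd_stereo_eq_1 simp_thms)
    qed
    have "((\<lambda>s. unstereo (stereo (g s))) \<longlongrightarrow> unstereo (stereo (Some y))) (at t within S)"
      unfolding unstereo_def
      by (intro tendsto_intros lim) (use snd_stereo_eq_1[of "Some y"] in auto)
    then have "((\<lambda>s. min M (dist c (unstereo (stereo (g s))))) \<longlongrightarrow> min M (dist c y)) (at t within S)"
      unfolding unstereo_stereo by (intro tendsto_intros)
    moreover have "\<forall>\<^sub>F s in at t within S. min M (dist c (unstereo (stereo (g s)))) = trunc_dist M c (g s)"
      using ne by eventually_elim (auto simp: trunc_dist_def unstereo_stereo simp del: stereo_simps)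
    ultimately show ?thesis
      by (simp add: continuous_within Some trunc_dist_def[of M c "Some y"] Lim_transform_eventually)
  qed
  then show ?thesis by (simp add: continuous_on_eq_continuous_within)
qed

text \<open>First hitting times depend monotonically on the level, hence measurably.\<close>

lemma hitting_time:
  fixes d :: "real \<Rightarrow> real"
  assumes "continuous_on {a..b} d" "a \<le> b" "d a \<le> p" "q \<le> d b"
  obtains \<tau> where "\<And>r. r \<in> {p<..<q} \<Longrightarrow> \<tau> r \<in> {a..b} \<and> d (\<tau> r) = r"
    "mono_on {p<..<q} \<tau>"
proof -
  define A where "A r = {t\<in>{a..b}. d t = r}" for r
  have ne: "A r \<noteq> {}" if "r \<in> {p<..<q}" for r
    using IVT'[of d a r b] assms that by (auto simp: A_def)
  have cl: "closed (A r)" for r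
    unfolding A_def using continuous_closed_preimage_constant[OF assms(1)] by auto
  have bd: "bdd_below (A r)" for r by (auto simp: A_def bdd_below_def)
  have In: "Inf (A r) \<in> A r" if "r \<in> {p<..<q}" for r
    using closed_contains_Inf[OF ne[OF that] bd cl] .
  show ?thesis
  proof
    show "Inf (A r) \<in> {a..b} \<and> d (Inf (A r)) = r" if "r \<in> {p<..<q}" for r
      using In[OF that] by (simp add: A_def)
    show "mono_on {p<..<q} (\<lambda>r. Inf (A r))"
    proof (rule mono_onI)
      fix r s assume rs: "r \<in> {p<..<q}" "s \<in> {p<..<q}" "r \<le> s"
      have s: "Inf (A s) \<in> {a..b}" "d (Inf (A s)) = s" using In[OF rs(2)] by (auto simp: A_def)
      \<comment> \<open>The function starts below r and equals s >= r at its first visit to level s,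
        so it has passed level r by then.\<close>
      obtain t where "t \<in> {a..Inf (A s)}" "d t = r"
        using IVT'[of d a r "Inf (A s)"] assms rs s continuous_on_subset[OF assms(1), of "{a..Inf (A s)}"]
        by force
      then have "t \<in> A r" "t \<le> Inf (A s)" using s by (auto simp: A_def)
      then show "Inf (A r) \<le> Inf (A s)" using cInf_lower[OF _ bd] by force
    qed
  qed
qed

section \<open>Lifting paths through open discrete maps\<close>

text \<open>Openness gives a covered ball at each point; compactness makes its size uniform, which
  allows a lift to advance by steps of fixed length.\<close>

lemma uniformly_open_map:
  fixes f :: "'a::euclidean_space \<Rightarrow> 'a option"
  assumes "compact K" "K \<subseteq> D" "open D" "ch_continuous_on D f" "open_map D f" "\<epsilon> > 0"
  obtains \<eta> where "\<eta> > 0" "\<And>x. x \<in> K \<Longrightarrow> ch_ball (f x) \<eta> \<subseteq> f ` (ball x \<epsilon> \<inter> D)"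
proof -
  have "\<exists>d>0. \<exists>\<eta>>0. \<forall>y\<in>ball x d \<inter> K. ch_ball (f y) \<eta> \<subseteq> f ` (ball y \<epsilon> \<inter> D)" if x: "x \<in> K" for x
  proof -
    \<comment> \<open>Half of \<open>\<epsilon>\<close> is used for the covering at x, the other
      half for replacing x by a nearby centre y.\<close>
    have "ch_open (f ` (ball x (\<epsilon>/2) \<inter> D))"
      using assms(3,5) unfolding open_map_def by (meson Int_lower2 open_Int open_ball)
    moreover have "f x \<in> f ` (ball x (\<epsilon>/2) \<inter> D)" using x assms by auto
    ultimately obtain e where e: "e > 0" "ch_ball (f x) e \<subseteq> f ` (ball x (\<epsilon>/2) \<inter> D)"
      unfolding ch_open_def by blast
    obtain d where d: "d > 0" "\<And>y. y \<in> D \<Longrightarrow> dist y x < d \<Longrightarrow> chordal (f y) (f x) < e/2"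
      using assms(2,4) x e(1) unfolding ch_continuous_on_def by (metis half_gt_zero subsetD)
    show ?thesis
    proof (rule exI[of _ "min d (\<epsilon>/2)"], rule conjI, goal_cases)
      case 2
      show ?case
      proof (rule exI[of _ "e/2"], intro conjI ballI)
        fix y assume y: "y \<in> ball x (min d (\<epsilon>/2)) \<inter> K"
        then have "chordal (f y) (f x) < e/2" using assms(2) by (intro d(2)) (auto simp: dist_commute)
        then have "ch_ball (f y) (e/2) \<subseteq> ch_ball (f x) e"
          unfolding ch_ball_def using chordal_triangle[of "f x" _ "f y"] chordal_commute[of "f x" "f y"]
          by (smt (verit) Collect_mono_iff field_sum_of_halves)
        moreover have "ball x (\<epsilon>/2) \<subseteq> ball y \<epsilon>"
        proof
          fix z assume "z \<in> ball x (\<epsilon>/2)"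
          then show "z \<in> ball y \<epsilon>" using y dist_triangle[of y z x] by (auto simp: dist_commute)
        qed
        ultimately show "ch_ball (f y) (e/2) \<subseteq> f ` (ball y \<epsilon> \<inter> D)" using e(2) by blast
      qed (use e in auto)
    qed (use d assms in auto)
  qed
  then obtain d \<eta> where d: "\<And>x. x \<in> K \<Longrightarrow> d x > 0 \<and> \<eta> x > (0::real) \<and>
      (\<forall>y\<in>ball x (d x) \<inter> K. ch_ball (f y) (\<eta> x) \<subseteq> f ` (ball y \<epsilon> \<inter> D))"
    by metis
  have pos: "\<And>y. y \<in> K \<Longrightarrow> 0 < d y" "\<And>y. y \<in> K \<Longrightarrow> 0 < \<eta> y" using d by blast+
  obtain T where T: "T \<subseteq> K" "finite T" "K \<subseteq> (\<Union>x\<in>T. ball x (d x))"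
    using compactE_image[OF assms(1), of K "\<lambda>x. ball x (d x)"] pos by force
  show ?thesis
  proof (cases "T = {}")
    case True
    with T show ?thesis by (intro that[of 1]) auto
  next
    case False
    show ?thesis
    proof (rule that[of "Min (\<eta> ` T)"])
      show "Min (\<eta> ` T) > 0" using T pos False by (subst Min_gr_iff) auto
      fix x assume x: "x \<in> K"
      then obtain y where y: "y \<in> T" "x \<in> ball y (d y)" using T by auto
      have "Min (\<eta> ` T) \<le> \<eta> y" using y T by auto
      then have "ch_ball (f x) (Min (\<eta> ` T)) \<subseteq> ch_ball (f x) (\<eta> y)" by (auto simp: ch_ball_def)
      then show "ch_ball (f x) (Min (\<eta> ` T)) \<subseteq> f ` (ball x \<epsilon> \<inter> D)"
        using d[of y] y T x by blast
    qed
  qed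
qed

text \<open>A chain that moves away from y has to meet a thin shell about y on which f avoids the value f(y).\<close>

lemma uniformly_light_map:
  fixes f :: "'a::euclidean_space \<Rightarrow> 'a option"
  assumes K: "compact K" and f: "ch_continuous_on K f" "discrete_map K f" and \<epsilon>: "\<epsilon> > 0"
  shows "\<exists>\<eta>>0. \<exists>\<theta>>0. \<forall>x i j. i \<le> j \<longrightarrow> (\<forall>k\<in>{i..j}. x k \<in> K \<and> chordal (f (x k)) (f (x i)) < \<eta>) \<longrightarrow>
       (\<forall>k\<in>{i..<j}. dist (x k) (x (Suc k)) < \<theta>) \<longrightarrow> dist (x i) (x (j::nat)) < \<epsilon>"
proof -
  have "\<exists>d>0. \<exists>\<eta>>0. \<forall>x i j. i \<le> j \<longrightarrow> dist y (x i) < d \<longrightarrow> (\<forall>k\<in>{i..j}. x k \<in> K \<and> chordal (f (x k)) (f (x i)) < \<eta>) \<longrightarrow>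
       (\<forall>k\<in>{i..<j}. dist (x k) (x (Suc k)) < d) \<longrightarrow> dist (x i) (x (j::nat)) < \<epsilon>" if y: "y \<in> K" for y
  proof -
    obtain e where e: "e > 0" "\<And>z. z \<in> K \<Longrightarrow> f z = f y \<Longrightarrow> dist z y < e \<Longrightarrow> z = y"
      using f(2) y unfolding discrete_map_def by blast
    \<comment> \<open>A quarter, so that the shell between s and 2s stays where y is the only
      preimage of f(y), and so that the final bound s + s is below
      \<open>\<epsilon>\<close>.\<close>
    define s where "s = min e \<epsilon> / 4"
    have s: "s > 0" "2 * s < e" "2 * s + s < \<epsilon>" using e \<epsilon> by (auto simp: s_def)
    define A where "A = {z\<in>K. s \<le> dist y z \<and> dist y z \<le> 2 * s}"
    have A: "compact A"
    proof -
      have "A = K \<inter> (cball y (2 * s) - ball y s)" by (auto simp: A_def)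
      then show ?thesis using K by (metis closed_cball closed_Diff open_ball compact_Int_closed)
    qed
    have fA: "continuous_on A (\<lambda>z. dist (stereo (f z)) (stereo (f y)))"
      using f(1) unfolding ch_continuous_on_iff
      by (intro continuous_intros) (auto simp: A_def intro: continuous_on_subset)
    have "\<exists>m>0. \<forall>z\<in>A. m \<le> chordal (f z) (f y)"
    proof (cases "A = {}")
      case True then show ?thesis by (auto intro: exI[of _ 1])
    next
      case False
      obtain z0 where z0: "z0 \<in> A" "\<And>z. z \<in> A \<Longrightarrow> chordal (f z0) (f y) \<le> chordal (f z) (f y)"
        using continuous_attains_inf[OF A False fA] unfolding chordal_eq_dist by blast
      have "f z0 \<noteq> f y" using z0(1) e(2)[of z0] s by (auto simp: A_def dist_commute)
      then have "chordal (f z0) (f y) > 0"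
        using chordal_eq_0_iff[of "f z0" "f y"] by (simp add: chordal_eq_dist)
      then show ?thesis using z0 by blast
    qed
    then obtain m where m: "m > 0" "\<And>z. z \<in> A \<Longrightarrow> m \<le> chordal (f z) (f y)" by blast
    obtain d where d: "d > 0" "\<And>z. z \<in> K \<Longrightarrow> dist z y < d \<Longrightarrow> chordal (f z) (f y) < m/2"
      using f(1) y m(1) unfolding ch_continuous_on_def by (metis half_gt_zero)
    show ?thesis
    proof (rule exI[of _ "min d s"], rule conjI, goal_cases)
      case 2
      show ?case
      proof (rule exI[of _ "m/2"], intro conjI allI impI)
        fix x :: "nat \<Rightarrow> 'a" and i j
        assume ij: "i \<le> j" and start: "dist y (x i) < min d s"
          and ch: "\<forall>k\<in>{i..j}. x k \<in> K \<and> chordal (f (x k)) (f (x i)) < m/2"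
          and step: "\<forall>k\<in>{i..<j}. dist (x k) (x (Suc k)) < min d s"
        \<comment> \<open>Steps shorter than s cannot jump over a shell of width s: the first point
          outside radius s would lie in A, where f is at least m away from f(y), whereas the chain
          keeps f within m/2 + m/2 of f(y).\<close>
        have inv: "dist y (x (i + k)) < s" if "i + k \<le> j" for k
          using that
        proof (induction k)
          case 0 then show ?case using start by simp
        next
          case (Suc k)
          show ?case
          proof (rule ccontr)
            assume "\<not> dist y (x (i + Suc k)) < s"
            moreover have "dist (x (i + k)) (x (i + Suc k)) < s" using step Suc.prems by auto
            then have "dist y (x (i + Suc k)) \<le> 2 * s"
              using Suc dist_triangle[of y "x (i + Suc k)" "x (i + k)"] by simp
            ultimately have "x (i + Suc k) \<in> A" using ch Suc.prems by (auto simp: A_def)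
            then have 1: "m \<le> chordal (f (x (i + Suc k))) (f y)" by (rule m)
            have "chordal (f (x i)) (f y) < m/2"
              using start ch ij by (intro d(2)) (auto simp: dist_commute)
            moreover have "chordal (f (x (i + Suc k))) (f (x i)) < m/2" using ch Suc.prems by auto
            ultimately show False using 1 chordal_triangle[of "f (x (i + Suc k))" "f y" "f (x i)"] by linarith
          qed
        qed
        have "dist y (x j) < s" using inv[of "j - i"] ij by simp
        then show "dist (x i) (x j) < \<epsilon>"
          using start s dist_triangle2[of "x i" "x j" y] by (simp add: dist_commute)
      qed (use m in auto)
    qed (use d s in auto)
  qed
  then obtain d \<eta> where d: "\<And>y. y \<in> K \<Longrightarrow> d y > 0 \<and> \<eta> y > (0::real) \<and>
      (\<forall>x i j. i \<le> j \<longrightarrow> dist y (x i) < d y \<longrightarrow> (\<forall>k\<in>{i..j}. x k \<in> K \<and> chordal (f (x k)) (f (x i)) < \<eta> y) \<longrightarrow>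
       (\<forall>k\<in>{i..<j}. dist (x k) (x (Suc k)) < d y) \<longrightarrow> dist (x i) (x (j::nat)) < \<epsilon>)"
    by metis
  have pos: "\<And>y. y \<in> K \<Longrightarrow> 0 < d y" "\<And>y. y \<in> K \<Longrightarrow> 0 < \<eta> y" using d by blast+
  obtain T where T: "T \<subseteq> K" "finite T" "K \<subseteq> (\<Union>x\<in>T. ball x (d x))"
    using compactE_image[OF assms(1), of K "\<lambda>x. ball x (d x)"] pos by force
  show ?thesis
  proof (cases "T = {}")
    case True
    with T have "K = {}" by auto
    then show ?thesis by (auto intro!: exI[of _ "1::real"])
  next
    case False
    show ?thesis
    proof (rule exI[of _ "Min (\<eta> ` T)"], rule conjI, goal_cases)
      case 1 show ?case using T pos False by (auto simp: Min_gr_iff)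
    next
      case 2
      show ?case
      proof (rule exI[of _ "Min (d ` T)"], intro conjI allI impI)
        show "Min (d ` T) > 0" using T pos False by (auto simp: Min_gr_iff)
        fix x :: "nat \<Rightarrow> 'a" and i j
        assume ij: "i \<le> j"
          and ch: "\<forall>k\<in>{i..j}. x k \<in> K \<and> chordal (f (x k)) (f (x i)) < Min (\<eta> ` T)"
          and st: "\<forall>k\<in>{i..<j}. dist (x k) (x (Suc k)) < Min (d ` T)"
        from ij ch have "x i \<in> K" by auto
        then obtain y where y: "y \<in> T" "x i \<in> ball y (d y)" using T by auto
        have "Min (\<eta> ` T) \<le> \<eta> y" "Min (d ` T) \<le> d y" using y T by auto
        then have "\<forall>k\<in>{i..j}. x k \<in> K \<and> chordal (f (x k)) (f (x i)) < \<eta> y"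
          "\<forall>k\<in>{i..<j}. dist (x k) (x (Suc k)) < d y" using ch st by force+
        moreover have "y \<in> K" "dist y (x i) < d y" using y T by auto
        ultimately show "dist (x i) (x j) < \<epsilon>" using d[of y] ij by blast
      qed
    qed
  qed
qed

text \<open>Tychonoff for uncountably many indices. The approximate lifts are step functions, so a
  limit is first taken pointwise; a cluster point is enough, because every later argument looks at
  finitely many times only.\<close>

lemma pointwise_cluster:
  fixes X :: "nat \<Rightarrow> 'i \<Rightarrow> 'b::metric_space"
  assumes "compact K" "\<And>n t. X n t \<in> K"
  obtains \<alpha> where "\<And>t. \<alpha> t \<in> K"
    "\<And>S e N. finite S \<Longrightarrow> e > 0 \<Longrightarrow> \<exists>n\<ge>N. \<forall>t\<in>S. dist (X n t) (\<alpha> t) < e"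
proof -
  have "compact (PiE UNIV (\<lambda>_::'i. K))"
    using assms(1) compactin_PiE[of "\<lambda>_. euclidean :: 'b topology" UNIV "\<lambda>_::'i. K"]
    by (simp add: euclidean_product_topology)
  moreover have "filtermap X sequentially \<noteq> bot" "\<forall>\<^sub>F \<phi> in filtermap X sequentially. \<phi> \<in> PiE UNIV (\<lambda>_::'i. K)"
    using assms(2) by (auto simp: eventually_filtermap filtermap_bot_iff PiE_UNIV_domain)
  ultimately obtain \<alpha> where \<alpha>: "\<alpha> \<in> PiE UNIV (\<lambda>_::'i. K)" "inf (nhds \<alpha>) (filtermap X sequentially) \<noteq> bot"
    unfolding compact_filter by blast
  show ?thesis
  proof (rule that)
    fix S :: "'i set" and e :: real and N :: nat assume S: "finite S" "e > 0"
    define U where "U = PiE UNIV (\<lambda>t. if t \<in> S then ball (\<alpha> t) e else UNIV)"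
    have "{i. (if i \<in> S then ball (\<alpha> i) e else UNIV) \<noteq> UNIV} \<subseteq> S" by auto
    then have "open U" unfolding U_def using S(1) by (intro open_PiE) (auto intro: finite_subset)
    moreover have "\<alpha> \<in> U" unfolding U_def PiE_UNIV_domain using S(2) by simp
    ultimately have U: "\<forall>\<^sub>F \<phi> in nhds \<alpha>. \<phi> \<in> U" by (rule eventually_nhds_in_open)
    show "\<exists>n\<ge>N. \<forall>t\<in>S. dist (X n t) (\<alpha> t) < e"
    proof (rule ccontr)
      assume *: "\<not> ?thesis"
      have "X n \<notin> U" if "n \<ge> N" for n
      proof
        assume "X n \<in> U"
        then have "X n t \<in> (if t \<in> S then ball (\<alpha> t) e else UNIV)" for t
          unfolding U_def by (rule PiE_mem) simp
        then have "dist (X n t) (\<alpha> t) < e" if "t \<in> S" for t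
          using that by (metis dist_commute mem_ball)
        with * \<open>n \<ge> N\<close> show False by blast
      qed
      then have "\<forall>\<^sub>F \<phi> in filtermap X sequentially. \<phi> \<notin> U"
        unfolding eventually_filtermap eventually_sequentially by blast
      with U have "\<forall>\<^sub>F \<phi> in inf (nhds \<alpha>) (filtermap X sequentially). False"
        unfolding eventually_inf by blast
      then show False using \<alpha>(2) by (simp add: eventually_False)
    qed
  qed (use \<alpha> in auto)
qed

text \<open>Stepping along a grid of width h: openness moves the point by less than
  \<open>\<epsilon>'\<close> while the image advances by one grid step, and the point is frozen once
  it has left radius r2, which is what \<open>min u T\<close> records. The conclusion speaks of
  chains from \<open>\<alpha> s\<close> to \<open>\<alpha> t\<close>, because
  \<open>uniformly_light_map\<close> needs the intermediate points and not merely the two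
  ends.\<close>

lemma approximate_lift:
  fixes f :: "'a::euclidean_space \<Rightarrow> 'a option" and G :: "real \<Rightarrow> 'a option"
  assumes D: "open D" "cball x0 r3 \<subseteq> D" and r: "r2 < r3"
    and f: "ch_continuous_on D f" "open_map D f"
    and G: "uniformly_continuous_on UNIV (\<lambda>t. stereo (G t))" "\<And>t. t \<ge> b \<Longrightarrow> G t \<notin> f ` D"
    and x1: "dist x1 x0 < r2" "f x1 = G a" and "a \<le> b" and \<epsilon>: "\<epsilon> > 0"
  shows "\<exists>T \<alpha>. T \<in> {a..b+1} \<and> \<alpha> a = x1 \<and> (\<forall>t. \<alpha> t \<in> cball x0 r3) \<and> dist (\<alpha> T) x0 \<ge> r2 \<and>
    (\<forall>s t. a \<le> s \<and> s \<le> t \<longrightarrow> (\<exists>x i j. i \<le> (j::nat) \<and> x i = \<alpha> s \<and> x j = \<alpha> t \<and>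
       (\<forall>k\<in>{i..j}. x k \<in> cball x0 r3 \<and> (\<exists>u\<in>{s-\<epsilon>..t}. f (x k) = G (min u T))) \<and>
       (\<forall>k\<in>{i..<j}. dist (x k) (x (Suc k)) < \<epsilon>)))"
proof -
  define K where "K = cball x0 r3"
  \<comment> \<open>The bound r3 - r2 keeps a step that starts inside radius r2 in the compact ball
    K.\<close>
  define \<epsilon>' where "\<epsilon>' = min \<epsilon> (r3 - r2)"
  have \<epsilon>': "\<epsilon>' > 0" "\<epsilon>' \<le> \<epsilon>" using \<epsilon> r by (auto simp: \<epsilon>'_def)
  obtain \<eta> where \<eta>: "\<eta> > 0" "\<And>x. x \<in> K \<Longrightarrow> ch_ball (f x) \<eta> \<subseteq> f ` (ball x \<epsilon>' \<inter> D)"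
    using uniformly_open_map[of K D f \<epsilon>'] D f \<epsilon>' unfolding K_def by auto
  obtain h0 where h0: "h0 > 0" "\<And>s t. \<bar>s - t\<bar> < h0 \<Longrightarrow> chordal (G s) (G t) < \<eta>"
    using G(1) \<eta>(1) unfolding uniformly_continuous_on_def chordal_eq_dist dist_real_def by blast
  define h where "h = min (h0 / 2) (min \<epsilon> 1)"
  have h: "h > 0" "h < h0" "h \<le> \<epsilon>" "h \<le> 1" using h0 \<epsilon> by (auto simp: h_def)
  \<comment> \<open>\<open>P\<close> is the invariant and \<open>Q\<close> the step relation of a
    dependent choice. Beyond radius r2 the relation \<open>Q\<close> forces the sequence to stay
    put.\<close>
  define P where "P i x \<longleftrightarrow> x \<in> K \<and> (dist x x0 < r2 \<longrightarrow> f x = G (a + real i * h))" for i x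
  define Q where "Q i x y \<longleftrightarrow> dist x y < \<epsilon>' \<and>
     (dist x x0 < r2 \<longrightarrow> f y = G (a + real (Suc i) * h)) \<and> (dist x x0 \<ge> r2 \<longrightarrow> y = x)" for i x y
  have "\<exists>x. \<forall>i. P i (x i) \<and> Q i (x i) (x (Suc i)) \<and> (i = 0 \<longrightarrow> x i = x1)"
  proof -
    have "\<exists>x. \<forall>i. (P i (x i) \<and> (i = 0 \<longrightarrow> x i = x1)) \<and> Q i (x i) (x (Suc i))"
    proof (rule dependent_nat_choice)
      show "\<exists>x. P 0 x \<and> (0 = 0 \<longrightarrow> x = x1)" using x1 r by (auto simp: P_def K_def dist_commute)
    next
      fix x i assume x: "P i x \<and> (i = 0 \<longrightarrow> x = x1)"
      show "\<exists>y. (P (Suc i) y \<and> (Suc i = 0 \<longrightarrow> y = x1)) \<and> Q i x y"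
      proof (cases "dist x x0 < r2")
        case False
        then show ?thesis using x \<epsilon>' by (auto simp: P_def Q_def)
      next
        case True
        have "chordal (f x) (G (a + real (Suc i) * h)) < \<eta>"
          using x True h h0(2)[of "a + real i * h" "a + real (Suc i) * h"]
          by (auto simp: P_def algebra_simps)
        then have "G (a + real (Suc i) * h) \<in> f ` (ball x \<epsilon>' \<inter> D)"
          using \<eta>(2)[of x] x by (auto simp: P_def ch_ball_def)
        then obtain y where y: "dist x y < \<epsilon>'" "f y = G (a + real (Suc i) * h)" by auto
        have "dist y x0 \<le> r3" using y(1) True dist_triangle[of y x0 x] by (auto simp: \<epsilon>'_def dist_commute)
        then show ?thesis using y True by (auto simp: P_def Q_def K_def dist_commute)
      qed
    qed
    then show ?thesis by blast
  qed
  then obtain x where P: "\<And>i. P i (x i)" and Q: "\<And>i. Q i (x i) (x (Suc i))" and x0: "x 0 = x1" by blast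
  have xK: "x i \<in> K" for i using P by (simp add: P_def)
  have step: "dist (x i) (x (Suc i)) < \<epsilon>" for i
    using Q[of i] \<epsilon>'(2) unfolding Q_def by linarith
  \<comment> \<open>The first grid point at or after b exceeds b by at most h <= 1, whence the range
    \<open>{a..b+1}\<close> for the exit time.\<close>
  define p where "p = nat \<lceil>(b - a) / h\<rceil>"
  have p: "b \<le> a + real p * h" "a + real p * h \<le> b + 1"
  proof -
    have "(b - a) / h \<ge> 0" using h assms by auto
    then have "(b - a) / h \<le> real p" "real p < (b - a) / h + 1"
      unfolding p_def by linarith+
    then have "b - a \<le> real p * h" "real p * h < b - a + h" using h by (auto simp: field_simps)
    then show "b \<le> a + real p * h" "a + real p * h \<le> b + 1" using h by auto
  qed
  have exit: "dist (x p) x0 \<ge> r2"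
  proof (rule ccontr)
    assume "\<not> ?thesis"
    then have "f (x p) = G (a + real p * h)" using P[of p] by (simp add: P_def)
    moreover have "x p \<in> D" using xK D by (auto simp: K_def)
    ultimately show False using G(2)[OF p(1)] by (metis image_eqI)
  qed
  define m where "m = (LEAST i. dist (x i) x0 \<ge> r2)"
  have m: "dist (x m) x0 \<ge> r2" "m \<le> p" "\<And>i. i < m \<Longrightarrow> dist (x i) x0 < r2"
    unfolding m_def using exit by (auto intro: LeastI Least_le dest: not_less_Least)
  have m0: "m \<noteq> 0" using m(1) x0 x1 by (metis not_less)
  \<comment> \<open>\<open>P\<close> says nothing about f at points outside radius r2; at the first
    such point the equation is supplied by the step \<open>Q\<close> leading to it.\<close>
  have fx: "f (x i) = G (a + real i * h)" if "i \<le> m" for i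
  proof (cases "i = m")
    case True
    obtain k where "m = Suc k" using m0 by (cases m) auto
    then show ?thesis using Q[of k] m(3)[of k] True by (auto simp: Q_def)
  next
    case False
    then show ?thesis using that P[of i] m(3)[of i] by (auto simp: P_def)
  qed
  have const: "x (m + i) = x m" for i
  proof (induction i)
    case (Suc i)
    then show ?case using Q[of "m + i"] m(1) by (simp add: Q_def)
  qed simp
  define T where "T = a + real m * h"
  have fx': "f (x i) = G (min (a + real i * h) T)" for i
  proof (cases "i \<le> m")
    case True
    then have "real i * h \<le> real m * h" using h by (simp add: mult_right_mono)
    with True show ?thesis by (simp add: fx T_def min_def)
  next
    case False
    then have "x i = x m" using const[of "i - m"] by simp
    moreover have "real m * h \<le> real i * h" using h False by (simp add: mult_right_mono)
    ultimately show ?thesis by (auto simp: fx T_def min_def)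
  qed
  \<comment> \<open>Times are rounded down to the grid, so a chain may begin up to h <=
    \<open>\<epsilon>\<close> before s; this is the slack in the interval
    \<open>{s-\<epsilon>..t}\<close>.\<close>
  define ix where "ix t = nat \<lfloor>(t - a) / h\<rfloor>" for t
  have ix: "a + real (ix t) * h \<le> t" "t < a + real (ix t) * h + h" if "a \<le> t" for t
  proof -
    have "0 \<le> (t - a) / h" using that h by auto
    then have "real (ix t) \<le> (t - a) / h" "(t - a) / h < real (ix t) + 1" unfolding ix_def by linarith+
    then show "a + real (ix t) * h \<le> t" "t < a + real (ix t) * h + h" using h by (auto simp: field_simps)
  qed
  show ?thesis
  proof (intro exI[of _ T] exI[of _ "\<lambda>t. x (ix t)"] conjI allI impI)
    have "T \<le> a + real p * h" using m(2) h by (auto simp: T_def mult_right_mono)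
    then show "T \<in> {a..b+1}" using p(2) h unfolding T_def by (metis atLeastAtMost_iff le_add_same_cancel1 less_imp_le mult_nonneg_nonneg of_nat_0_le_iff order_trans)
    show "x (ix a) = x1" by (simp add: ix_def x0)
    show "x (ix t) \<in> cball x0 r3" for t using xK by (simp add: K_def)
    have "ix T = m" using h by (simp add: ix_def T_def)
    then show "dist (x (ix T)) x0 \<ge> r2" using m(1) by simp
    fix s t assume st: "a \<le> s \<and> s \<le> t"
    have "(s - a) / h \<le> (t - a) / h" using st h by (intro divide_right_mono) auto
    then have ij: "ix s \<le> ix t" unfolding ix_def by (intro nat_mono floor_mono)
    show "\<exists>y i j. i \<le> (j::nat) \<and> y i = x (ix s) \<and> y j = x (ix t) \<and>
       (\<forall>k\<in>{i..j}. y k \<in> cball x0 r3 \<and> (\<exists>u\<in>{s-\<epsilon>..t}. f (y k) = G (min u T))) \<and>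
       (\<forall>k\<in>{i..<j}. dist (y k) (y (Suc k)) < \<epsilon>)"
    proof (rule exI[of _ x], rule exI[of _ "ix s"], rule exI[of _ "ix t"], intro conjI ballI ij refl)
      fix k assume k: "k \<in> {ix s..ix t}"
      have "a + real k * h \<in> {s-\<epsilon>..t}"
      proof -
        have "real (ix s) * h \<le> real k * h" "real k * h \<le> real (ix t) * h"
          using k h by (auto intro: mult_right_mono)
        then show ?thesis using ix[of s] ix[of t] st h unfolding atLeastAtMost_iff by linarith
      qed
      then show "\<exists>u\<in>{s-\<epsilon>..t}. f (x k) = G (min u T)" using fx' by blast
    qed (use xK step in \<open>auto simp: K_def\<close>)
  qed
qed

text \<open>A limit of approximate lifts with mesh 1/(n+1), in the manner of Arzela-Ascoli: although
  these are discontinuous, lightness of f makes them equicontinuous from some index on, and the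
  pointwise cluster function inherits continuity.\<close>

lemma exiting_lift:
  fixes f :: "'a::euclidean_space \<Rightarrow> 'a option"
  assumes D: "open D" "cball x0 r3 \<subseteq> D" and r: "r2 < r3"
    and f: "ch_continuous_on D f" "open_map D f" "discrete_map D f"
    and g: "ch_path a b g" "g b \<notin> f ` D"
    and x1: "dist x1 x0 < r2" "f x1 = g a"
  obtains T \<alpha> where "a \<le> T" "T \<le> b" "continuous_on {a..T} \<alpha>" "\<alpha> a = x1"
    "dist (\<alpha> T) x0 \<ge> r2" "\<And>t. t \<in> {a..T} \<Longrightarrow> f (\<alpha> t) = g t"
proof -
  define K where "K = cball x0 r3"
  have ab: "a < b" using g(1) by (simp add: ch_path_def)
  \<comment> \<open>Constant continuation beyond [a,b]: grid times may overshoot b, and all later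
    values then equal g(b), which f omits.\<close>
  define G where "G t = g (max a (min t b))" for t
  have "uniformly_continuous_on {a..b} (\<lambda>t. stereo (g t))"
    using g(1) by (intro compact_uniformly_continuous) (auto simp: ch_path_iff)
  then have Gc: "\<exists>d>0. \<forall>u v. \<bar>u - v\<bar> < d \<longrightarrow> chordal (G u) (G v) < e" if "e > 0" for e
  proof -
    obtain d where d: "d > 0" "\<And>u v. u \<in> {a..b} \<Longrightarrow> v \<in> {a..b} \<Longrightarrow> dist v u < d \<Longrightarrow> dist (stereo (g v)) (stereo (g u)) < e"
      using \<open>uniformly_continuous_on {a..b} (\<lambda>t. stereo (g t))\<close> \<open>e > 0\<close>
      unfolding uniformly_continuous_on_def by metis
    have "chordal (G u) (G v) < e" if uv: "\<bar>u - v\<bar> < d" for u v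
    proof -
      have "\<bar>max a (min u b) - max a (min v b)\<bar> < d" using uv ab by linarith
      then show ?thesis
        unfolding chordal_eq_dist G_def using ab by (intro d(2)) (simp_all only: dist_real_def, auto)
    qed
    then show ?thesis using d(1) by blast
  qed
  then have Gu: "uniformly_continuous_on UNIV (\<lambda>t. stereo (G t))"
    unfolding uniformly_continuous_on_def chordal_eq_dist by (simp only: dist_real_def ball_UNIV) (metis abs_minus_commute)
  have Gb: "G t \<notin> f ` D" if "t \<ge> b" for t using that g(2) ab by (simp add: G_def)
  have Ga: "f x1 = G a" using x1 ab by (simp add: G_def)
  have "\<forall>n. \<exists>T \<alpha>. T \<in> {a..b+1} \<and> \<alpha> a = x1 \<and> (\<forall>t. \<alpha> t \<in> cball x0 r3) \<and> dist (\<alpha> T) x0 \<ge> r2 \<and>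
    (\<forall>s t. a \<le> s \<and> s \<le> t \<longrightarrow> (\<exists>x i j. i \<le> (j::nat) \<and> x i = \<alpha> s \<and> x j = \<alpha> t \<and>
       (\<forall>k\<in>{i..j}. x k \<in> cball x0 r3 \<and> (\<exists>u\<in>{s-inverse (Suc n)..t}. f (x k) = G (min u T))) \<and>
       (\<forall>k\<in>{i..<j}. dist (x k) (x (Suc k)) < inverse (Suc n))))"
    using ab by (intro allI approximate_lift[OF D r f(1,2) Gu Gb x1(1) Ga]) auto
  then obtain T0 \<alpha>0 where T0: "\<And>n. T0 n \<in> {a..b+1}" and \<alpha>0a: "\<And>n. \<alpha>0 n a = x1"
    and \<alpha>0K: "\<And>n t. \<alpha>0 n t \<in> K" and \<alpha>0T: "\<And>n. dist (\<alpha>0 n (T0 n)) x0 \<ge> r2"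
    and chain: "\<And>n s t. a \<le> s \<and> s \<le> t \<Longrightarrow> (\<exists>x i j. i \<le> (j::nat) \<and> x i = \<alpha>0 n s \<and> x j = \<alpha>0 n t \<and>
       (\<forall>k\<in>{i..j}. x k \<in> K \<and> (\<exists>u\<in>{s-inverse (Suc n)..t}. f (x k) = G (min u (T0 n)))) \<and>
       (\<forall>k\<in>{i..<j}. dist (x k) (x (Suc k)) < inverse (Suc n)))"
    unfolding K_def by metis
  obtain T r where T: "T \<in> {a..b+1}" "strict_mono r" "(T0 \<circ> r) \<longlonglongrightarrow> T"
    using T0 compact_Icc[of a "b+1"] unfolding compact_def by metis
  have fK: "ch_continuous_on K f" "discrete_map K f"
    using f D unfolding ch_continuous_on_def discrete_map_def K_def by (meson subsetD)+
  have "compact K" by (simp add: K_def)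
  obtain \<alpha> where \<alpha>K: "\<And>t. \<alpha> t \<in> K" and
    cl0: "\<And>S e N. finite S \<Longrightarrow> e > 0 \<Longrightarrow> \<exists>n\<ge>N. \<forall>t\<in>S. dist ((\<alpha>0 \<circ> r) n t) (\<alpha> t) < e"
    using pointwise_cluster[of K "\<alpha>0 \<circ> r"] \<open>compact K\<close> \<alpha>0K by (auto simp: o_def)
  \<comment> \<open>The exit times converge along r and the cluster function belongs to the same
    subsequence, so one index n is good for the exit time and for finitely many parameters at
    once.\<close>
  have cl: "\<exists>n\<ge>N. \<bar>T0 n - T\<bar> < e \<and> (\<forall>t\<in>S. dist (\<alpha>0 n t) (\<alpha> t) < e)" if S: "finite S" "e > 0" for S e N
  proof -
    obtain N1 where N1: "\<And>n. n \<ge> N1 \<Longrightarrow> \<bar>T0 (r n) - T\<bar> < e"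
      using T(3) S(2) unfolding LIMSEQ_def dist_real_def by auto
    obtain n where "n \<ge> max N N1" "\<forall>t\<in>S. dist (\<alpha>0 (r n) t) (\<alpha> t) < e"
      using cl0[OF S, of "max N N1"] by auto
    moreover have "r n \<ge> n" using T(2) by (rule seq_suble)
    ultimately show ?thesis using N1[of n] by (intro exI[of _ "r n"]) auto
  qed
  \<comment> \<open>Over a short time interval the images along the connecting chain stay within
    \<open>\<eta>\<close> of each other, because G is uniformly continuous; by
    \<open>uniformly_light_map\<close> the ends of the chain are then close.\<close>
  have equi: "\<exists>d>0. \<exists>N. \<forall>n\<ge>N. \<forall>s t. a \<le> s \<longrightarrow> s \<le> t \<longrightarrow> t < s + d \<longrightarrow> dist (\<alpha>0 n s) (\<alpha>0 n t) < e" if e: "e > 0" for e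
  proof -
    obtain \<eta> \<theta> where \<eta>: "\<eta> > 0" "\<theta> > 0"
      "\<forall>x i j. i \<le> j \<longrightarrow> (\<forall>k\<in>{i..j}. x k \<in> K \<and> chordal (f (x k)) (f (x i)) < \<eta>) \<longrightarrow>
       (\<forall>k\<in>{i..<j}. dist (x k) (x (Suc k)) < \<theta>) \<longrightarrow> dist (x i) (x (j::nat)) < e"
      using uniformly_light_map[OF \<open>compact K\<close> fK e] by (elim exE conjE) (rule that)
    obtain d where d: "d > 0" "\<And>u v. \<bar>u - v\<bar> < d \<Longrightarrow> chordal (G u) (G v) < \<eta>"
      using Gc[OF \<eta>(1)] by blast
    obtain N where N: "inverse (real (Suc N)) < min \<theta> (d / 2)"
      using reals_Archimedean[of "min \<theta> (d/2)"] d \<eta> by auto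
    show ?thesis
    proof (rule exI[of _ "d/2"], intro conjI exI[of _ N] allI impI)
      fix n s t assume n: "n \<ge> N" and st: "a \<le> s" "s \<le> t" "t < s + d/2"
      have "inverse (real (Suc n)) \<le> inverse (real (Suc N))" using n by (intro le_imp_inverse_le) auto
      with N have n': "inverse (real (Suc n)) < \<theta>" "inverse (real (Suc n)) < d / 2" by linarith+
      obtain x i j where x: "i \<le> (j::nat)" "x i = \<alpha>0 n s" "x j = \<alpha>0 n t"
         "\<forall>k\<in>{i..j}. x k \<in> K \<and> (\<exists>u\<in>{s-inverse (Suc n)..t}. f (x k) = G (min u (T0 n)))"
         "\<forall>k\<in>{i..<j}. dist (x k) (x (Suc k)) < inverse (Suc n)"
        using chain[of s t n] st by blast
      have "dist (x i) (x j) < e"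
      proof (rule \<eta>(3)[rule_format, OF x(1)])
        fix k assume k: "k \<in> {i..j}"
        obtain u where u: "u \<in> {s-inverse (Suc n)..t}" "f (x k) = G (min u (T0 n))" using x(4) k by blast
        obtain v where v: "v \<in> {s-inverse (Suc n)..t}" "f (x i) = G (min v (T0 n))" using x(1,4) by force
        have "\<bar>u - v\<bar> < d" using u(1) v(1) st n' unfolding atLeastAtMost_iff by linarith
        then have "\<bar>min u (T0 n) - min v (T0 n)\<bar> < d" by linarith
        then show "x k \<in> K \<and> chordal (f (x k)) (f (x i)) < \<eta>"
          using d(2) x(4) k unfolding u(2) v(2) by blast
      qed (use x(5) n' in force)
      then show "dist (\<alpha>0 n s) (\<alpha>0 n t) < e" using x by simp
    qed (use d in auto)
  qed
  have cont: "\<exists>d>0. \<forall>s t. a \<le> s \<longrightarrow> s \<le> t \<longrightarrow> t < s + d \<longrightarrow> dist (\<alpha> s) (\<alpha> t) < e" if e: "e > 0" for e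
  proof -
    obtain d N where d: "d > 0" "\<And>n s t. n \<ge> N \<Longrightarrow> a \<le> s \<Longrightarrow> s \<le> t \<Longrightarrow> t < s + d \<Longrightarrow> dist (\<alpha>0 n s) (\<alpha>0 n t) < e/3"
      using equi[of "e/3", OF divide_pos_pos[OF e zero_less_numeral]] by blast
    show ?thesis
    proof (intro exI[of _ d] conjI allI impI d)
      fix s t assume st: "a \<le> s" "s \<le> t" "t < s + d"
      obtain n where n: "n \<ge> N" "\<forall>u\<in>{s,t}. dist (\<alpha>0 n u) (\<alpha> u) < e/3"
        using cl[of "{s,t}" "e/3" N] e by auto
      have "dist (\<alpha>0 n s) (\<alpha>0 n t) < e/3" "dist (\<alpha>0 n s) (\<alpha> s) < e/3" "dist (\<alpha>0 n t) (\<alpha> t) < e/3"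
        using d(2)[OF n(1) st] n(2) by auto
      then show "dist (\<alpha> s) (\<alpha> t) < e"
        using dist_triangle[of "\<alpha> s" "\<alpha> t" "\<alpha>0 n s"] dist_triangle[of "\<alpha>0 n s" "\<alpha> t" "\<alpha>0 n t"]
        by (simp add: dist_commute)
    qed
  qed
  \<comment> \<open>The trivial chain from t to t provides a parameter within 1/(n+1) of t at which
    G gives the value of f; continuity of f and G carries the equation to the limit.\<close>
  have f\<alpha>: "f (\<alpha> t) = G (min t T)" if t: "a \<le> t" for t
  proof -
    have "chordal (f (\<alpha> t)) (G (min t T)) \<le> e" if e: "e > 0" for e
    proof -
      obtain d1 where d1: "d1 > 0" "\<And>y. y \<in> K \<Longrightarrow> dist y (\<alpha> t) < d1 \<Longrightarrow> chordal (f y) (f (\<alpha> t)) < e/2"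
        using fK(1) \<alpha>K e unfolding ch_continuous_on_def by (metis half_gt_zero)
      obtain d where d: "d > 0" "\<And>u v. \<bar>u - v\<bar> < d \<Longrightarrow> chordal (G u) (G v) < e/2"
        using Gc[of "e/2"] e half_gt_zero by blast
      obtain N where N: "inverse (real (Suc N)) < d"
        using reals_Archimedean[OF d(1)] by auto
      obtain n where n: "n \<ge> N" "\<bar>T0 n - T\<bar> < min d d1" "dist (\<alpha>0 n t) (\<alpha> t) < min d d1"
        using cl[of "{t}" "min d d1" N] d d1 by auto
      have n': "inverse (real (Suc n)) < d"
        using le_imp_inverse_le[of "real (Suc N)" "real (Suc n)"] n N by linarith
      obtain x i j where x: "i \<le> (j::nat)" "x i = \<alpha>0 n t" "x j = \<alpha>0 n t"
         "\<forall>k\<in>{i..j}. x k \<in> K \<and> (\<exists>u\<in>{t-inverse (Suc n)..t}. f (x k) = G (min u (T0 n)))"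
        using chain[of t t n] t by blast
      then obtain u where u: "u \<in> {t-inverse (Suc n)..t}" "f (\<alpha>0 n t) = G (min u (T0 n))" by force
      have "\<bar>min u (T0 n) - min t T\<bar> < d" using u(1) n n' unfolding atLeastAtMost_iff by linarith
      then have "chordal (f (\<alpha>0 n t)) (G (min t T)) < e/2" using d(2) u(2) by simp
      moreover have "chordal (f (\<alpha>0 n t)) (f (\<alpha> t)) < e/2" using d1(2)[OF \<alpha>0K] n(3) by simp
      ultimately show ?thesis
        using chordal_triangle[of "f (\<alpha> t)" "G (min t T)" "f (\<alpha>0 n t)"]
          chordal_commute[of "f (\<alpha>0 n t)" "f (\<alpha> t)"] by linarith
    qed
    then have "chordal (f (\<alpha> t)) (G (min t T)) \<le> 0" by (rule field_le_epsilon[OF order.trans]) auto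
    then show ?thesis
      using chordal_eq_0_iff[of "f (\<alpha> t)" "G (min t T)"] by (simp add: chordal_eq_dist)
  qed
  have \<alpha>D: "\<alpha> t \<in> D" for t using \<alpha>K D by (auto simp: K_def)
  \<comment> \<open>Otherwise f(\<alpha>(T)) = G(T) would be the omitted value g(b), although
    \<alpha>(T) lies in D.\<close>
  have "T < b" using f\<alpha>[of T] T Gb[of T] \<alpha>D[of T] by (force simp: not_less[symmetric])
  have "\<alpha> a = x1"
  proof -
    have "dist x1 (\<alpha> a) < e" if "e > 0" for e using cl[of "{a}" e 0] that \<alpha>0a by auto
    then show ?thesis by (metis dist_pos_lt less_irrefl)
  qed
  \<comment> \<open>The exit happens at the moving times \<open>T0 n\<close>, where pointwise
    convergence says nothing; equicontinuity moves it to the fixed time T.\<close>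
  have exit: "dist (\<alpha> T) x0 \<ge> r2"
  proof (rule field_le_epsilon)
    fix e :: real assume e: "e > 0"
    obtain d N where d: "d > 0" "\<And>n s t. n \<ge> N \<Longrightarrow> a \<le> s \<Longrightarrow> s \<le> t \<Longrightarrow> t < s + d \<Longrightarrow> dist (\<alpha>0 n s) (\<alpha>0 n t) < e/2"
      using equi[of "e/2", OF divide_pos_pos[OF e zero_less_numeral]] by blast
    obtain n where n: "n \<ge> N" "\<bar>T0 n - T\<bar> < min d (e/2)" "dist (\<alpha>0 n T) (\<alpha> T) < min d (e/2)"
      using cl[of "{T}" "min d (e/2)" N] d e by auto
    have "dist (\<alpha>0 n (T0 n)) (\<alpha>0 n T) < e/2"
      using d(2)[OF n(1), of "T0 n" T] d(2)[OF n(1), of T "T0 n"] n(2) T(1) T0[of n]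
      by (cases "T \<le> T0 n") (auto simp: dist_commute)
    then show "r2 \<le> dist (\<alpha> T) x0 + e"
      using \<alpha>0T[of n] n(3) dist_triangle[of "\<alpha>0 n (T0 n)" x0 "\<alpha>0 n T"] dist_triangle[of "\<alpha>0 n T" x0 "\<alpha> T"]
      by simp
  qed
  show ?thesis
  proof (rule that[of T \<alpha>])
    show "continuous_on {a..T} \<alpha>"
      unfolding continuous_on_iff
    proof (intro ballI allI impI)
      fix t e assume t: "t \<in> {a..T}" and e: "(e::real) > 0"
      obtain d where d: "d > 0" "\<And>s t. a \<le> s \<Longrightarrow> s \<le> t \<Longrightarrow> t < s + d \<Longrightarrow> dist (\<alpha> s) (\<alpha> t) < e"
        using cont[OF e] by blast
      show "\<exists>d>0. \<forall>x'\<in>{a..T}. dist x' t < d \<longrightarrow> dist (\<alpha> x') (\<alpha> t) < e"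
      proof (intro exI[of _ d] conjI ballI impI d(1))
        fix s assume "s \<in> {a..T}" "dist s t < d"
        then show "dist (\<alpha> s) (\<alpha> t) < e" using d(2)[of s t] d(2)[of t s] t
          by (cases "s \<le> t") (auto simp: dist_real_def dist_commute)
      qed
    qed
    show "f (\<alpha> t) = g t" if "t \<in> {a..T}" for t
    proof -
      have "max a (min (min t T) b) = t" using that \<open>T < b\<close> unfolding atLeastAtMost_iff by linarith
      then show ?thesis using f\<alpha>[of t] that by (simp add: G_def)
    qed
  qed (use T(1) \<open>T < b\<close> \<open>\<alpha> a = x1\<close> exit in \<open>simp_all\<close>)
qed

text \<open>The lift is cut at its first arrival d at radius r2 and at its last visit c to radius r1
  before d. Between c and d it can touch neither sphere, so it runs inside the open ring.\<close>

lemma ring_crossing_lift: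
  fixes f :: "'a::euclidean_space \<Rightarrow> 'a option"
  assumes D: "open D" "cball x0 r3 \<subseteq> D" and r: "r1 < r2" "r2 < r3"
    and f: "ch_continuous_on D f" "open_map D f" "discrete_map D f"
    and g: "ch_path a b g" "g b \<notin> f ` D"
    and x1: "dist x1 x0 \<le> r1" "f x1 = g a"
  obtains c d \<alpha> where "a \<le> c" "c < d" "d \<le> b"
    "(c, d, Some \<circ> \<alpha>) \<in> Gam (Some ` sphere x0 r1) (Some ` sphere x0 r2) (Some ` ring r1 r2 x0)"
    "\<And>t. t \<in> {c..d} \<Longrightarrow> f (\<alpha> t) = g t"
proof -
  have "dist x1 x0 < r2" using x1(1) r(1) by simp
  then obtain T \<alpha> where T: "a \<le> T" "T \<le> b" and \<alpha>: "continuous_on {a..T} \<alpha>" "\<alpha> a = x1"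
    "dist (\<alpha> T) x0 \<ge> r2" "\<And>t. t \<in> {a..T} \<Longrightarrow> f (\<alpha> t) = g t"
    by (rule exiting_lift[OF D r(2) f g _ x1(2)]) (rule that; blast)
  define \<rho> where "\<rho> t = dist (\<alpha> t) x0" for t
  have \<rho>: "continuous_on {a..T} \<rho>" unfolding \<rho>_def by (intro continuous_intros \<alpha>)
  define A where "A = {t\<in>{a..T}. \<rho> t = r2}"
  have A: "closed A" "bdd_below A"
    unfolding A_def using continuous_closed_preimage_constant[OF \<rho>] by (auto simp: bdd_below_def)
  have "A \<noteq> {}" using IVT'[of \<rho> a r2 T] \<rho> T \<alpha> x1 r by (auto simp: A_def \<rho>_def)
  define d where "d = Inf A"
  have d: "d \<in> A" unfolding d_def using closed_contains_Inf[OF \<open>A \<noteq> {}\<close> A(2,1)] .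
  have \<rho>d: "continuous_on {a..d} \<rho>" using \<rho> d by (auto simp: A_def intro: continuous_on_subset)
  define B where "B = {t\<in>{a..d}. \<rho> t = r1}"
  have B: "closed B" "bdd_above B"
    unfolding B_def using continuous_closed_preimage_constant[OF \<rho>d] by (auto simp: bdd_above_def)
  have "B \<noteq> {}" using IVT'[of \<rho> a r1 d] \<rho>d d \<alpha> x1 r by (auto simp: B_def A_def \<rho>_def)
  define c where "c = Sup B"
  have c: "c \<in> B" unfolding c_def using closed_contains_Sup[OF \<open>B \<noteq> {}\<close> B(2,1)] .
  have cd: "a \<le> c" "c < d" "d \<le> T" "\<rho> c = r1" "\<rho> d = r2"
    using c d r unfolding A_def B_def by (auto simp: order.order_iff_strict)
  have in_ring: "r1 < \<rho> t \<and> \<rho> t < r2" if t: "c < t" "t < d" for t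
  proof
    show "\<rho> t < r2"
    proof (rule ccontr)
      assume "\<not> \<rho> t < r2"
      then obtain s where "s \<in> {c..t}" "\<rho> s = r2"
        using IVT'[of \<rho> c r2 t] continuous_on_subset[OF \<rho>, of "{c..t}"] cd t r by force
      then have "s \<in> A" using cd t by (auto simp: A_def)
      then have "d \<le> s" unfolding d_def by (rule cInf_lower[OF _ A(2)])
      then show False using \<open>s \<in> {c..t}\<close> t by auto
    qed
    show "r1 < \<rho> t"
    proof (rule ccontr)
      assume "\<not> r1 < \<rho> t"
      then obtain s where "s \<in> {t..d}" "\<rho> s = r1"
        using IVT'[of \<rho> t r1 d] continuous_on_subset[OF \<rho>, of "{t..d}"] cd t r by force
      then have "s \<in> B" using cd t by (auto simp: B_def)
      then have "s \<le> c" unfolding c_def by (rule cSup_upper[OF _ B(2)])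
      then show False using \<open>s \<in> {t..d}\<close> t by auto
    qed
  qed
  show ?thesis
  proof (rule that[of c d \<alpha>])
    have "continuous_on {c..d} \<alpha>" using \<alpha>(1) cd by (auto intro: continuous_on_subset)
    then have "continuous_on {c..d} (\<lambda>t. stereo (Some (\<alpha> t)))"
      using continuous_on_compose2[OF continuous_on_stereo_Some[of UNIV]] by auto
    then have "ch_path c d (Some \<circ> \<alpha>)" using cd by (simp add: ch_path_iff)
    then show "(c, d, Some \<circ> \<alpha>) \<in> Gam (Some ` sphere x0 r1) (Some ` sphere x0 r2) (Some ` ring r1 r2 x0)"
      using cd in_ring unfolding Gam_def by (auto simp: \<rho>_def ring_def dist_commute)
  qed (use cd T \<alpha> in auto)
qed

section \<open>Arc length and line integrals\<close>

text \<open>The recursive form of the sum in \<open>path_length\<close>, which permits induction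
  when points are inserted or lists are cut.\<close>

fun chain_length :: "(real \<Rightarrow> 'a::metric_space) \<Rightarrow> real list \<Rightarrow> ennreal" where
  "chain_length g (x # y # xs) = ennreal (dist (g x) (g y)) + chain_length g (y # xs)"
| "chain_length g _ = 0"

lemma chain_length_eq_sum:
  "chain_length g ts = (\<Sum>i<length ts - 1. ennreal (dist (g (ts ! i)) (g (ts ! Suc i))))"
proof (induction g ts rule: chain_length.induct)
  case (1 g x y xs)
  then show ?case by (simp add: sum.lessThan_Suc_shift del: sum.lessThan_Suc)
qed auto

lemma path_length_chain:
  "path_length g c d = (SUP ts \<in> {ts. sorted ts \<and> set ts \<subseteq> {c..d}}. chain_length g ts)"
  by (simp add: path_length_def chain_length_eq_sum)

lemma chain_length_le_path_length:
  "sorted ts \<Longrightarrow> set ts \<subseteq> {c..d} \<Longrightarrow> chain_length g ts \<le> path_length g c d"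
  unfolding path_length_chain by (rule SUP_upper) auto

lemma path_length_least:
  "(\<And>ts. sorted ts \<Longrightarrow> set ts \<subseteq> {c..d} \<Longrightarrow> chain_length g ts \<le> B) \<Longrightarrow> path_length g c d \<le> B"
  unfolding path_length_chain by (rule SUP_least) auto

lemma chain_length_cong: "(\<And>t. t \<in> set ts \<Longrightarrow> g t = g' t) \<Longrightarrow> chain_length g ts = chain_length g' ts"
  by (induction g ts rule: chain_length.induct) auto

lemma path_length_cong: "(\<And>t. t \<in> {c..d} \<Longrightarrow> g t = g' t) \<Longrightarrow> path_length g c d = path_length g' c d"
  unfolding path_length_chain by (intro SUP_cong refl chain_length_cong) auto

lemma path_length_mono: "c' \<le> c \<Longrightarrow> d \<le> d' \<Longrightarrow> path_length g c d \<le> path_length g c' d'"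
  by (rule path_length_least, rule chain_length_le_path_length) (auto dest!: subsetD)

lemma chain_length_Cons_le: "chain_length g xs \<le> chain_length g (x # xs)"
  by (cases xs) auto

lemma chain_length_triangle: "chain_length g (x # xs) \<le> ennreal (dist (g x) (g y)) + chain_length g (y # xs)"
proof (cases xs)
  case (Cons z zs)
  have "ennreal (dist (g x) (g z)) \<le> ennreal (dist (g x) (g y)) + ennreal (dist (g y) (g z))"
    by (simp add: dist_triangle flip: ennreal_plus)
  then show ?thesis by (simp add: Cons add_right_mono flip: add.assoc)
qed auto

lemma chain_length_append_ge: "chain_length g xs + chain_length g ys \<le> chain_length g (xs @ ys)"
proof (induction g xs rule: chain_length.induct)
  case (1 g x y xs)
  then show ?case by (simp add: add.assoc add_left_mono)
next
  case ("2_2" g v)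
  then show ?case by (simp add: chain_length_Cons_le)
qed auto

lemma chain_length_insert:
  "chain_length g (xs @ ys) \<le> chain_length g (xs @ [m]) + chain_length g (m # ys)"
proof (induction g xs rule: chain_length.induct)
  case (1 g x y xs)
  then show ?case by (simp add: add.assoc add_left_mono)
next
  case ("2_1" g)
  then show ?case by (simp add: chain_length_Cons_le)
next
  case ("2_2" g x)
  then show ?case using chain_length_triangle[of g x ys m] by simp
qed

lemma sorted_split_filter:
  fixes m :: real
  assumes "sorted ts"
  shows "ts = filter (\<lambda>t. t \<le> m) ts @ filter (\<lambda>t. \<not> t \<le> m) ts"
  using assms
proof (induction ts)
  case (Cons a ts)
  show ?case
  proof (cases "a \<le> m")
    case False
    then have "\<forall>t\<in>set ts. \<not> t \<le> m" using Cons.prems by auto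
    then have "filter (\<lambda>t. t \<le> m) ts = []" "filter (\<lambda>t. \<not> t \<le> m) ts = ts"
      by (auto simp: filter_empty_conv filter_id_conv)
    then show ?thesis using False by simp
  qed (use Cons in auto)
qed auto

lemma chain_length_split:
  assumes "sorted ts"
  shows "chain_length g ts \<le> chain_length g (filter (\<lambda>t. t \<le> m) ts @ [m]) + chain_length g (m # filter (\<lambda>t. \<not> t \<le> m) ts)"
  using chain_length_insert[of g "filter (\<lambda>t. t \<le> m) ts" "filter (\<lambda>t. \<not> t \<le> m) ts" m]
    sorted_split_filter[OF assms, of m] by simp

lemma path_length_add:
  assumes "c \<le> m" "m \<le> d"
  shows "path_length g c d = path_length g c m + path_length g m d"
proof (rule antisym)
  show "path_length g c d \<le> path_length g c m + path_length g m d"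
  proof (rule path_length_least)
    fix ts assume ts: "sorted ts" "set ts \<subseteq> {c..d}"
    have "chain_length g (filter (\<lambda>t. t \<le> m) ts @ [m]) \<le> path_length g c m"
      using ts assms by (intro chain_length_le_path_length) (auto simp: sorted_append sorted_wrt_filter)
    moreover have "chain_length g (m # filter (\<lambda>t. \<not> t \<le> m) ts) \<le> path_length g m d"
      using ts assms by (intro chain_length_le_path_length) (auto simp: sorted_wrt_filter)
    ultimately show "chain_length g ts \<le> path_length g c m + path_length g m d"
      using chain_length_split[OF ts(1), of g m] by (meson add_mono order_trans)
  qed
  show "path_length g c m + path_length g m d \<le> path_length g c d"
  proof -
    have ne: "{ts. sorted ts \<and> set ts \<subseteq> {a..b}} \<noteq> {}" for a b :: real
      by (auto intro!: exI[of _ "[]"])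
    have "chain_length g xs + path_length g m d \<le> path_length g c d" if xs: "sorted xs" "set xs \<subseteq> {c..m}" for xs
    proof -
      have "chain_length g ys + chain_length g xs \<le> path_length g c d" if ys: "sorted ys" "set ys \<subseteq> {m..d}" for ys
      proof -
        have "chain_length g (xs @ ys) \<le> path_length g c d"
          using xs ys assms by (intro chain_length_le_path_length) (force simp: sorted_append)+
        then show ?thesis using chain_length_append_ge[of g xs ys] by (simp add: add.commute)
      qed
      then have "path_length g m d + chain_length g xs \<le> path_length g c d"
        unfolding path_length_chain[of g m d] ennreal_SUP_add_left[OF ne, symmetric]
        by (intro SUP_least) auto
      then show ?thesis by (simp add: add.commute)
    qed
    then show ?thesis
      unfolding path_length_chain[of g c m] ennreal_SUP_add_left[OF ne, symmetric]
      by (intro SUP_least) auto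
  qed
qed

text \<open>Sorted lists may repeat a point. Repetitions of t contribute nothing, and only the final
  jump to s remains.\<close>

lemma chain_length_two_values:
  "set xs \<subseteq> {t} \<Longrightarrow> chain_length g (xs @ [s]) \<le> ennreal (dist (g t) (g s))"
proof (induction xs)
  case (Cons x xs)
  then have "x = t" and *: "chain_length g (xs @ [s]) \<le> ennreal (dist (g t) (g s))" by auto
  show ?case
  proof (cases xs)
    case (Cons y ys)
    with Cons.prems have "y = t" by auto
    with * \<open>x = t\<close> show ?thesis by (simp add: Cons)
  qed (simp add: \<open>x = t\<close>)
qed simp

text \<open>Cutting a nearly optimal chain just after its first point shows that a continuous
  rectifiable path has short initial arcs.\<close>

lemma path_length_small_right:
  assumes td: "t < d" and g: "continuous_on {t..d} g" and fin: "path_length g t d < \<infinity>" and e: "e > 0"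
  shows "\<forall>\<^sub>F s in at_right t. path_length g t s < ennreal e"
proof -
  have "\<exists>s>t. s \<le> d \<and> path_length g t s < ennreal e"
  proof (cases "path_length g t d < ennreal e")
    case True then show ?thesis using td by auto
  next
    case False
    obtain L where L: "L \<ge> 0" "path_length g t d = ennreal L"
      using fin by (cases "path_length g t d") auto
    \<comment> \<open>L - e/2 may be negative, in which case it becomes 0 in \<open>ennreal\<close>;
      the inequality stays strict because the length is at least e > 0.\<close>
    have "ennreal (L - e/2) < path_length g t d"
      using e False unfolding L(2) by (intro ennreal_lessI) (auto simp: not_less ennreal_less_iff L(1))
    then obtain ts where ts: "sorted ts" "set ts \<subseteq> {t..d}" "ennreal (L - e/2) < chain_length g ts"
      unfolding path_length_chain[of g t d] less_SUP_iff by auto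
    have ev1: "\<forall>\<^sub>F s in at_right t. s \<le> d \<and> t < s"
      using td by (auto intro!: eventually_conj eventually_at_right_less simp: eventually_at_right_field intro: less_imp_le)
    have ev2: "\<forall>\<^sub>F s in at_right t. \<forall>x\<in>set ts. t < x \<longrightarrow> s < x"
    proof (intro eventually_ball_finite ballI)
      fix x show "\<forall>\<^sub>F s in at_right t. t < x \<longrightarrow> s < x"
        by (cases "t < x") (auto simp: eventually_at_right_field)
    qed auto
    have "(g \<longlongrightarrow> g t) (at_right t)"
      using g td by (metis continuous_on_Icc_at_rightD)
    then have ev3: "\<forall>\<^sub>F s in at_right t. dist (g s) (g t) < e/2"
      using e unfolding tendsto_iff by (metis half_gt_zero)
    \<comment> \<open>s precedes all chain points beyond t, so the part of the chain up to s
      consists of copies of t and costs only dist (g t) (g s) < e/2.\<close>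
    obtain s where s: "s \<le> d" "t < s" "\<forall>x\<in>set ts. t < x \<longrightarrow> s < x" "dist (g s) (g t) < e/2"
      using eventually_happens'[OF _ eventually_conj[OF ev1 eventually_conj[OF ev2 ev3]]] by auto
    have 1: "chain_length g (filter (\<lambda>t. t \<le> s) ts @ [s]) \<le> ennreal (dist (g t) (g s))"
      by (rule chain_length_two_values) (use s(3) ts(2) in \<open>force simp: not_less[symmetric]\<close>)
    have 2: "chain_length g (s # filter (\<lambda>t. \<not> t \<le> s) ts) \<le> path_length g s d"
      using ts s by (intro chain_length_le_path_length) (auto simp: sorted_wrt_filter)
    have fin2: "path_length g s d < \<infinity>" "path_length g t s < \<infinity>"
      using path_length_mono[of t s d d g] path_length_mono[of t t s d g] s fin by auto
    have "path_length g t d \<le> ennreal (L - e/2) + ennreal (e/2)"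
      using e L(1) by (cases "L - e/2 \<ge> 0") (auto simp: L(2) ennreal_neg intro: ennreal_leI simp flip: ennreal_plus)
    also have "\<dots> \<le> chain_length g ts + ennreal (e/2)" using ts(3) by (simp add: add_right_mono)
    also have "chain_length g ts \<le> ennreal (dist (g t) (g s)) + path_length g s d"
      using chain_length_split[OF ts(1), of g s] 1 2 by (meson add_mono order_trans)
    finally have "path_length g t s + path_length g s d \<le> ennreal (dist (g t) (g s)) + path_length g s d + ennreal (e/2)"
      using path_length_add[of t s d g] s by (simp add: add_right_mono)
    then have "path_length g s d + path_length g t s \<le> path_length g s d + (ennreal (dist (g t) (g s)) + ennreal (e/2))"
      by (simp add: ac_simps)
    then have "path_length g t s \<le> ennreal (dist (g t) (g s)) + ennreal (e/2)"
      using fin2 by (metis ennreal_add_left_cancel_le infinity_ennreal_def less_irrefl)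
    also have "\<dots> = ennreal (dist (g t) (g s) + e/2)" using e by simp
    also have "\<dots> < ennreal e" using s(4) e by (intro ennreal_lessI) (auto simp: dist_commute)
    finally show ?thesis using s by auto
  qed
  then obtain s where "s > t" "path_length g t s < ennreal e" by blast
  then show ?thesis unfolding eventually_at_right_field
    using path_length_mono[of t t _ s g] by (meson le_less_trans less_imp_le order_refl)
qed

section \<open>Line integrals as integrals against arc length\<close>

lemma nn_integral_Ioc_cong_measure:
  fixes M N :: "real measure"
  assumes sets: "sets M = sets borel" "sets N = sets borel" and cd: "c \<le> d"
    and eq: "\<And>a. c \<le> a \<Longrightarrow> a \<le> d \<Longrightarrow> emeasure M {a<..d} = emeasure N {a<..d}"
    and fin: "emeasure M {c<..d} < \<infinity>" and f: "f \<in> borel_measurable borel"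
  shows "(\<integral>\<^sup>+t\<in>{c<..d}. f t \<partial>M) = (\<integral>\<^sup>+t\<in>{c<..d}. f t \<partial>N)"
proof -
  note [measurable_cong] = sets and [measurable] = f
  \<comment> \<open>After restriction to \<open>{c<..d}\<close> every ray becomes a tail ending at
    d, so agreement of the measures on these tails determines the restrictions.\<close>
  have em: "emeasure (density K (indicator {c<..d})) {x<..} = emeasure K {max c (min x d)<..d}"
    if "sets K = sets borel" for K :: "real measure" and x
  proof -
    note [measurable_cong] = that
    have "{c<..d} \<inter> {x<..} = {max c (min x d)<..d}" by auto
    then show ?thesis by (subst emeasure_density) (auto simp: that simp flip: indicator_inter_arith)
  qed
  have "density M (indicator {c<..d}) = density N (indicator {c<..d})"
  proof (rule measure_eqI_lessThan)
    fix x
    show "emeasure (density M (indicator {c<..d})) {x<..} = emeasure (density N (indicator {c<..d})) {x<..}"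
      unfolding em[OF sets(1)] em[OF sets(2)] using cd by (intro eq) auto
    have "emeasure M {max c (min x d)<..d} \<le> emeasure M {c<..d}"
      by (rule emeasure_mono) (auto simp: sets)
    then show "emeasure (density M (indicator {c<..d})) {x<..} < \<infinity>"
      unfolding em[OF sets(1)] using fin by (rule le_less_trans)
  qed (simp_all add: sets)
  then have "(\<integral>\<^sup>+t. f t \<partial>density M (indicator {c<..d})) = (\<integral>\<^sup>+t. f t \<partial>density N (indicator {c<..d}))"
    by simp
  then show ?thesis by (simp add: nn_integral_density mult.commute)
qed

text \<open>The distribution function in \<open>line_int\<close>: it vanishes to the left of c and
  is constant to the right of d.\<close>

definition arc_length_fun :: "(real \<Rightarrow> 'a::euclidean_space) \<Rightarrow> real \<Rightarrow> real \<Rightarrow> real \<Rightarrow> real" where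
  "arc_length_fun g c d t = enn2real (path_length g c (min t d))"

lemma path_length_degenerate:
  assumes "t \<le> c" shows "path_length g c t = 0"
proof -
  have "chain_length g ts = 0" if "sorted ts" "set ts \<subseteq> {c..t}" for ts
    using that
  proof (induction g ts rule: chain_length.induct)
    case (1 g x y xs)
    then have "x = y" using assms by auto
    with 1 show ?case by auto
  qed auto
  then have "path_length g c t \<le> 0" by (intro path_length_least) auto
  then show ?thesis by simp
qed

lemma measurable_line_integrand:
  fixes g :: "real \<Rightarrow> 'a::euclidean_space"
  assumes "continuous_on {c..d} g" "\<rho> \<in> borel_measurable borel"
  shows "(\<lambda>t. \<rho> (g t) * indicator {c..d} t :: ennreal) \<in> borel_measurable borel"
proof -
  have "(\<lambda>t. \<rho> (g t)) \<in> borel_measurable (restrict_space borel {c..d})"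
    using borel_measurable_continuous_on_restrict[OF assms(1)] assms(2) by (rule measurable_compose)
  then show ?thesis by (subst (asm) borel_measurable_restrict_space_iff_ennreal) auto
qed

context
  fixes g :: "real \<Rightarrow> 'a::euclidean_space" and c d :: real
  assumes cd: "c \<le> d" and g: "continuous_on {c..d} g" and fin: "path_length g c d < \<infinity>"
begin

lemma path_length_finite: "t \<le> d \<Longrightarrow> path_length g c t \<noteq> \<infinity>"
  using path_length_mono[of c c t d g] fin by auto

lemma arc_length_fun_mono: "s \<le> t \<Longrightarrow> arc_length_fun g c d s \<le> arc_length_fun g c d t"
  unfolding arc_length_fun_def using path_length_finite[of "min t d"]
  by (intro enn2real_mono path_length_mono) (auto simp: less_top)

lemma ennreal_arc_length_fun: "ennreal (arc_length_fun g c d t) = path_length g c (min t d)"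
  unfolding arc_length_fun_def using path_length_finite[of "min t d"]
  by (intro ennreal_enn2real) (auto simp: less_top)

lemma arc_length_fun_diff:
  assumes "s \<le> t"
  shows "ennreal (arc_length_fun g c d t - arc_length_fun g c d s) =
    path_length g (max c (min s d)) (min t d)"
proof (cases "c \<le> min s d")
  case True
  have "path_length g c (min t d) = path_length g c (min s d) + path_length g (min s d) (min t d)"
    using True assms by (intro path_length_add) auto
  then have "ennreal (arc_length_fun g c d t) = ennreal (arc_length_fun g c d s) + path_length g (min s d) (min t d)"
    by (simp add: ennreal_arc_length_fun)
  moreover have "ennreal (arc_length_fun g c d t - arc_length_fun g c d s) =
     ennreal (arc_length_fun g c d t) - ennreal (arc_length_fun g c d s)"
    by (rule ennreal_minus[symmetric]) (simp add: arc_length_fun_def)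
  ultimately show ?thesis using True by (simp add: max_def)
next
  case False
  then have "min s d \<le> c" by linarith
  then have "arc_length_fun g c d s = 0" by (simp only: arc_length_fun_def path_length_degenerate enn2real_0)
  moreover have "max c (min s d) = c" using False by linarith
  ultimately show ?thesis by (simp only: ennreal_arc_length_fun diff_zero)
qed

text \<open>\<open>interval_measure\<close> assigns half-open intervals the increments of its
  function only if that function is right continuous. Here continuity of g enters, through short
  initial arcs.\<close>

lemma arc_length_fun_continuous: "continuous (at_right t) (arc_length_fun g c d)"
proof -
  have "\<forall>\<^sub>F s in at_right t. dist (arc_length_fun g c d s) (arc_length_fun g c d t) < e" if e: "e > 0" for e
  proof -
    let ?t = "max c t"
    have "\<forall>\<^sub>F s in at_right t. path_length g (max c (min t d)) (min s d) < ennreal e"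
    proof (cases "?t < d")
      case True
      have "\<forall>\<^sub>F s in at_right ?t. path_length g ?t s < ennreal e"
      proof (rule path_length_small_right[OF True _ _ e])
        show "continuous_on {?t..d} g" using g by (rule continuous_on_subset) auto
        show "path_length g ?t d < \<infinity>" using path_length_mono[of c ?t d d g] fin by auto
      qed
      then obtain b where b: "b > ?t" "\<And>s. ?t < s \<Longrightarrow> s < b \<Longrightarrow> path_length g ?t s < ennreal e"
        unfolding eventually_at_right_field by blast
      have "path_length g (max c (min t d)) (min s d) < ennreal e" if "t < s" "s < min b d" for s
      proof -
        have eq: "max c (min t d) = ?t" "min s d = s" using True that by auto
        show ?thesis
        proof (cases "?t < s")
          case False
          then have "path_length g ?t s = 0" by (intro path_length_degenerate) linarith
          then show ?thesis using e unfolding eq by simp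
        qed (use b that eq in auto)
      qed
      then show ?thesis using b True unfolding eventually_at_right_field
        by (intro exI[of _ "min b d"]) auto
    next
      case False
      then have "path_length g (max c (min t d)) (min s d) = 0" for s
        using cd by (intro path_length_degenerate) auto
      then show ?thesis using e by simp
    qed
    moreover have "\<forall>\<^sub>F s in at_right t. t < s" by (simp add: eventually_at_right_less)
    ultimately show ?thesis
    proof eventually_elim
      case (elim s)
      have "ennreal (arc_length_fun g c d s - arc_length_fun g c d t) < ennreal e"
        using elim by (simp add: arc_length_fun_diff)
      then show ?case using arc_length_fun_mono[of t s] elim(2)
        by (auto simp: dist_real_def ennreal_less_iff)
    qed
  qed
  then show ?thesis by (simp add: continuous_within tendsto_iff)
qed

lemma emeasure_arc_length:
  assumes "c \<le> s" "s \<le> t" "t \<le> d"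
  shows "emeasure (interval_measure (arc_length_fun g c d)) {s<..t} = path_length g s t"
  using assms by (subst emeasure_interval_measure_Ioc)
    (auto simp: arc_length_fun_mono arc_length_fun_continuous arc_length_fun_diff max_def)

text \<open>The point c carries no mass, as the distribution function vanishes up to c. Half-open
  intervals then fit together without counting endpoints twice.\<close>

lemma line_int_eq:
  "line_int g c d \<rho> = (\<integral>\<^sup>+t\<in>{c<..d}. \<rho> (g t) \<partial>interval_measure (arc_length_fun g c d))"
proof -
  let ?M = "interval_measure (arc_length_fun g c d)"
  have "emeasure ?M {c} \<le> emeasure ?M {c - 1<..c}" by (rule emeasure_mono) auto
  also have "\<dots> = ennreal (arc_length_fun g c d c - arc_length_fun g c d (c - 1))"
    by (rule emeasure_interval_measure_Ioc) (auto simp: arc_length_fun_mono arc_length_fun_continuous)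
  also have "\<dots> = 0" using cd by (simp add: arc_length_fun_def path_length_degenerate)
  finally have "{c} \<in> null_sets ?M" by (auto simp: null_sets_def)
  then have "AE t in ?M. t \<noteq> c" by (auto dest: AE_not_in)
  then have ae: "AE t in ?M. \<rho> (g t) * indicator {c..d} t = \<rho> (g t) * indicator {c<..d} t"
    by (rule eventually_mono) (auto simp: indicator_def)
  have F: "(\<lambda>t. enn2real (path_length g c (min t d))) = arc_length_fun g c d"
    by (simp add: fun_eq_iff arc_length_fun_def)
  show ?thesis unfolding line_int_def F by (rule nn_integral_cong_AE[OF ae])
qed

text \<open>Any measure with the right tails may replace arc length: the arc length measure of a
  longer interval, or for straight paths a multiple of Lebesgue measure.\<close>

lemma line_int_eq_measure:
  assumes M: "sets M = sets borel" and \<rho>: "\<rho> \<in> borel_measurable borel"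
    and eq: "\<And>a. c \<le> a \<Longrightarrow> a \<le> d \<Longrightarrow> emeasure M {a<..d} = path_length g a d"
  shows "line_int g c d \<rho> = (\<integral>\<^sup>+t\<in>{c<..d}. \<rho> (g t) \<partial>M)"
proof -
  have "(\<lambda>t. \<rho> (g t) * indicator {c..d} t) \<in> borel_measurable borel"
    using g \<rho> by (rule measurable_line_integrand)
  then have "(\<integral>\<^sup>+t\<in>{c<..d}. (\<rho> (g t) * indicator {c..d} t) \<partial>interval_measure (arc_length_fun g c d)) =
    (\<integral>\<^sup>+t\<in>{c<..d}. (\<rho> (g t) * indicator {c..d} t) \<partial>M)"
    using cd fin by (intro nn_integral_Ioc_cong_measure) (auto simp: M emeasure_arc_length eq)
  moreover have "(\<rho> (g t) * indicator {c..d} t) * indicator {c<..d} t = \<rho> (g t) * indicator {c<..d} t" for t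
    by (auto simp: indicator_def)
  ultimately show ?thesis unfolding line_int_eq by simp
qed

end

text \<open>Both pieces are computed with the arc length measure of the whole interval, after which
  this is additivity over a disjoint union.\<close>

lemma line_int_add:
  assumes c: "c \<le> m" "m \<le> d" and g: "continuous_on {c..d} g" and fin: "path_length g c d < \<infinity>"
    and \<rho>: "\<rho> \<in> borel_measurable borel"
  shows "line_int g c d \<rho> \<le> line_int g c m \<rho> + line_int g m d \<rho>"
proof -
  let ?M = "interval_measure (arc_length_fun g c d)"
  have cd: "c \<le> d" using c by simp
  have g': "continuous_on {c..m} g" "continuous_on {m..d} g" using g c by (auto intro: continuous_on_subset)
  have fin': "path_length g c m < \<infinity>" "path_length g m d < \<infinity>"
    using path_length_mono[of c c m d g] path_length_mono[of c m d d g] c fin by auto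
  note em = emeasure_arc_length[OF cd g fin]
  have 1: "line_int g c m \<rho> = (\<integral>\<^sup>+t\<in>{c<..m}. \<rho> (g t) \<partial>?M)"
    using c by (intro line_int_eq_measure[OF c(1) g'(1) fin'(1) _ \<rho>]) (auto simp: em)
  have 2: "line_int g m d \<rho> = (\<integral>\<^sup>+t\<in>{m<..d}. \<rho> (g t) \<partial>?M)"
    using c by (intro line_int_eq_measure[OF c(2) g'(2) fin'(2) _ \<rho>]) (auto simp: em)
  have meas: "(\<lambda>t. \<rho> (g t) * indicator {c..d} t) \<in> borel_measurable borel"
    using g \<rho> by (rule measurable_line_integrand)
  have ind: "\<rho> (g t) * indicator S t = (\<rho> (g t) * indicator {c..d} t) * indicator S t" if "S \<subseteq> {c..d}" for S t
    using that by (auto simp: indicator_def)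
  have m: "(\<lambda>t. \<rho> (g t) * indicator S t) \<in> borel_measurable ?M" if "S \<subseteq> {c..d}" "S \<in> sets borel" for S
    unfolding ind[OF that(1)] using meas that(2) by measurable
  have "line_int g c d \<rho> = (\<integral>\<^sup>+t. \<rho> (g t) * indicator {c<..m} t + \<rho> (g t) * indicator {m<..d} t \<partial>?M)"
    unfolding line_int_eq[OF cd g fin] using c by (intro nn_integral_cong) (auto simp: indicator_def)
  also have "\<dots> = line_int g c m \<rho> + line_int g m d \<rho>"
    unfolding 1 2 using c by (intro nn_integral_add m) auto
  finally show ?thesis by simp
qed

lemma line_int_cong:
  assumes "\<And>t. t \<in> {c..d} \<Longrightarrow> g t = g' t"
  shows "line_int g c d \<rho> = line_int g' c d \<rho>"
proof -
  have "path_length g c (min t d) = path_length g' c (min t d)" for t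
    using assms by (intro path_length_cong) auto
  moreover have "\<rho> (g t) * indicator {c..d} t = \<rho> (g' t) * indicator {c..d} t" for t
    using assms by (auto simp: indicator_def)
  ultimately show ?thesis unfolding line_int_def by simp
qed

section \<open>Line integrals along paths that may pass through infinity\<close>

definition interval_families :: "'a::euclidean_space ext_path \<Rightarrow> (real \<times> real) set set" where
  "interval_families p = {F. finite F \<and> (\<forall>(c, d)\<in>F. c \<le> d \<and> {c..d} \<subseteq> fin_params p)
                 \<and> disjoint_family_on (\<lambda>(c, d). {c..d::real}) F}"

lemma interval_families_iff:
  "F \<in> interval_families p \<longleftrightarrow> finite F \<and> (\<forall>x\<in>F. fst x \<le> snd x \<and> {fst x..snd x} \<subseteq> fin_params p) \<and>
     (\<forall>x\<in>F. \<forall>y\<in>F. x \<noteq> y \<longrightarrow> {fst x..snd x} \<inter> {fst y..snd y} = {})"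
  unfolding interval_families_def disjoint_family_on_def case_prod_unfold by blast

lemma ext_line_int_eq:
  "ext_line_int (a, b, g) \<rho> = (SUP F \<in> interval_families (a, b, g). \<Sum>(c, d)\<in>F. line_int (the \<circ> g) c d \<rho>)"
  by (simp add: ext_line_int_def interval_families_def)

lemma ext_line_int_subpath:
  assumes "a \<le> a'" "b' \<le> b"
  shows "ext_line_int (a', b', g) \<rho> \<le> ext_line_int (a, b, g) \<rho>"
  unfolding ext_line_int_eq
proof (rule SUP_subset_mono)
  have "fin_params (a', b', g) \<subseteq> fin_params (a, b, g)" using assms by (auto simp: fin_params_def)
  then show "interval_families (a', b', g) \<subseteq> interval_families (a, b, g)"
    unfolding interval_families_def by blast
qed auto

lemma loc_rectifiable_subpath:
  assumes "loc_rectifiable (a, b, g)" "a \<le> a'" "b' \<le> b"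
  shows "loc_rectifiable (a', b', g)"
proof -
  have "fin_params (a', b', g) \<subseteq> fin_params (a, b, g)" using assms by (auto simp: fin_params_def)
  with assms show ?thesis unfolding loc_rectifiable_def by auto
qed

lemma fin_params_cong:
  "(\<And>t. t \<in> {a..b} \<Longrightarrow> g t = g' t) \<Longrightarrow> fin_params (a, b, g) = fin_params (a, b, g')"
  by (auto simp: fin_params_def)

lemma ext_line_int_cong:
  assumes "\<And>t. t \<in> {a..b} \<Longrightarrow> g t = g' t"
  shows "ext_line_int (a, b, g) \<rho> = ext_line_int (a, b, g') \<rho>"
proof -
  have "fin_params (a, b, g) = fin_params (a, b, g')" by (rule fin_params_cong) (rule assms)
  then have eq: "interval_families (a, b, g) = interval_families (a, b, g')"
    unfolding interval_families_def by simp
  show ?thesis unfolding ext_line_int_eq eq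
  proof (intro SUP_cong refl sum.cong)
    fix F x assume F: "F \<in> interval_families (a, b, g')" and x: "x \<in> F"
    obtain c d where [simp]: "x = (c, d)" by (cases x)
    have "{c..d} \<subseteq> fin_params (a, b, g')" using F x unfolding interval_families_iff by force
    then have "{c..d} \<subseteq> {a..b}" by (auto simp: fin_params_def)
    then show "(case x of (c, d) \<Rightarrow> line_int (the \<circ> g) c d \<rho>) = (case x of (c, d) \<Rightarrow> line_int (the \<circ> g') c d \<rho>)"
      using assms by (auto intro!: line_int_cong)
  qed
qed

lemma loc_rectifiable_cong:
  assumes "\<And>t. t \<in> {a..b} \<Longrightarrow> g t = g' t"
  shows "loc_rectifiable (a, b, g) \<longleftrightarrow> loc_rectifiable (a, b, g')"
proof -
  have "path_length (the \<circ> g) c d = path_length (the \<circ> g') c d" if "{c..d} \<subseteq> fin_params (a, b, g')" for c d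
    using that assms by (intro path_length_cong) (auto simp: fin_params_def)
  moreover have "fin_params (a, b, g) = fin_params (a, b, g')" by (rule fin_params_cong) (rule assms)
  ultimately show ?thesis unfolding loc_rectifiable_def prod.case by metis
qed

lemma loc_rectifiable_concat:
  assumes "loc_rectifiable (a, m, g)" "loc_rectifiable (m, b, g)"
  shows "loc_rectifiable (a, b, g)"
  unfolding loc_rectifiable_def prod.case
proof (intro allI impI)
  fix c d assume *: "c \<le> d \<and> {c..d} \<subseteq> fin_params (a, b, g)"
  have 1: "path_length (the \<circ> g) c (min d m) < \<infinity>" if "c \<le> m"
  proof -
    have "c \<le> min d m \<and> {c..min d m} \<subseteq> fin_params (a, m, g)"
      using * that by (auto simp: fin_params_def subset_iff)
    then show ?thesis using assms(1) unfolding loc_rectifiable_def prod.case by blast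
  qed
  have 2: "path_length (the \<circ> g) (max c m) d < \<infinity>" if "m \<le> d"
  proof -
    have "max c m \<le> d \<and> {max c m..d} \<subseteq> fin_params (m, b, g)"
      using * that by (auto simp: fin_params_def subset_iff)
    then show ?thesis using assms(2) unfolding loc_rectifiable_def prod.case by blast
  qed
  show "path_length (the \<circ> g) c d < \<infinity>"
  proof (cases "c \<le> m \<and> m \<le> d")
    case True
    then have "min d m = m" "max c m = m" by auto
    then show ?thesis using 1 2 True path_length_add[of c m d "the \<circ> g"] by simp
  next
    case False
    then show ?thesis using 1 2 * by (cases "c \<le> m") (auto simp: max_def min_def)
  qed
qed

text \<open>Cutting intervals at m alters only one endpoint of each; the other endpoint still
  identifies the interval, so no two cut intervals coincide and sums can be reindexed.\<close>

lemma interval_families_fst_inj: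
  assumes "F \<in> interval_families p" shows "inj_on fst F" "inj_on snd F"
proof -
  have *: "x = y" if xy: "x \<in> F" "y \<in> F" and t: "t \<in> {fst x..snd x}" "t \<in> {fst y..snd y}" for x y t
    using assms that unfolding interval_families_iff by blast
  have le: "fst x \<le> snd x" if "x \<in> F" for x using assms that by (simp add: interval_families_iff)
  show "inj_on fst F" using * le by (intro inj_onI) (metis atLeastAtMost_iff order_refl)
  show "inj_on snd F" using * le by (intro inj_onI) (metis atLeastAtMost_iff order_refl)
qed

text \<open>Every finite family for the whole path is cut at m into one family for each part. An
  interval that contains m contributes to both families and is split by
  \<open>line_int_add\<close>.\<close>

lemma ext_line_int_concat:
  assumes p: "ch_path a b g" and r: "loc_rectifiable (a, b, g)" and \<rho>: "\<rho> \<in> borel_measurable borel"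
  shows "ext_line_int (a, b, g) \<rho> \<le> ext_line_int (a, m, g) \<rho> + ext_line_int (m, b, g) \<rho>"
  unfolding ext_line_int_eq[of a b]
proof (rule SUP_least)
  fix F assume F: "F \<in> interval_families (a, b, g)"
  let ?L = "\<lambda>c d. line_int (the \<circ> g) c d \<rho>"
  define FL where "FL = {x\<in>F. fst x \<le> m}"
  define FR where "FR = {x\<in>F. m \<le> snd x}"
  define l where "l = (\<lambda>x. (fst x, min (snd x) m) :: real \<times> real)"
  define r where "r = (\<lambda>x. (max (fst x) m, snd x) :: real \<times> real)"
  have fin: "finite F" "finite FL" "finite FR" using F by (auto simp: interval_families_def FL_def FR_def)
  have le: "fst x \<le> snd x" "{fst x..snd x} \<subseteq> fin_params (a, b, g)" if "x \<in> F" for x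
    using F that by (simp_all add: interval_families_iff)
  have disj: "{fst x..snd x} \<inter> {fst y..snd y} = {}" if "x \<in> F" "y \<in> F" "x \<noteq> y" for x y
    using F that unfolding interval_families_iff by blast
  have injl: "inj_on l FL"
    using interval_families_fst_inj(1)[OF F] by (auto simp: inj_on_def l_def FL_def)
  have injr: "inj_on r FR"
    using interval_families_fst_inj(2)[OF F] by (auto simp: inj_on_def r_def FR_def)
  have "l ` FL \<in> interval_families (a, m, g)"
    unfolding interval_families_iff
  proof (intro conjI ballI impI)
    fix y assume "y \<in> l ` FL"
    then show "fst y \<le> snd y" "{fst y..snd y} \<subseteq> fin_params (a, m, g)"
      using le by (auto simp: l_def FL_def fin_params_def subset_iff)
  next
    fix y z assume "y \<in> l ` FL" "z \<in> l ` FL" "y \<noteq> z"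
    then obtain y' z' where "y' \<in> FL" "z' \<in> FL" "y = l y'" "z = l z'" "y' \<noteq> z'" by auto
    then show "{fst y..snd y} \<inter> {fst z..snd z} = {}"
      using disj[of y' z'] by (auto simp: l_def FL_def)
  qed (use fin in auto)
  then have L: "(\<Sum>x\<in>FL. ?L (fst x) (min (snd x) m)) \<le> ext_line_int (a, m, g) \<rho>"
    unfolding ext_line_int_eq by (intro SUP_upper2[of "l ` FL"]) (auto simp: sum.reindex[OF injl], simp add: l_def)
  have "r ` FR \<in> interval_families (m, b, g)"
    unfolding interval_families_iff
  proof (intro conjI ballI impI)
    fix y assume "y \<in> r ` FR"
    then show "fst y \<le> snd y" "{fst y..snd y} \<subseteq> fin_params (m, b, g)"
      using le by (auto simp: r_def FR_def fin_params_def subset_iff)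
  next
    fix y z assume "y \<in> r ` FR" "z \<in> r ` FR" "y \<noteq> z"
    then obtain y' z' where "y' \<in> FR" "z' \<in> FR" "y = r y'" "z = r z'" "y' \<noteq> z'" by auto
    then show "{fst y..snd y} \<inter> {fst z..snd z} = {}"
      using disj[of y' z'] by (auto simp: r_def FR_def)
  qed (use fin in auto)
  then have R: "(\<Sum>x\<in>FR. ?L (max (fst x) m) (snd x)) \<le> ext_line_int (m, b, g) \<rho>"
    unfolding ext_line_int_eq by (intro SUP_upper2[of "r ` FR"]) (auto simp: sum.reindex[OF injr], simp add: r_def)
  have step: "?L (fst x) (snd x) \<le> (if fst x \<le> m then ?L (fst x) (min (snd x) m) else 0)
     + (if m \<le> snd x then ?L (max (fst x) m) (snd x) else 0)" if x: "x \<in> F" for x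
  proof (cases "fst x \<le> m \<and> m \<le> snd x")
    case True
    have "path_length (the \<circ> g) (fst x) (snd x) < \<infinity>"
      using assms(2) le[OF x] unfolding loc_rectifiable_def by simp
    then have "?L (fst x) (snd x) \<le> ?L (fst x) m + ?L m (snd x)"
      using True le[OF x] by (intro line_int_add ch_path_imp_continuous_the[OF p] \<rho>) auto
    then show ?thesis using True by (simp add: min_def max_def)
  next
    case False
    then show ?thesis using le[OF x] by (cases "fst x \<le> m") (auto simp: min_def max_def)
  qed
  have "(\<Sum>(c, d)\<in>F. ?L c d) = (\<Sum>x\<in>F. ?L (fst x) (snd x))" by (simp add: case_prod_beta)
  also have "\<dots> \<le> (\<Sum>x\<in>F. (if fst x \<le> m then ?L (fst x) (min (snd x) m) else 0)
     + (if m \<le> snd x then ?L (max (fst x) m) (snd x) else 0))"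
    by (intro sum_mono step)
  also have "\<dots> = (\<Sum>x\<in>FL. ?L (fst x) (min (snd x) m)) + (\<Sum>x\<in>FR. ?L (max (fst x) m) (snd x))"
    unfolding sum.distrib FL_def FR_def using fin(1) by (simp add: sum.inter_filter)
  also have "\<dots> \<le> ext_line_int (a, m, g) \<rho> + ext_line_int (m, b, g) \<rho>" using L R by (rule add_mono)
  finally show "(\<Sum>(c, d)\<in>F. ?L c d) \<le> ext_line_int (a, m, g) \<rho> + ext_line_int (m, b, g) \<rho>" .
qed

lemma ext_line_int_cmult_ge:
  assumes p: "ch_path a b g" and \<rho>: "\<rho> \<in> borel_measurable borel"
  shows "K * ext_line_int (a, b, g) \<rho> \<le> ext_line_int (a, b, g) (\<lambda>x. K * \<rho> x)"
  unfolding ext_line_int_eq SUP_mult_left_ennreal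
proof (rule SUP_mono, intro bexI)
  fix F assume F: "F \<in> interval_families (a, b, g)"
  have "K * line_int (the \<circ> g) c d \<rho> = line_int (the \<circ> g) c d (\<lambda>x. K * \<rho> x)" if "(c, d) \<in> F" for c d
  proof -
    have "continuous_on {c..d} (the \<circ> g)"
      using F that by (intro ch_path_imp_continuous_the[OF p]) (auto simp: interval_families_def)
    from measurable_line_integrand[OF this \<rho>] show ?thesis
      unfolding line_int_def by (subst nn_integral_cmult[symmetric]) (auto simp: mult.assoc)
  qed
  then show "K * (\<Sum>(c, d)\<in>F. line_int (the \<circ> g) c d \<rho>) \<le> (\<Sum>(c, d)\<in>F. line_int (the \<circ> g) c d (\<lambda>x. K * \<rho> x))"
    unfolding sum_distrib_left by (intro sum_mono) auto
qed

section \<open>Straight segments\<close>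

lemma path_length_affine:
  fixes u w :: "'a::euclidean_space"
  assumes "c \<le> d" and g: "\<And>t. t \<in> {c..d} \<Longrightarrow> g t = u + (t - t0) *\<^sub>R w"
  shows "path_length g c d = ennreal (norm w * (d - c))"
proof (rule antisym)
  have dist: "dist (g s) (g t) = norm w * (t - s)" if "s \<in> {c..d}" "t \<in> {c..d}" "s \<le> t" for s t
  proof -
    have "g t - g s = (t - s) *\<^sub>R w" using that by (simp add: g algebra_simps)
    then have "norm (g t - g s) = \<bar>t - s\<bar> * norm w" by simp
    then show ?thesis using that by (simp add: dist_norm norm_minus_commute)
  qed
  have *: "chain_length g ts \<le> ennreal (norm w * (d - hd ts))" if "sorted ts" "set ts \<subseteq> {c..d}" "ts \<noteq> []" for ts
    using that
  proof (induction ts rule: induct_list012)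
    case (3 x y zs)
    have "chain_length g (x # y # zs) \<le> ennreal (norm w * (y - x)) + ennreal (norm w * (d - y))"
      using 3 dist[of x y] by (auto intro!: add_mono)
    also have "\<dots> = ennreal (norm w * (d - x))"
      using 3 by (subst ennreal_plus[symmetric]) (auto simp flip: distrib_left)
    finally show ?case by simp
  qed (use assms(1) in auto)
  show "path_length g c d \<le> ennreal (norm w * (d - c))"
  proof (rule path_length_least)
    fix ts assume ts: "sorted ts" "set ts \<subseteq> {c..d}"
    show "chain_length g ts \<le> ennreal (norm w * (d - c))"
    proof (cases ts)
      case (Cons x xs)
      have "chain_length g ts \<le> ennreal (norm w * (d - x))" using *[OF ts] Cons by simp
      also have "\<dots> \<le> ennreal (norm w * (d - c))" using ts Cons by (intro ennreal_leI mult_left_mono) auto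
      finally show ?thesis .
    qed simp
  qed
  have "chain_length g [c, d] \<le> path_length g c d" using assms by (intro chain_length_le_path_length) auto
  then show "ennreal (norm w * (d - c)) \<le> path_length g c d" using dist[of c d] assms(1) by simp
qed

lemma line_int_affine:
  fixes u w :: "'a::euclidean_space"
  assumes cd: "c \<le> d" and g: "\<And>t. t \<in> {c..d} \<Longrightarrow> g t = u + (t - t0) *\<^sub>R w"
    and \<rho>: "\<rho> \<in> borel_measurable borel"
  shows "line_int g c d \<rho> = ennreal (norm w) * (\<integral>\<^sup>+t\<in>{c<..d}. \<rho> (u + (t - t0) *\<^sub>R w) \<partial>lborel)"
proof -
  let ?g = "\<lambda>t. u + (t - t0) *\<^sub>R w"
  let ?M = "density lborel (\<lambda>_. ennreal (norm w)) :: real measure"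
  note [measurable] = \<rho>
  have pl: "path_length ?g a d = ennreal (norm w * (d - a))" if "a \<le> d" for a
    using that by (intro path_length_affine[of _ _ _ u t0 w]) auto
  have "line_int g c d \<rho> = line_int ?g c d \<rho>" using g by (rule line_int_cong)
  also have "\<dots> = (\<integral>\<^sup>+t\<in>{c<..d}. \<rho> (?g t) \<partial>?M)"
    using cd by (intro line_int_eq_measure \<rho> continuous_intros)
       (auto simp: pl emeasure_density nn_integral_cmult_indicator ennreal_mult ennreal_mult_less_top)
  also have "\<dots> = ennreal (norm w) * (\<integral>\<^sup>+t\<in>{c<..d}. \<rho> (?g t) \<partial>lborel)"
    by (subst nn_integral_density) (auto simp: nn_integral_cmult mult.assoc)
  finally show ?thesis .
qed

text \<open>The intervals of a family are disjoint parts of [a, a+1], so no sum in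
  \<open>ext_line_int\<close> exceeds the integral over the whole segment.\<close>

lemma segment_path:
  fixes u w :: "'a::euclidean_space"
  assumes g: "\<And>t. t \<in> {a..a+1} \<Longrightarrow> g t = Some (u + (t - a) *\<^sub>R w)" and \<rho>: "\<rho> \<in> borel_measurable borel"
  shows "loc_rectifiable (a, a+1, g)"
    "ext_line_int (a, a+1, g) \<rho> \<le> ennreal (norm w) * (\<integral>\<^sup>+t\<in>{0..1}. \<rho> (u + t *\<^sub>R w) \<partial>lborel)"
proof -
  have fp: "fin_params (a, a+1, g) = {a..a+1}" using g by (auto simp: fin_params_def)
  have g': "(the \<circ> g) t = u + (t - a) *\<^sub>R w" if "t \<in> {c..d}" "{c..d} \<subseteq> {a..a+1}" for t c d
    using that g[of t] by auto
  show "loc_rectifiable (a, a+1, g)"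
    unfolding loc_rectifiable_def prod.case fp
  proof (intro allI impI)
    fix c d assume "c \<le> d \<and> {c..d} \<subseteq> {a..a+1}"
    then show "path_length (the \<circ> g) c d < \<infinity>"
      using path_length_affine[of c d "the \<circ> g" u a w] g'[of _ c d] by simp
  qed
  note [measurable] = \<rho>
  let ?f = "\<lambda>t. \<rho> (u + (t - a) *\<^sub>R w)"
  show "ext_line_int (a, a+1, g) \<rho> \<le> ennreal (norm w) * (\<integral>\<^sup>+t\<in>{0..1}. \<rho> (u + t *\<^sub>R w) \<partial>lborel)"
    unfolding ext_line_int_eq
  proof (rule SUP_least)
    fix F assume F: "F \<in> interval_families (a, a+1, g)"
    have fin: "finite F" using F by (simp add: interval_families_def)
    have Fx: "fst x \<le> snd x" "{fst x..snd x} \<subseteq> {a..a+1}" if "x \<in> F" for x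
      using F that unfolding interval_families_iff fp by blast+
    have disj: "disjoint_family_on (\<lambda>x. {fst x<..snd x}) F"
      unfolding disjoint_family_on_def
    proof (intro ballI impI)
      fix x y assume "x \<in> F" "y \<in> F" "x \<noteq> y"
      then have "{fst x..snd x} \<inter> {fst y..snd y} = {}" using F unfolding interval_families_iff by blast
      then show "{fst x<..snd x} \<inter> {fst y<..snd y} = {}" by fastforce
    qed
    have "(\<Sum>(c, d)\<in>F. line_int (the \<circ> g) c d \<rho>) =
        (\<Sum>x\<in>F. ennreal (norm w) * (\<integral>\<^sup>+t\<in>{fst x<..snd x}. ?f t \<partial>lborel))"
      unfolding case_prod_beta
      by (intro sum.cong refl line_int_affine \<rho> g' Fx) (use Fx in auto)
    also have "\<dots> = ennreal (norm w) * (\<integral>\<^sup>+t. (\<Sum>x\<in>F. ?f t * indicator {fst x<..snd x} t) \<partial>lborel)"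
      by (subst nn_integral_sum) (auto simp: sum_distrib_left)
    also have "\<dots> \<le> ennreal (norm w) * (\<integral>\<^sup>+t\<in>{a..a+1}. ?f t \<partial>lborel)"
    proof (intro mult_left_mono nn_integral_mono)
      fix t
      have "(\<Sum>x\<in>F. ?f t * indicator {fst x<..snd x} t) = ?f t * indicator (\<Union>x\<in>F. {fst x<..snd x}) t"
        unfolding sum_distrib_left[symmetric] by (simp add: indicator_UN_disjoint[OF fin disj])
      also have "\<dots> \<le> ?f t * indicator {a..a+1} t"
        using Fx by (intro mult_left_mono) (auto simp: indicator_def subset_iff less_imp_le)
      finally show "(\<Sum>x\<in>F. ?f t * indicator {fst x<..snd x} t) \<le> ?f t * indicator {a..a+1} t" .
    qed auto
    also have "(\<integral>\<^sup>+t\<in>{a..a+1}. ?f t \<partial>lborel) = (\<integral>\<^sup>+t\<in>{0..1}. \<rho> (u + t *\<^sub>R w) \<partial>lborel)"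
      by (subst nn_integral_real_affine[where c=1 and t=a]) (auto intro!: nn_integral_cong simp: indicator_def)
    finally show "(\<Sum>(c, d)\<in>F. line_int (the \<circ> g) c d \<rho>) \<le> ennreal (norm w) * (\<integral>\<^sup>+t\<in>{0..1}. \<rho> (u + t *\<^sub>R w) \<partial>lborel)" .
  qed
qed

section \<open>Segments of small length\<close>

text \<open>Either x <= a, or x = x^n / x^(n-1) <= x^n / a^(n-1). This stands in for Hoelder's
  inequality, with a level a that can be adapted to the situation.\<close>

lemma le_add_power_split:
  fixes x :: ennreal
  assumes a: "a > 0" and n: "n > 0"
  shows "x \<le> ennreal a + ennreal (1 / a ^ (n - 1)) * x ^ n"
proof (cases "x \<le> ennreal a")
  case True
  then show ?thesis by (simp add: add_increasing2)
next
  case False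
  show ?thesis
  proof (cases x)
    case (real y)
    with False a have y: "a < y" by (simp add: not_le ennreal_less_iff)
    have "y * a ^ (n - 1) \<le> y * y ^ (n - 1)"
      using y a by (intro mult_left_mono power_mono) auto
    also have "\<dots> = y ^ n" using n by (cases n) auto
    finally have "y \<le> 1 / a ^ (n - 1) * y ^ n" using a by (simp add: field_simps)
    then have "ennreal y \<le> ennreal (1 / a ^ (n - 1)) * ennreal y ^ n"
      using a y by (simp add: ennreal_power ennreal_mult[symmetric] ennreal_leI)
    then show ?thesis by (simp add: real add_increasing)
  next
    case top
    have "ennreal (1 / a ^ (n - 1)) \<noteq> 0" using a by (simp add: ennreal_eq_0_iff not_le)
    then show ?thesis using n by (simp add: top ennreal_mult_top)
  qed
qed

lemma nn_integral_lborel_affine: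
  fixes t :: "'a::euclidean_space"
  assumes [measurable]: "f \<in> borel_measurable borel" and c: "c \<noteq> 0"
  shows "(\<integral>\<^sup>+x. f x \<partial>lborel) = ennreal (\<bar>c\<bar> ^ DIM('a)) * (\<integral>\<^sup>+x. f (t + c *\<^sub>R x) \<partial>lborel)"
  by (subst lborel_affine[OF c, of t]) (simp add: nn_integral_density nn_integral_distr nn_integral_cmult)

lemma nn_integral_powr_01:
  assumes "\<theta> < 1"
  shows "(\<integral>\<^sup>+t\<in>{0..1}. ennreal (t powr (-\<theta>)) \<partial>lborel) = ennreal (1 / (1 - \<theta>))"
proof -
  have "((\<lambda>t::real. t powr (-\<theta>)) has_integral (1 powr (-\<theta> + 1) / (-\<theta> + 1))) {0..1}"
    using assms by (intro has_integral_powr_from_0) auto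
  then have "(\<integral>\<^sup>+t. ennreal (indicator {0..1} t * t powr (-\<theta>)) \<partial>lborel) = ennreal (1 powr (-\<theta> + 1) / (-\<theta> + 1))"
    by (intro nn_integral_has_integral_lebesgue) auto
  moreover have "ennreal (indicator {0..1} t * t powr (-\<theta>)) = ennreal (t powr (-\<theta>)) * indicator {0..1} t" for t
    by (auto simp: indicator_def)
  ultimately show ?thesis by simp
qed

text \<open>Pushing the unit ball towards the point u r contracts volumes by t^n, but the image of a fixed point y
  is only hit by radii r in an interval of length 2 K t.\<close>

lemma contracted_ball_integral:
  fixes u :: "real \<Rightarrow> 'a::euclidean_space" and h :: "'a \<Rightarrow> ennreal"
  assumes u: "u \<in> borel_measurable borel" and h: "h \<in> borel_measurable borel"
    and dist: "\<And>r. r \<in> {p<..<q} \<Longrightarrow> dist c (u r) = r"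
    and K: "\<And>r z. r \<in> {p<..<q} \<Longrightarrow> z \<in> ball 0 1 \<Longrightarrow> norm (z - u r) \<le> K" and K0: "K \<ge> 0"
    and t: "t > 0"
  shows "(\<integral>\<^sup>+r\<in>{p<..<q}. (\<integral>\<^sup>+z\<in>ball 0 1. h (u r + t *\<^sub>R (z - u r)) \<partial>lborel) \<partial>lborel)
     \<le> ennreal (2 * K * t / t ^ DIM('a)) * (\<integral>\<^sup>+y. h y \<partial>lborel)"
proof -
  note [measurable] = u h
  \<comment> \<open>Contracted points lie within K t of \<open>u r\<close>, so the cut-off loses
    nothing; it is what confines the radii that reach a given y.\<close>
  let ?G = "\<lambda>r y. h y * indicator {y. dist y (u r) \<le> K * t} y"
  have in1: "(\<integral>\<^sup>+z\<in>ball 0 1. h (u r + t *\<^sub>R (z - u r)) \<partial>lborel) \<le> ennreal (1 / t ^ DIM('a)) * (\<integral>\<^sup>+y. ?G r y \<partial>lborel)"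
    if r: "r \<in> {p<..<q}" for r
  proof -
    have "(\<integral>\<^sup>+y. ?G r y \<partial>lborel) = ennreal (\<bar>t\<bar> ^ DIM('a)) * (\<integral>\<^sup>+z. ?G r ((1 - t) *\<^sub>R u r + t *\<^sub>R z) \<partial>lborel)"
      using t by (intro nn_integral_lborel_affine) auto
    then have "ennreal (1 / t ^ DIM('a)) * (\<integral>\<^sup>+y. ?G r y \<partial>lborel) =
       (\<integral>\<^sup>+z. ?G r ((1 - t) *\<^sub>R u r + t *\<^sub>R z) \<partial>lborel)"
      using t by (simp add: mult.assoc[symmetric] ennreal_mult[symmetric])
    moreover have "(\<integral>\<^sup>+z\<in>ball 0 1. h (u r + t *\<^sub>R (z - u r)) \<partial>lborel) \<le> (\<integral>\<^sup>+z. ?G r ((1 - t) *\<^sub>R u r + t *\<^sub>R z) \<partial>lborel)"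
    proof (rule nn_integral_mono)
      fix z
      have eq: "u r + t *\<^sub>R (z - u r) = (1 - t) *\<^sub>R u r + t *\<^sub>R z" by (simp add: algebra_simps)
      have "dist (u r + t *\<^sub>R (z - u r)) (u r) \<le> K * t" if "z \<in> ball 0 1"
        using K[OF r that] t by (simp add: dist_norm mult.commute mult_left_mono)
      then show "h (u r + t *\<^sub>R (z - u r)) * indicator (ball 0 1) z \<le> ?G r ((1 - t) *\<^sub>R u r + t *\<^sub>R z)"
        unfolding eq by (auto simp: indicator_def)
    qed
    ultimately show ?thesis by simp
  qed
  have in2: "(\<integral>\<^sup>+r. h y * indicator {y. dist y (u r) \<le> K * t} y * indicator {p<..<q} r \<partial>lborel) \<le> h y * ennreal (2 * K * t)" for y
  proof -
    have "(\<integral>\<^sup>+r. h y * indicator {y. dist y (u r) \<le> K * t} y * indicator {p<..<q} r \<partial>lborel)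
      \<le> (\<integral>\<^sup>+r. h y * indicator {dist c y - K * t..dist c y + K * t} r \<partial>lborel)"
    proof (intro nn_integral_mono)
      fix r
      have "\<bar>dist c y - r\<bar> \<le> K * t" if "r \<in> {p<..<q}" "dist y (u r) \<le> K * t"
        using dist[OF that(1)] that(2) dist_triangle[of c y "u r"] dist_triangle[of c "u r" y]
        by (simp add: dist_commute abs_le_iff)
      then show "h y * indicator {y. dist y (u r) \<le> K * t} y * indicator {p<..<q} r \<le> h y * indicator {dist c y - K * t..dist c y + K * t} r"
        by (auto simp: indicator_def abs_le_iff)
    qed
    also have "\<dots> = h y * ennreal (2 * K * t)"
      using K0 t by (simp add: nn_integral_cmult_indicator algebra_simps)
    finally show ?thesis .
  qed
  have "(\<integral>\<^sup>+r\<in>{p<..<q}. (\<integral>\<^sup>+z\<in>ball 0 1. h (u r + t *\<^sub>R (z - u r)) \<partial>lborel) \<partial>lborel) \<le>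
    (\<integral>\<^sup>+r. ennreal (1 / t ^ DIM('a)) * (\<integral>\<^sup>+y. ?G r y * indicator {p<..<q} r \<partial>lborel) \<partial>lborel)"
    using in1 by (intro nn_integral_mono) (auto simp: indicator_def)
  also have "\<dots> = ennreal (1 / t ^ DIM('a)) * (\<integral>\<^sup>+r. (\<integral>\<^sup>+y. ?G r y * indicator {p<..<q} r \<partial>lborel) \<partial>lborel)"
    by (rule nn_integral_cmult) (unfold indicator_def, measurable)
  also have "(\<integral>\<^sup>+r. (\<integral>\<^sup>+y. ?G r y * indicator {p<..<q} r \<partial>lborel) \<partial>lborel) =
     (\<integral>\<^sup>+y. (\<integral>\<^sup>+r. ?G r y * indicator {p<..<q} r \<partial>lborel) \<partial>lborel)"
    by (rule lborel_pair.Fubini') (unfold indicator_def, measurable)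
  also have "\<dots> \<le> (\<integral>\<^sup>+y. h y * ennreal (2 * K * t) \<partial>lborel)"
    by (intro nn_integral_mono in2)
  also have "\<dots> = ennreal (2 * K * t) * (\<integral>\<^sup>+y. h y \<partial>lborel)" by (simp add: nn_integral_multc mult.commute)
  finally show ?thesis
    using t K0 by (simp add: mult.assoc[symmetric] ennreal_mult[symmetric] mult_left_mono)
qed

text \<open>What matters is integrability at t = 0. The contraction alone costs t^(1-n), which is
  not integrable there for n >= 2; a splitting level that grows as t decreases lowers the cost to
  t^-\<theta> with \<theta> < 1.\<close>

lemma fixed_time_estimate:
  fixes u :: "real \<Rightarrow> 'a::euclidean_space" and \<rho> :: "'a \<Rightarrow> ennreal"
  defines "n \<equiv> DIM('a)"
  defines "\<theta> \<equiv> (real n - 1) / real n"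
  defines "b \<equiv> measure lborel (ball (0::'a) 1)"
  assumes u: "u \<in> borel_measurable borel" and \<rho>: "\<rho> \<in> borel_measurable borel"
    and dist: "\<And>r. r \<in> {p<..<q} \<Longrightarrow> dist c (u r) = r" and pq: "p \<le> q"
    and K: "\<And>r z. r \<in> {p<..<q} \<Longrightarrow> z \<in> ball 0 1 \<Longrightarrow> norm (z - u r) \<le> K" and K0: "K \<ge> 0"
    and t: "t > 0" and \<epsilon>: "\<epsilon> > 0"
  shows "(\<integral>\<^sup>+r\<in>{p<..<q}. (\<integral>\<^sup>+z\<in>ball 0 1. \<rho> (u r + t *\<^sub>R (z - u r)) \<partial>lborel) \<partial>lborel)
    \<le> ennreal (t powr (-\<theta>)) * (ennreal (\<epsilon> * (q - p) * b) + ennreal (2 * K / \<epsilon> ^ (n - 1)) * (\<integral>\<^sup>+y. \<rho> y ^ n \<partial>lborel))"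
proof -
  note [measurable] = u \<rho>
  have [measurable]: "ball (0::'a) 1 \<in> sets borel" by simp
  have n: "n > 0" by (simp add: n_def)
  \<comment> \<open>The two terms are of order a and a^-(n-1) t^(1-n), that is t^-\<theta> and
    t^((n-1)(\<theta>-1)); the exponents agree exactly for \<theta> = (n-1)/n.\<close>
  define a where "a = \<epsilon> * t powr (-\<theta>)"
  have a: "a > 0" using \<epsilon> t by (simp add: a_def)
  have b0: "b \<ge> 0" by (simp add: b_def)
  have eb: "emeasure lborel (ball (0::'a) 1) = ennreal b"
    unfolding b_def using emeasure_lborel_ball_finite[of "0::'a" 1]
    by (intro emeasure_eq_ennreal_measure) auto
  have z: "(\<integral>\<^sup>+z\<in>ball 0 1. \<rho> (u r + t *\<^sub>R (z - u r)) \<partial>lborel) \<le>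
     ennreal (a * b) + ennreal (1 / a ^ (n - 1)) * (\<integral>\<^sup>+z\<in>ball 0 1. \<rho> (u r + t *\<^sub>R (z - u r)) ^ n \<partial>lborel)" for r
  proof -
    have "(\<integral>\<^sup>+z\<in>ball 0 1. \<rho> (u r + t *\<^sub>R (z - u r)) \<partial>lborel) \<le>
       (\<integral>\<^sup>+z. ennreal a * indicator (ball 0 1) z + ennreal (1 / a ^ (n - 1)) * (\<rho> (u r + t *\<^sub>R (z - u r)) ^ n * indicator (ball 0 1) z) \<partial>lborel)"
      using le_add_power_split[OF a n] by (intro nn_integral_mono) (auto simp: indicator_def)
    also have "\<dots> = ennreal (a * b) + ennreal (1 / a ^ (n - 1)) * (\<integral>\<^sup>+z\<in>ball 0 1. \<rho> (u r + t *\<^sub>R (z - u r)) ^ n \<partial>lborel)"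
    proof (subst nn_integral_add)
      show "(\<integral>\<^sup>+z. ennreal a * indicator (ball (0::'a) 1) z \<partial>lborel) + (\<integral>\<^sup>+z. ennreal (1 / a ^ (n - 1)) * (\<rho> (u r + t *\<^sub>R (z - u r)) ^ n * indicator (ball 0 1) z) \<partial>lborel)
         = ennreal (a * b) + ennreal (1 / a ^ (n - 1)) * (\<integral>\<^sup>+z\<in>ball 0 1. \<rho> (u r + t *\<^sub>R (z - u r)) ^ n \<partial>lborel)"
      proof -
        have "(\<integral>\<^sup>+z. ennreal a * indicator (ball (0::'a) 1) z \<partial>lborel) = ennreal a * ennreal b"
          unfolding eb[symmetric] by (rule nn_integral_cmult_indicator) simp
        moreover have "(\<integral>\<^sup>+z. ennreal (1 / a ^ (n - 1)) * (\<rho> (u r + t *\<^sub>R (z - u r)) ^ n * indicator (ball 0 1) z) \<partial>lborel) =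
           ennreal (1 / a ^ (n - 1)) * (\<integral>\<^sup>+z\<in>ball 0 1. \<rho> (u r + t *\<^sub>R (z - u r)) ^ n \<partial>lborel)"
          by (rule nn_integral_cmult) measurable
        ultimately show ?thesis using a b0 by (simp add: ennreal_mult)
      qed
    qed measurable
    finally show ?thesis .
  qed
  have "(\<integral>\<^sup>+r\<in>{p<..<q}. (\<integral>\<^sup>+z\<in>ball 0 1. \<rho> (u r + t *\<^sub>R (z - u r)) \<partial>lborel) \<partial>lborel) \<le>
    (\<integral>\<^sup>+r. ennreal (a * b) * indicator {p<..<q} r + ennreal (1 / a ^ (n - 1)) *
       ((\<integral>\<^sup>+z\<in>ball 0 1. \<rho> (u r + t *\<^sub>R (z - u r)) ^ n \<partial>lborel) * indicator {p<..<q} r) \<partial>lborel)"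
    using z by (intro nn_integral_mono) (auto simp: indicator_def)
  also have "\<dots> = ennreal (a * b) * ennreal (q - p) + ennreal (1 / a ^ (n - 1)) *
     (\<integral>\<^sup>+r\<in>{p<..<q}. (\<integral>\<^sup>+z\<in>ball 0 1. \<rho> (u r + t *\<^sub>R (z - u r)) ^ n \<partial>lborel) \<partial>lborel)"
    using pq by (subst nn_integral_add) (auto simp: nn_integral_cmult)
  also have "\<dots> \<le> ennreal (a * b) * ennreal (q - p) + ennreal (1 / a ^ (n - 1)) *
     (ennreal (2 * K * t / t ^ n) * (\<integral>\<^sup>+y. \<rho> y ^ n \<partial>lborel))"
    unfolding n_def
    by (intro add_left_mono mult_left_mono contracted_ball_integral[OF u _ dist K K0 t]) auto
  also have "ennreal (1 / a ^ (n - 1)) * (ennreal (2 * K * t / t ^ n) * (\<integral>\<^sup>+y. \<rho> y ^ n \<partial>lborel)) =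
     ennreal (1 / a ^ (n - 1) * (2 * K * t / t ^ n)) * (\<integral>\<^sup>+y. \<rho> y ^ n \<partial>lborel)"
    using a t K0 by (subst ennreal_mult) (auto simp: mult.assoc)
  also have "1 / a ^ (n - 1) * (2 * K * t / t ^ n) = t powr (-\<theta>) * (2 * K / \<epsilon> ^ (n - 1))"
  proof -
    have "(t powr (-\<theta>)) ^ (n - 1) = t powr (-\<theta> * (real n - 1))"
      using t n by (simp add: powr_powr flip: powr_realpow)
    moreover have "t / t ^ n = t powr (1 - real n)"
      using t by (simp add: powr_diff powr_realpow)
    moreover have "- \<theta> * (real n - 1) + - \<theta> = 1 - real n"
      using n by (simp add: \<theta>_def field_simps)
    ultimately have "t / t ^ n = (t powr (-\<theta>)) ^ (n - 1) * t powr (-\<theta>)"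
      by (simp add: powr_add[symmetric])
    moreover have "t powr (-\<theta>) \<noteq> 0" using t by simp
    ultimately show ?thesis using \<epsilon> by (simp add: a_def power_mult_distrib field_simps)
  qed
  also have "ennreal (a * b) * ennreal (q - p) = ennreal (t powr (-\<theta>)) * ennreal (\<epsilon> * (q - p) * b)"
    using a b0 pq by (simp add: a_def ennreal_mult[symmetric] mult_ac \<epsilon> less_imp_le)
  also have "ennreal (t powr (-\<theta>) * (2 * K / \<epsilon> ^ (n - 1))) = ennreal (t powr (-\<theta>)) * ennreal (2 * K / \<epsilon> ^ (n - 1))"
    using K0 \<epsilon> by (intro ennreal_mult) auto
  finally show ?thesis
    by (simp only: distrib_left mult.assoc)
qed

text \<open>If every radius were bad, integration over the radii would contradict the bound that
  results from exchanging the integrals over r, z and t. The threshold \<mu> depends on K, L, s and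
  the dimension only, not on the curve or on \<open>\<rho>\<close>.\<close>

lemma short_segments:
  fixes K L s :: real
  assumes "K > 0" "L > 0" "s > 0"
  shows "\<exists>\<mu>>0. \<forall>\<rho> (u :: real \<Rightarrow> 'a::euclidean_space) c p q. \<rho> \<in> borel_measurable borel \<longrightarrow> u \<in> borel_measurable borel \<longrightarrow>
    L \<le> q - p \<longrightarrow> (\<forall>r\<in>{p<..<q}. dist c (u r) = r) \<longrightarrow>
    (\<forall>r\<in>{p<..<q}. \<forall>z\<in>ball 0 1. norm (z - u r) \<le> K) \<longrightarrow>
    (\<integral>\<^sup>+y. \<rho> y ^ DIM('a) \<partial>lborel) \<le> ennreal \<mu> \<longrightarrow>
    (\<exists>r\<in>{p<..<q}. (\<integral>\<^sup>+z\<in>ball 0 1. (\<integral>\<^sup>+t\<in>{0..1}. \<rho> (u r + t *\<^sub>R (z - u r)) \<partial>lborel) \<partial>lborel) < ennreal s)"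
proof -
  define n where "n = DIM('a)"
  define \<theta> where "\<theta> = (real n - 1) / real n"
  define b where "b = measure lborel (ball (0::'a) 1)"
  have n: "n > 0" by (simp add: n_def)
  have b: "b > 0" unfolding b_def by (rule content_ball_pos) simp
  have \<theta>: "1 / (1 - \<theta>) = real n" "\<theta> < 1" using n by (simp_all add: \<theta>_def field_simps)
  \<comment> \<open>t^-\<theta> has integral n over [0,1]. Thus this choice makes the first term s
    (q-p)/4, and that of \<mu> makes the second s L/4; together they are at most half of s
    (q-p).\<close>
  define \<epsilon> where "\<epsilon> = s / (4 * n * b)"
  have \<epsilon>: "\<epsilon> > 0" using assms n b by (simp add: \<epsilon>_def)
  define \<mu> where "\<mu> = s * L / (4 * n * (2 * K / \<epsilon> ^ (n - 1)))"
  have \<mu>: "\<mu> > 0" using assms n \<epsilon> by (simp add: \<mu>_def)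
  show ?thesis
  proof (intro exI[of _ \<mu>] conjI \<mu> allI impI)
    fix \<rho> :: "'a \<Rightarrow> ennreal" and u :: "real \<Rightarrow> 'a" and c p q
    assume [measurable]: "\<rho> \<in> borel_measurable borel" "u \<in> borel_measurable borel"
      and L: "L \<le> q - p" and dist: "\<forall>r\<in>{p<..<q}. dist c (u r) = r"
      and K: "\<forall>r\<in>{p<..<q}. \<forall>z\<in>ball 0 1. norm (z - u r) \<le> K"
      and H: "(\<integral>\<^sup>+y. \<rho> y ^ DIM('a) \<partial>lborel) \<le> ennreal \<mu>"
    have [measurable]: "ball (0::'a) 1 \<in> sets borel" by simp
    let ?\<phi> = "\<lambda>r. \<integral>\<^sup>+z\<in>ball 0 1. (\<integral>\<^sup>+t\<in>{0..1}. \<rho> (u r + t *\<^sub>R (z - u r)) \<partial>lborel) \<partial>lborel"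
    show "\<exists>r\<in>{p<..<q}. ?\<phi> r < ennreal s"
    proof (rule ccontr)
      assume "\<not> ?thesis"
      then have big: "ennreal s \<le> ?\<phi> r" if "r \<in> {p<..<q}" for r using that by (auto simp: not_less)
      let ?B = "ennreal (\<epsilon> * (q - p) * b) + ennreal (2 * K / \<epsilon> ^ (n - 1)) * ennreal \<mu>"
      have "ennreal (s * (q - p)) = (\<integral>\<^sup>+r. ennreal s * indicator {p<..<q} r \<partial>lborel)"
        using assms L by (simp add: nn_integral_cmult_indicator ennreal_mult)
      also have "\<dots> \<le> (\<integral>\<^sup>+r. ?\<phi> r * indicator {p<..<q} r \<partial>lborel)"
        using big by (intro nn_integral_mono) (auto simp: indicator_def)
      also have "\<dots> = (\<integral>\<^sup>+r. (\<integral>\<^sup>+z. (\<integral>\<^sup>+t. \<rho> (u r + t *\<^sub>R (z - u r)) * indicator (ball 0 1) z * indicator {p<..<q} r * indicator {0..1} t \<partial>lborel) \<partial>lborel) \<partial>lborel)"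
      proof (rule nn_integral_cong)
        fix r :: real
        have "(\<integral>\<^sup>+t\<in>{0..1}. \<rho> (u r + t *\<^sub>R (z - u r)) \<partial>lborel) * indicator (ball 0 1) z * indicator {p<..<q} r =
          (\<integral>\<^sup>+t. \<rho> (u r + t *\<^sub>R (z - u r)) * indicator (ball 0 1) z * indicator {p<..<q} r * indicator {0..1} t \<partial>lborel)" for z
          by (simp add: indicator_def)
        then show "?\<phi> r * indicator {p<..<q} r = (\<integral>\<^sup>+z. (\<integral>\<^sup>+t. \<rho> (u r + t *\<^sub>R (z - u r)) * indicator (ball 0 1) z * indicator {p<..<q} r * indicator {0..1} t \<partial>lborel) \<partial>lborel)"
          by (cases "r \<in> {p<..<q}") auto
      qed
      also have "\<dots> = (\<integral>\<^sup>+r. (\<integral>\<^sup>+t. (\<integral>\<^sup>+z. \<rho> (u r + t *\<^sub>R (z - u r)) * indicator (ball 0 1) z * indicator {p<..<q} r * indicator {0..1} t \<partial>lborel) \<partial>lborel) \<partial>lborel)"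
        by (intro nn_integral_cong lborel_pair.Fubini') measurable
      also have "\<dots> = (\<integral>\<^sup>+t. (\<integral>\<^sup>+r. (\<integral>\<^sup>+z. \<rho> (u r + t *\<^sub>R (z - u r)) * indicator (ball 0 1) z * indicator {p<..<q} r * indicator {0..1} t \<partial>lborel) \<partial>lborel) \<partial>lborel)"
        by (rule lborel_pair.Fubini') measurable
      also have "\<dots> \<le> (\<integral>\<^sup>+t. ?B * (ennreal (t powr (-\<theta>)) * indicator {0..1} t) \<partial>lborel)"
      proof (rule nn_integral_mono_AE)
        have "AE t in lborel. t \<noteq> (0::real)" by (rule AE_lborel_singleton)
        then show "AE t in lborel. (\<integral>\<^sup>+r. (\<integral>\<^sup>+z. \<rho> (u r + t *\<^sub>R (z - u r)) * indicator (ball 0 1) z * indicator {p<..<q} r * indicator {0..1} t \<partial>lborel) \<partial>lborel)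
           \<le> ?B * (ennreal (t powr (-\<theta>)) * indicator {0..1} t)"
        proof eventually_elim
          case (elim t)
          show ?case
          proof (cases "t \<in> {0..1}")
            case True
            with elim have t: "t > 0" by auto
            have "(\<integral>\<^sup>+r. (\<integral>\<^sup>+z. \<rho> (u r + t *\<^sub>R (z - u r)) * indicator (ball 0 1) z * indicator {p<..<q} r * indicator {0..1} t \<partial>lborel) \<partial>lborel) =
               (\<integral>\<^sup>+r\<in>{p<..<q}. (\<integral>\<^sup>+z\<in>ball 0 1. \<rho> (u r + t *\<^sub>R (z - u r)) \<partial>lborel) \<partial>lborel)"
              using True by (intro nn_integral_cong) (auto simp: indicator_def)
            also have "\<dots> \<le> ennreal (t powr (-\<theta>)) * (ennreal (\<epsilon> * (q - p) * b) + ennreal (2 * K / \<epsilon> ^ (n - 1)) * (\<integral>\<^sup>+y. \<rho> y ^ n \<partial>lborel))"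
              unfolding \<theta>_def b_def n_def using dist K L assms t \<epsilon>
              by (intro fixed_time_estimate[where c = c]) auto
            also have "\<dots> \<le> ennreal (t powr (-\<theta>)) * ?B"
              using H by (intro mult_left_mono add_left_mono) (auto simp: n_def)
            finally show ?thesis using True by (simp add: mult.commute)
          qed simp
        qed
      qed
      also have "\<dots> = ?B * ennreal n"
        by (subst nn_integral_cmult) (auto simp: nn_integral_powr_01[OF \<theta>(2)] \<theta>(1))
      also have "?B * ennreal n = ennreal ((\<epsilon> * (q - p) * b + 2 * K / \<epsilon> ^ (n - 1) * \<mu>) * n)"
        using \<epsilon> b assms L \<mu> by (simp add: ennreal_mult[symmetric] ennreal_plus[symmetric] del: ennreal_plus)
      also have "(\<epsilon> * (q - p) * b + 2 * K / \<epsilon> ^ (n - 1) * \<mu>) * n = s * (q - p) / 4 + s * L / 4"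
      proof -
        have "\<epsilon> * b * n = s / 4" using n b by (simp add: \<epsilon>_def)
        moreover have "2 * K / \<epsilon> ^ (n - 1) * \<mu> * n = s * L / 4" using n \<epsilon> assms by (simp add: \<mu>_def)
        moreover have "(\<epsilon> * (q - p) * b + 2 * K / \<epsilon> ^ (n - 1) * \<mu>) * n = (\<epsilon> * b * n) * (q - p) + 2 * K / \<epsilon> ^ (n - 1) * \<mu> * n"
          by (simp only: distrib_left distrib_right mult_ac)
        ultimately show ?thesis by (simp only: times_divide_eq_left)
      qed
      finally have "s * (q - p) \<le> s * (q - p) / 4 + s * L / 4"
        using assms L by (subst (asm) ennreal_le_iff) auto
      moreover have "s * L \<le> s * (q - p)" using assms L by (intro mult_left_mono) auto
      ultimately have "s * (q - p) \<le> 0" by linarith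
      moreover have "s * (q - p) > 0" using assms L by simp
      ultimately show False by simp
    qed
  qed
qed

section \<open>Small weighted integrals over rings\<close>

lemma measurable_radial_lebesgue:
  fixes x0 :: "'a::euclidean_space" and g :: "real \<Rightarrow> ennreal"
  assumes "g \<in> borel_measurable borel"
  shows "(\<lambda>x. g (dist x x0)) \<in> borel_measurable lebesgue"
proof -
  have "(\<lambda>x. g (dist x x0)) \<in> borel_measurable lborel" using assms by measurable
  then show ?thesis by (rule measurable_completion)
qed

lemma ring_in_sets: "ring r1 r2 x0 \<in> sets borel"
proof -
  have "ring r1 r2 x0 = {x \<in> space borel. r1 < dist x x0 \<and> dist x x0 < r2}" by (auto simp: ring_def)
  also have "\<dots> \<in> sets borel" by measurable
  finally show ?thesis .
qed

text \<open>The common consequence of the three conditions on Q, and the only form in which the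
  geometric argument uses them.\<close>

definition small_ring_integrals :: "'a::euclidean_space set \<Rightarrow> ('a \<Rightarrow> ennreal) \<Rightarrow> 'a \<Rightarrow> bool" where
  "small_ring_integrals D Q x0 \<longleftrightarrow> (\<forall>\<mu>>0. \<exists>r1 r2 \<eta>. 0 < r1 \<and> r1 < r2 \<and> ereal r2 < dist_bd x0 D \<and> \<eta> \<in> borel_measurable borel \<and>
     (\<integral>\<^sup>+ r\<in>{r1<..<r2}. \<eta> r \<partial>lborel) \<ge> 1 \<and>
     (\<integral>\<^sup>+ x\<in>ring r1 r2 x0. Q x * \<eta> (dist x x0) ^ DIM('a) \<partial>lebesgue) < ennreal \<mu>)"

text \<open>Let I be the integral of \<psi>. Normalising to \<psi>/I multiplies the ring integral by
  I^-n and so bounds it by B I^(1-n) <= B/I for I >= 1 and n >= 2, which is small once I is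
  large.\<close>

lemma small_ring_integralsI:
  fixes Q :: "'a::euclidean_space \<Rightarrow> ennreal"
  assumes n: "DIM('a) \<ge> 2" and Q: "Q \<in> borel_measurable lebesgue" and B: "B \<ge> 0"
    and ex: "\<And>M::real. \<exists>r1 r2 \<psi>. 0 < r1 \<and> r1 < r2 \<and> ereal r2 < dist_bd x0 D \<and> \<psi> \<in> borel_measurable borel \<and>
      ennreal M \<le> (\<integral>\<^sup>+ r\<in>{r1<..<r2}. \<psi> r \<partial>lborel) \<and> (\<integral>\<^sup>+ r\<in>{r1<..<r2}. \<psi> r \<partial>lborel) < \<infinity> \<and>
      (\<integral>\<^sup>+ x\<in>ring r1 r2 x0. Q x * \<psi> (dist x x0) ^ DIM('a) \<partial>lebesgue) \<le> ennreal B * (\<integral>\<^sup>+ r\<in>{r1<..<r2}. \<psi> r \<partial>lborel)"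
  shows "small_ring_integrals D Q x0"
  unfolding small_ring_integrals_def
proof (intro allI impI)
  fix \<mu> :: real assume \<mu>: "\<mu> > 0"
  \<comment> \<open>The bound 1 serves I^-n <= I^-2, the other one gives B/I < \<mu>.\<close>
  define M where "M = max 1 (B / \<mu> + 1)"
  obtain r1 r2 \<psi> where r: "0 < r1" "r1 < r2" "ereal r2 < dist_bd x0 D" and \<psi>: "\<psi> \<in> borel_measurable borel"
    and I: "ennreal M \<le> (\<integral>\<^sup>+ r\<in>{r1<..<r2}. \<psi> r \<partial>lborel)" "(\<integral>\<^sup>+ r\<in>{r1<..<r2}. \<psi> r \<partial>lborel) < \<infinity>"
    and J: "(\<integral>\<^sup>+ x\<in>ring r1 r2 x0. Q x * \<psi> (dist x x0) ^ DIM('a) \<partial>lebesgue) \<le> ennreal B * (\<integral>\<^sup>+ r\<in>{r1<..<r2}. \<psi> r \<partial>lborel)"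
    using ex[of M] by blast
  obtain i where i: "(\<integral>\<^sup>+ r\<in>{r1<..<r2}. \<psi> r \<partial>lborel) = ennreal i" "i \<ge> 0"
    using I(2) by (cases "\<integral>\<^sup>+ r\<in>{r1<..<r2}. \<psi> r \<partial>lborel") auto
  have iM: "i \<ge> M" using I(1) i by (simp add: M_def)
  then have i1: "i \<ge> 1" "i > B / \<mu>" by (auto simp: M_def)
  note [measurable] = \<psi> Q measurable_radial_lebesgue[OF \<psi>]
  have [measurable]: "ring r1 r2 x0 \<in> sets lebesgue" using ring_in_sets by (metis sets_completionI_sets sets_lborel)
  define \<eta> where "\<eta> r = ennreal (1 / i) * \<psi> r" for r
  have "(\<integral>\<^sup>+ r\<in>{r1<..<r2}. \<eta> r \<partial>lborel) = ennreal (1 / i) * (\<integral>\<^sup>+ r\<in>{r1<..<r2}. \<psi> r \<partial>lborel)"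
    unfolding \<eta>_def mult.assoc by (rule nn_integral_cmult) measurable
  also have "\<dots> = 1" using i1 i by (simp add: ennreal_mult[symmetric])
  finally have 1: "(\<integral>\<^sup>+ r\<in>{r1<..<r2}. \<eta> r \<partial>lborel) = 1" .
  have "(\<integral>\<^sup>+ x\<in>ring r1 r2 x0. Q x * \<eta> (dist x x0) ^ DIM('a) \<partial>lebesgue) =
     (\<integral>\<^sup>+ x. ennreal ((1 / i) ^ DIM('a)) * (Q x * \<psi> (dist x x0) ^ DIM('a) * indicator (ring r1 r2 x0) x) \<partial>lebesgue)"
    using i1 by (simp add: \<eta>_def power_mult_distrib ennreal_power mult_ac)
  also have "\<dots> = ennreal ((1 / i) ^ DIM('a)) * (\<integral>\<^sup>+ x\<in>ring r1 r2 x0. Q x * \<psi> (dist x x0) ^ DIM('a) \<partial>lebesgue)"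
    by (rule nn_integral_cmult) measurable
  also have "\<dots> \<le> ennreal ((1 / i) ^ DIM('a)) * (ennreal B * ennreal i)"
    using J unfolding i(1) by (rule mult_left_mono) simp
  also have "\<dots> = ennreal ((1 / i) ^ DIM('a) * (B * i))"
    using i1 B by (simp add: ennreal_mult)
  also have "\<dots> < ennreal \<mu>"
  proof (rule ennreal_lessI[OF \<mu>])
    have "(1 / i) ^ DIM('a) \<le> (1 / i) ^ 2" using i1 n by (intro power_decreasing) auto
    then have "(1 / i) ^ DIM('a) * (B * i) \<le> (1 / i) ^ 2 * (B * i)"
      using B i by (intro mult_right_mono) auto
    also have "\<dots> = B / i" using i1 by (simp add: power2_eq_square field_simps)
    also have "\<dots> < \<mu>" using i1 \<mu> by (simp add: field_simps)
    finally show "(1 / i) ^ DIM('a) * (B * i) < \<mu>" .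
  qed
  finally have 2: "(\<integral>\<^sup>+ x\<in>ring r1 r2 x0. Q x * \<eta> (dist x x0) ^ DIM('a) \<partial>lebesgue) < ennreal \<mu>" .
  have "\<eta> \<in> borel_measurable borel" unfolding \<eta>_def[abs_def] by measurable
  with r 1 2 show "\<exists>r1 r2 \<eta>. 0 < r1 \<and> r1 < r2 \<and> ereal r2 < dist_bd x0 D \<and> \<eta> \<in> borel_measurable borel \<and>
     (\<integral>\<^sup>+ r\<in>{r1<..<r2}. \<eta> r \<partial>lborel) \<ge> 1 \<and>
     (\<integral>\<^sup>+ x\<in>ring r1 r2 x0. Q x * \<eta> (dist x x0) ^ DIM('a) \<partial>lebesgue) < ennreal \<mu>"
    by (intro exI[of _ r1] exI[of _ r2] exI[of _ \<eta>]) simp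
qed

section \<open>Polar coordinates\<close>

lemma nn_integral_power_tail:
  assumes a: "a > 0" and n: "n > 0"
  shows "(\<integral>\<^sup>+s\<in>{a<..}. ennreal (1 / s ^ Suc n) \<partial>lborel) = ennreal (1 / (n * a ^ n))"
proof -
  have "((\<lambda>s. s powr (- real (Suc n))) has_integral -(a powr (- real (Suc n) + 1)) / (- real (Suc n) + 1)) {a..}"
    using assms by (intro has_integral_powr_to_inf) auto
  then have "(\<integral>\<^sup>+s. ennreal (indicator {a..} s * s powr (- real (Suc n))) \<partial>lborel) =
      ennreal (-(a powr (- real (Suc n) + 1)) / (- real (Suc n) + 1))"
    by (intro nn_integral_has_integral_lebesgue) auto
  also have "-(a powr (- real (Suc n) + 1)) / (- real (Suc n) + 1) = 1 / (n * a ^ n)"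
    using assms by (simp add: powr_minus powr_realpow field_simps)
  also have "(\<integral>\<^sup>+s. ennreal (indicator {a..} s * s powr (- real (Suc n))) \<partial>lborel) =
     (\<integral>\<^sup>+s\<in>{a<..}. ennreal (1 / s ^ Suc n) \<partial>lborel)"
  proof (rule nn_integral_cong_AE)
    have "AE s in lborel. s \<noteq> a" by (rule AE_lborel_singleton)
    then show "AE s in lborel. ennreal (indicator {a..} s * s powr (- real (Suc n))) = ennreal (1 / s ^ Suc n) * indicator {a<..} s"
    proof eventually_elim
      case (elim s)
      have "s powr (- real (Suc n)) = 1 / s ^ Suc n" if "s > 0"
        using that by (simp only: powr_minus powr_realpow inverse_eq_divide)
      then show ?case using elim a by (auto simp: indicator_def)
    qed
  qed
  finally show ?thesis .
qed

text \<open>As \<open>sphere_int\<close> is n times an integral over the unit ball, Tonelli and two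
  substitutions give the formula: r = |x| s for fixed x, then y = s x for fixed s. The remaining
  integral of s^-(n+1) over s > |y| is 1/(n |y|^n), which cancels the factors n and |y|^n.\<close>

lemma polar_coordinates:
  fixes f :: "'a::euclidean_space \<Rightarrow> ennreal"
  assumes f: "f \<in> borel_measurable borel"
  shows "(\<integral>\<^sup>+r\<in>{0<..}. ennreal (r ^ (DIM('a) - 1)) * sphere_int (\<lambda>\<theta>. f (r *\<^sub>R \<theta>)) \<partial>lborel) = (\<integral>\<^sup>+y. f y \<partial>lborel)"
proof -
  note [measurable] = f
  define n where "n = DIM('a)"
  have n: "n > 0" by (simp add: n_def)
  have [measurable]: "ball (0::'a) 1 \<in> sets borel" by simp
  let ?h = "\<lambda>r x. ennreal (r ^ (n - 1)) * (f (r *\<^sub>R (x /\<^sub>R norm x)) * indicator (ball 0 1) x) * indicator {0<..} r"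
  have "(\<integral>\<^sup>+r\<in>{0<..}. ennreal (r ^ (n - 1)) * sphere_int (\<lambda>\<theta>. f (r *\<^sub>R \<theta>)) \<partial>lborel) =
    (\<integral>\<^sup>+r. of_nat n * (\<integral>\<^sup>+x. ?h r x \<partial>lborel) \<partial>lborel)"
  proof (rule nn_integral_cong)
    fix r :: real
    have "(\<integral>\<^sup>+x. ?h r x \<partial>lborel) = ennreal (r ^ (n - 1)) * (\<integral>\<^sup>+x\<in>ball 0 1. f (r *\<^sub>R (x /\<^sub>R norm x)) \<partial>lborel) * indicator {0<..} r"
    proof -
      have "(\<integral>\<^sup>+x. ?h r x \<partial>lborel) = (\<integral>\<^sup>+x. ennreal (r ^ (n - 1)) * (f (r *\<^sub>R (x /\<^sub>R norm x)) * indicator (ball 0 1) x) \<partial>lborel) * indicator {0<..} r"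
        by (rule nn_integral_multc) measurable
      also have "(\<integral>\<^sup>+x. ennreal (r ^ (n - 1)) * (f (r *\<^sub>R (x /\<^sub>R norm x)) * indicator (ball 0 1) x) \<partial>lborel) =
         ennreal (r ^ (n - 1)) * (\<integral>\<^sup>+x\<in>ball 0 1. f (r *\<^sub>R (x /\<^sub>R norm x)) \<partial>lborel)"
        by (rule nn_integral_cmult) measurable
      finally show ?thesis .
    qed
    then show "ennreal (r ^ (n - 1)) * sphere_int (\<lambda>\<theta>. f (r *\<^sub>R \<theta>)) * indicator {0<..} r = of_nat n * (\<integral>\<^sup>+x. ?h r x \<partial>lborel)"
      by (simp add: sphere_int_def n_def nn_integral_completion mult_ac)
  qed
  also have "\<dots> = of_nat n * (\<integral>\<^sup>+r. (\<integral>\<^sup>+x. ?h r x \<partial>lborel) \<partial>lborel)"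
    by (rule nn_integral_cmult) measurable
  also have "(\<integral>\<^sup>+r. (\<integral>\<^sup>+x. ?h r x \<partial>lborel) \<partial>lborel) = (\<integral>\<^sup>+x. (\<integral>\<^sup>+r. ?h r x \<partial>lborel) \<partial>lborel)"
    by (rule lborel_pair.Fubini') measurable
  also have "\<dots> = (\<integral>\<^sup>+x. (\<integral>\<^sup>+s. ennreal (norm x ^ n) * (ennreal (s ^ (n - 1)) * (f (s *\<^sub>R x) * indicator (ball 0 1) x) * indicator {0<..} s) \<partial>lborel) \<partial>lborel)"
  proof (rule nn_integral_cong_AE)
    have "AE x in lborel. x \<noteq> (0::'a)" by (rule AE_lborel_singleton)
    then show "AE x in lborel. (\<integral>\<^sup>+r. ?h r x \<partial>lborel) =
      (\<integral>\<^sup>+s. ennreal (norm x ^ n) * (ennreal (s ^ (n - 1)) * (f (s *\<^sub>R x) * indicator (ball 0 1) x) * indicator {0<..} s) \<partial>lborel)"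
    proof eventually_elim
      case (elim x)
      then have x: "norm x > 0" by simp
      have "(\<integral>\<^sup>+r. ?h r x \<partial>lborel) = ennreal \<bar>norm x\<bar> * (\<integral>\<^sup>+s. ?h (0 + norm x * s) x \<partial>lborel)"
        using x by (intro nn_integral_real_affine) auto
      also have "\<dots> = (\<integral>\<^sup>+s. ennreal (norm x) * ?h (norm x * s) x \<partial>lborel)"
        by (subst nn_integral_cmult[symmetric]) auto
      also have "\<dots> = (\<integral>\<^sup>+s. ennreal (norm x ^ n) * (ennreal (s ^ (n - 1)) * (f (s *\<^sub>R x) * indicator (ball 0 1) x) * indicator {0<..} s) \<partial>lborel)"
      proof (rule nn_integral_cong)
        fix s :: real
        show "ennreal (norm x) * ?h (norm x * s) x = ennreal (norm x ^ n) * (ennreal (s ^ (n - 1)) * (f (s *\<^sub>R x) * indicator (ball 0 1) x) * indicator {0<..} s)"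
        proof (cases "s > 0")
          case True
          have "norm x * (norm x * s) ^ (n - 1) = norm x ^ n * s ^ (n - 1)"
            using n by (cases n) (auto simp: power_mult_distrib)
          then have "ennreal (norm x) * ennreal ((norm x * s) ^ (n - 1)) = ennreal (norm x ^ n) * ennreal (s ^ (n - 1))"
            using True x by (simp add: ennreal_mult[symmetric])
          moreover have eq: "(norm x * s) *\<^sub>R (x /\<^sub>R norm x) = s *\<^sub>R x" using x by simp
          ultimately show ?thesis unfolding eq using True x by (simp add: mult.assoc[symmetric])
        next
          case False
          then show ?thesis using x by (simp add: indicator_def zero_less_mult_iff)
        qed
      qed
      finally show ?case .
    qed
  qed
  also have "\<dots> = (\<integral>\<^sup>+s. (\<integral>\<^sup>+x. ennreal (norm x ^ n) * (ennreal (s ^ (n - 1)) * (f (s *\<^sub>R x) * indicator (ball 0 1) x) * indicator {0<..} s) \<partial>lborel) \<partial>lborel)"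
    by (rule lborel_pair.Fubini') measurable
  \<comment> \<open>With y = s x the condition |x| < 1 becomes |y| < s, the lower limit of the final
    integral over s.\<close>
  also have "\<dots> = (\<integral>\<^sup>+s. (\<integral>\<^sup>+y. f y * ennreal (norm y ^ n) * (ennreal (1 / s ^ Suc n) * indicator {norm y<..} s) \<partial>lborel) \<partial>lborel)"
  proof (rule nn_integral_cong)
    fix s :: real
    show "(\<integral>\<^sup>+x. ennreal (norm x ^ n) * (ennreal (s ^ (n - 1)) * (f (s *\<^sub>R x) * indicator (ball 0 1) x) * indicator {0<..} s) \<partial>lborel)
      = (\<integral>\<^sup>+y. f y * ennreal (norm y ^ n) * (ennreal (1 / s ^ Suc n) * indicator {norm y<..} s) \<partial>lborel)"
    proof (cases "s > 0")
      case True
      have [measurable]: "(\<lambda>y::'a. indicator {norm y<..} s :: ennreal) \<in> borel_measurable borel"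
        unfolding indicator_def greaterThan_iff by measurable
      have "(\<integral>\<^sup>+y. f y * ennreal (norm y ^ n) * (ennreal (1 / s ^ Suc n) * indicator {norm y<..} s) \<partial>lborel) =
        ennreal (\<bar>s\<bar> ^ DIM('a)) * (\<integral>\<^sup>+x. f (0 + s *\<^sub>R x) * ennreal (norm (0 + s *\<^sub>R x) ^ n) * (ennreal (1 / s ^ Suc n) * indicator {norm (0 + s *\<^sub>R x)<..} s) \<partial>lborel)"
        using True by (intro nn_integral_lborel_affine) auto
      also have "\<dots> = (\<integral>\<^sup>+x. ennreal (s ^ n) * (f (s *\<^sub>R x) * ennreal (norm (s *\<^sub>R x) ^ n) * (ennreal (1 / s ^ Suc n) * indicator {norm (s *\<^sub>R x)<..} s)) \<partial>lborel)"
        using True by (subst nn_integral_cmult) (auto simp: n_def indicator_def)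
      also have "\<dots> = (\<integral>\<^sup>+x. ennreal (norm x ^ n) * (ennreal (s ^ (n - 1)) * (f (s *\<^sub>R x) * indicator (ball 0 1) x) * indicator {0<..} s) \<partial>lborel)"
      proof (rule nn_integral_cong)
        fix x :: 'a
        have "s ^ n * (norm (s *\<^sub>R x) ^ n) * (1 / s ^ Suc n) = norm x ^ n * s ^ (n - 1)"
          using True n by (cases n) (auto simp: power_mult_distrib field_simps)
        then have *: "ennreal (s ^ n) * ennreal (norm (s *\<^sub>R x) ^ n) * ennreal (1 / s ^ Suc n) = ennreal (norm x ^ n) * ennreal (s ^ (n - 1))"
          using True by (simp only: ennreal_mult[symmetric] zero_le_power norm_ge_zero less_imp_le zero_le_divide_1_iff mult_nonneg_nonneg)
        have ind: "indicator {norm (s *\<^sub>R x)<..} s = (indicator (ball 0 1) x :: ennreal)"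
          using True by (simp add: indicator_def mult_less_cancel_left1)
        have "ennreal (s ^ n) * (f (s *\<^sub>R x) * ennreal (norm (s *\<^sub>R x) ^ n) * (ennreal (1 / s ^ Suc n) * indicator {norm (s *\<^sub>R x)<..} s)) =
          (ennreal (s ^ n) * ennreal (norm (s *\<^sub>R x) ^ n) * ennreal (1 / s ^ Suc n)) * f (s *\<^sub>R x) * indicator (ball 0 1) x"
          unfolding ind by (simp only: mult_ac)
        then show "ennreal (s ^ n) * (f (s *\<^sub>R x) * ennreal (norm (s *\<^sub>R x) ^ n) * (ennreal (1 / s ^ Suc n) * indicator {norm (s *\<^sub>R x)<..} s)) =
          ennreal (norm x ^ n) * (ennreal (s ^ (n - 1)) * (f (s *\<^sub>R x) * indicator (ball 0 1) x) * indicator {0<..} s)"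
          unfolding * using True by (simp add: mult_ac)
      qed
      finally show ?thesis by simp
    next
      case False
      then have "\<not> norm y < s" for y :: 'a by (meson norm_ge_zero order_le_less_trans)
      then show ?thesis using False by simp
    qed
  qed
  also have "\<dots> = (\<integral>\<^sup>+y. (\<integral>\<^sup>+s. f y * ennreal (norm y ^ n) * (ennreal (1 / s ^ Suc n) * indicator {norm y<..} s) \<partial>lborel) \<partial>lborel)"
    by (rule lborel_pair.Fubini') (unfold indicator_def greaterThan_iff, measurable)
  also have "\<dots> = (\<integral>\<^sup>+y. f y * ennreal (1 / n) \<partial>lborel)"
  proof (rule nn_integral_cong_AE)
    have "AE y in lborel. y \<noteq> (0::'a)" by (rule AE_lborel_singleton)
    then show "AE y in lborel. (\<integral>\<^sup>+s. f y * ennreal (norm y ^ n) * (ennreal (1 / s ^ Suc n) * indicator {norm y<..} s) \<partial>lborel) = f y * ennreal (1 / n)"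
    proof eventually_elim
      case (elim y)
      then have y: "norm y > 0" by simp
      have "(\<integral>\<^sup>+s. f y * ennreal (norm y ^ n) * (ennreal (1 / s ^ Suc n) * indicator {norm y<..} s) \<partial>lborel) =
        f y * ennreal (norm y ^ n) * ennreal (1 / (n * norm y ^ n))"
        by (subst nn_integral_cmult, measurable) (simp add: nn_integral_power_tail[OF y n, simplified])
      also have "\<dots> = f y * ennreal (1 / n)"
        using y n by (simp add: mult.assoc ennreal_mult[symmetric])
      finally show ?case .
    qed
  qed
  also have "\<dots> = (\<integral>\<^sup>+y. f y \<partial>lborel) * ennreal (1 / n)" by (rule nn_integral_multc) measurable
  also have "of_nat n * \<dots> = (\<integral>\<^sup>+y. f y \<partial>lborel)"
  proof -
    have "of_nat n * ennreal (1 / n) = 1"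
      using n by (simp add: ennreal_of_nat_eq_real_of_nat ennreal_mult[symmetric])
    then show ?thesis by (metis mult.commute mult.left_commute mult.right_neutral)
  qed
  finally show ?thesis by (simp add: n_def)
qed

lemma sphere_int_mono: "(\<And>x. g x \<le> h x) \<Longrightarrow> sphere_int g \<le> sphere_int h"
  unfolding sphere_int_def by (intro mult_left_mono nn_integral_mono mult_right_mono) auto

text \<open>Q is only Lebesgue measurable, and its restriction to a particular sphere may fail to be
  measurable. A Borel minorant P, equal to Q almost everywhere, has the same integral over the ring,
  and its sphere integrals are at most those of Q by monotonicity; hence an inequality.\<close>

lemma ring_integral_le_polar:
  fixes Q :: "'a::euclidean_space \<Rightarrow> ennreal"
  assumes Q: "Q \<in> borel_measurable lebesgue" and \<psi>: "\<psi> \<in> borel_measurable borel" and r1: "r1 \<ge> 0"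
  shows "(\<integral>\<^sup>+x\<in>ring r1 r2 x0. Q x * \<psi> (dist x x0) ^ DIM('a) \<partial>lebesgue) \<le>
    (\<integral>\<^sup>+r\<in>{r1<..<r2}. surf_int Q x0 r * \<psi> r ^ DIM('a) \<partial>lborel)"
proof -
  obtain Q' where Q': "Q' \<in> borel_measurable lborel" "AE x in lborel. Q x = Q' x"
    using completion_ex_borel_measurable[OF Q] by blast
  obtain N where N: "{x \<in> space lborel. \<not> Q x = Q' x} \<subseteq> N" "emeasure lborel N = 0" "N \<in> sets lborel"
    using AE_E[OF Q'(2)] by blast
  \<comment> \<open>Setting P to 0 on a Borel null set containing the exceptional points makes P <=
    Q hold everywhere, in particular on each single sphere.\<close>
  define P where "P x = (if x \<in> N then 0 else Q' x)" for x
  have eqN: "Q x = Q' x" if "x \<notin> N" for x using N(1) that by auto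
  have P_le: "P x \<le> Q x" for x by (simp add: P_def eqN)
  have [measurable]: "N \<in> sets borel" "Q' \<in> borel_measurable borel" using N(3) Q'(1) by auto
  have [measurable]: "P \<in> borel_measurable borel" unfolding P_def[abs_def] by measurable
  note [measurable] = \<psi> ring_in_sets
  have ae: "AE x in lborel. Q x = P x"
  proof -
    have "AE x in lborel. x \<notin> N" using N by (intro AE_not_in) auto
    then show ?thesis by (rule eventually_mono) (simp add: P_def eqN)
  qed
  have [measurable]: "ball (0::'a) 1 \<in> sets borel" by simp
  define f where "f y = P (x0 + y) * \<psi> (norm y) ^ DIM('a) * indicator {r1<..<r2} (norm y)" for y
  have [measurable]: "f \<in> borel_measurable borel" unfolding f_def[abs_def] by measurable
  have "(\<integral>\<^sup>+x\<in>ring r1 r2 x0. Q x * \<psi> (dist x x0) ^ DIM('a) \<partial>lebesgue) =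
     (\<integral>\<^sup>+x\<in>ring r1 r2 x0. P x * \<psi> (dist x x0) ^ DIM('a) \<partial>lborel)"
    unfolding nn_integral_completion by (rule nn_integral_cong_AE) (use ae in eventually_elim, simp)
  also have "\<dots> = (\<integral>\<^sup>+y. f y \<partial>lborel)"
    by (subst nn_integral_lborel_affine[where c = 1 and t = x0])
      (auto simp: f_def ring_def indicator_def dist_norm intro!: nn_integral_cong)
  also have "\<dots> = (\<integral>\<^sup>+r\<in>{0<..}. ennreal (r ^ (DIM('a) - 1)) * sphere_int (\<lambda>\<theta>. f (r *\<^sub>R \<theta>)) \<partial>lborel)"
    by (rule polar_coordinates[symmetric]) measurable
  also have "\<dots> \<le> (\<integral>\<^sup>+r\<in>{r1<..<r2}. surf_int Q x0 r * \<psi> r ^ DIM('a) \<partial>lborel)"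
  proof (rule nn_integral_mono)
    fix r :: real
    show "ennreal (r ^ (DIM('a) - 1)) * sphere_int (\<lambda>\<theta>. f (r *\<^sub>R \<theta>)) * indicator {0<..} r \<le>
      surf_int Q x0 r * \<psi> r ^ DIM('a) * indicator {r1<..<r2} r"
    proof (cases "r > 0")
      case r: True
      let ?c = "\<psi> r ^ DIM('a) * indicator {r1<..<r2} r"
      have "(\<integral>\<^sup>+x\<in>ball 0 1. f (r *\<^sub>R (x /\<^sub>R norm x)) \<partial>lborel) \<le> (\<integral>\<^sup>+x. (P (x0 + r *\<^sub>R (x /\<^sub>R norm x)) * indicator (ball 0 1) x) * ?c \<partial>lborel)"
      proof (rule nn_integral_mono)
        fix x :: 'a
        show "f (r *\<^sub>R (x /\<^sub>R norm x)) * indicator (ball 0 1) x \<le> (P (x0 + r *\<^sub>R (x /\<^sub>R norm x)) * indicator (ball 0 1) x) * ?c"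
        proof (cases "x = 0")
          case True
          then show ?thesis using r1 by (simp add: f_def)
        next
          case False
          then have "norm (r *\<^sub>R (x /\<^sub>R norm x)) = r" using r by simp
          then show ?thesis unfolding f_def by (simp add: mult_ac)
        qed
      qed
      also have "\<dots> = (\<integral>\<^sup>+x\<in>ball 0 1. P (x0 + r *\<^sub>R (x /\<^sub>R norm x)) \<partial>lborel) * ?c"
        by (rule nn_integral_multc) measurable
      finally have "sphere_int (\<lambda>\<theta>. f (r *\<^sub>R \<theta>)) \<le> sphere_int (\<lambda>\<theta>. P (x0 + r *\<^sub>R \<theta>)) * ?c"
        unfolding sphere_int_def nn_integral_completion mult.assoc by (rule mult_left_mono) simp
      also have "\<dots> \<le> sphere_int (\<lambda>\<theta>. Q (x0 + r *\<^sub>R \<theta>)) * ?c"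
        by (intro mult_right_mono sphere_int_mono P_le) simp
      finally have "ennreal (r ^ (DIM('a) - 1)) * sphere_int (\<lambda>\<theta>. f (r *\<^sub>R \<theta>)) \<le>
         ennreal (r ^ (DIM('a) - 1)) * (sphere_int (\<lambda>\<theta>. Q (x0 + r *\<^sub>R \<theta>)) * ?c)"
        by (rule mult_left_mono) simp
      then show ?thesis using r by (simp add: surf_int_def mult.assoc)
    qed simp
  qed
  finally show ?thesis .
qed

lemma omega_pos_finite: "omega TYPE('a::euclidean_space) \<noteq> 0" "omega TYPE('a) \<noteq> \<infinity>"
proof -
  have "omega TYPE('a) = of_nat DIM('a) * emeasure lborel (ball (0::'a) 1)"
    unfolding omega_def sphere_int_def nn_integral_completion by simp
  moreover have "emeasure lborel (ball (0::'a) 1) < \<infinity>" by (rule emeasure_lborel_ball_finite)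
  moreover have "emeasure lborel (ball (0::'a) 1) \<noteq> 0"
    using content_ball_pos[of 1 "0::'a"] by (auto simp: measure_def)
  ultimately show "omega TYPE('a) \<noteq> 0" "omega TYPE('a) \<noteq> \<infinity>"
    by (auto simp: ennreal_mult_eq_top_iff)
qed

lemma surf_int_eq_q_mean:
  fixes Q :: "'a::euclidean_space \<Rightarrow> ennreal"
  assumes "r > 0"
  shows "surf_int Q x0 r = omega TYPE('a) * (ennreal (r ^ (DIM('a) - 1)) * q_mean Q x0 r)"
proof -
  let ?w = "omega TYPE('a) * ennreal (r ^ (DIM('a) - 1))"
  have "?w \<noteq> 0" "?w \<noteq> \<infinity>" using assms omega_pos_finite[where 'a='a]
    by (auto simp: ennreal_mult_eq_top_iff ennreal_eq_0_iff not_le)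
  then have "surf_int Q x0 r / ?w * ?w = surf_int Q x0 r"
    by (simp add: ennreal_divide_times mult_divide_eq_ennreal[of ?w 1, simplified])
  then show ?thesis unfolding q_mean_def by (simp add: mult_ac)
qed

section \<open>The three conditions on Q\<close>

lemma enn_root_power: "k > 0 \<Longrightarrow> enn_root k x ^ k = x"
  unfolding enn_root_def
  by (cases x) (auto simp: ennreal_power)

lemma enn_root_mono_real:
  assumes "k > 0" "x \<le> ennreal (a ^ k)" "a \<ge> 0"
  shows "enn_root k x \<le> ennreal a"
proof -
  obtain y where y: "x = ennreal y" "y \<ge> 0" "y \<le> a ^ k"
    using assms by (cases x) (auto simp: top_unique)
  then have "root k y \<le> root k (a ^ k)" using assms by simp
  also have "\<dots> = a" using assms by (simp add: real_root_power_cancel)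
  finally show ?thesis using y by (auto simp: enn_root_def intro: ennreal_leI)
qed

text \<open>The extremal weight is the reciprocal of t q(t)^(1/(n-1)). As q need not be Borel measurable, a simple
  function below it is used instead.\<close>

lemma small_ring_integrals_divergence:
  fixes Q :: "'a::euclidean_space \<Rightarrow> ennreal"
  assumes n: "DIM('a) \<ge> 2" and Q: "Q \<in> borel_measurable lebesgue" and \<epsilon>0: "\<epsilon>0 > 0" "ereal \<epsilon>0 < dist_bd x0 D"
    and div: "(\<integral>\<^sup>+ t\<in>{0<..<\<epsilon>0}. inverse (ennreal t * enn_root (DIM('a) - 1) (q_mean Q x0 t)) \<partial>lborel) = \<infinity>"
  shows "small_ring_integrals D Q x0"
proof -
  obtain B where B: "omega TYPE('a) = ennreal B" "B \<ge> 0"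
    using omega_pos_finite[where 'a='a] by (cases "omega TYPE('a)") auto
  let ?\<psi> = "\<lambda>t. inverse (ennreal t * enn_root (DIM('a) - 1) (q_mean Q x0 t)) * indicator {0<..<\<epsilon>0} t"
  show ?thesis
  proof (rule small_ring_integralsI[OF n Q B(2)])
    fix M :: real
    have "ennreal M < integral\<^sup>N lborel ?\<psi>" using div by simp
    \<comment> \<open>A simple function with finite values has a finite integral over a bounded
      interval, as \<open>small_ring_integralsI\<close> demands.\<close>
    then obtain g where g: "simple_function lborel g" "g \<le> ?\<psi>" "\<And>x. g x < top" "ennreal M < integral\<^sup>S lborel g"
      unfolding nn_integral_def_finite less_SUP_iff by blast
    have gb: "g \<in> borel_measurable borel" using borel_measurable_simple_function[OF g(1)] by simp
    note [measurable] = gb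
    have gle: "g t \<le> inverse (ennreal t * enn_root (DIM('a) - 1) (q_mean Q x0 t))" for t
      using le_funD[OF g(2), of t] by (cases "t \<in> {0<..<\<epsilon>0}") auto
    have g0: "g t = 0" if "t \<notin> {0<..<\<epsilon>0}" for t
      using le_funD[OF g(2), of t] that by simp
    \<comment> \<open>The inner radius has to be positive. Dividing by k + 2 keeps every
      \<open>r k\<close> below \<epsilon>0, also for k = 0, and monotone convergence recovers the
      integral of g.\<close>
    define r where "r k = \<epsilon>0 / real (Suc (Suc k))" for k
    have r: "0 < r k" "r k < \<epsilon>0" for k using \<epsilon>0 by (auto simp: r_def field_simps intro!: add_pos_nonneg)
    have "(SUP k. (\<integral>\<^sup>+t. g t * indicator {r k<..<\<epsilon>0} t \<partial>lborel)) = (\<integral>\<^sup>+t. (SUP k. g t * indicator {r k<..<\<epsilon>0} t) \<partial>lborel)"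
    proof (rule nn_integral_monotone_convergence_SUP[symmetric])
      show "incseq (\<lambda>k t. g t * indicator {r k<..<\<epsilon>0} t)"
      proof (intro incseq_SucI le_funI mult_left_mono)
        fix k t
        have "r (Suc k) \<le> r k" using \<epsilon>0 unfolding r_def by (intro divide_left_mono) auto
        then show "indicator {r k<..<\<epsilon>0} t \<le> (indicator {r (Suc k)<..<\<epsilon>0} t :: ennreal)" by (auto simp: indicator_def)
      qed simp
    qed measurable
    also have "\<dots> = (\<integral>\<^sup>+t. g t \<partial>lborel)"
    proof (rule nn_integral_cong)
      fix t
      show "(SUP k. g t * indicator {r k<..<\<epsilon>0} t) = g t"
      proof (cases "t \<in> {0<..<\<epsilon>0}")
        case True
        have "t / \<epsilon>0 > 0" using True \<epsilon>0 by simp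
        then obtain k where "inverse (real (Suc k)) < t / \<epsilon>0" using reals_Archimedean by blast
        then have "\<epsilon>0 / real (Suc k) < t" using \<epsilon>0 by (simp add: field_simps)
        moreover have "r k \<le> \<epsilon>0 / real (Suc k)" using \<epsilon>0 unfolding r_def by (intro divide_left_mono) auto
        ultimately have "r k < t" by simp
        then have "g t * indicator {r k<..<\<epsilon>0} t = g t" using True by simp
        then show ?thesis by (intro antisym SUP_least) (auto simp: indicator_def intro: SUP_upper2[of k])
      qed (simp add: g0)
    qed
    also have "\<dots> = integral\<^sup>S lborel g" using g(1) by (rule nn_integral_eq_simple_integral)
    finally have "ennreal M < (SUP k. (\<integral>\<^sup>+t. g t * indicator {r k<..<\<epsilon>0} t \<partial>lborel))" using g(4) by simp
    then obtain k where k: "ennreal M < (\<integral>\<^sup>+t. g t * indicator {r k<..<\<epsilon>0} t \<partial>lborel)" unfolding less_SUP_iff by blast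
    have fin: "(\<integral>\<^sup>+t. g t * indicator {r k<..<\<epsilon>0} t \<partial>lborel) < \<infinity>"
    proof -
      have "finite (range g)" using simple_functionD(1)[OF g(1)] by simp
      define m where "m = Max (range g)"
      have m: "m < top" "\<And>t. g t \<le> m" unfolding m_def using \<open>finite (range g)\<close> g(3) by (auto intro: Max_ge)
      have "(\<integral>\<^sup>+t. g t * indicator {r k<..<\<epsilon>0} t \<partial>lborel) \<le> (\<integral>\<^sup>+t. m * indicator {r k<..<\<epsilon>0} t \<partial>lborel)"
        by (intro nn_integral_mono mult_right_mono m) auto
      also have "\<dots> = m * ennreal (\<epsilon>0 - r k)" using r[of k] by (simp add: nn_integral_cmult_indicator)
      also have "\<dots> < \<infinity>" using m(1) by (simp add: ennreal_mult_less_top)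
      finally show ?thesis .
    qed
    have "(\<integral>\<^sup>+ x\<in>ring (r k) \<epsilon>0 x0. Q x * g (dist x x0) ^ DIM('a) \<partial>lebesgue) \<le>
      (\<integral>\<^sup>+ t\<in>{r k<..<\<epsilon>0}. surf_int Q x0 t * g t ^ DIM('a) \<partial>lborel)"
      using r[of k] by (intro ring_integral_le_polar[OF Q gb]) auto
    also have "\<dots> \<le> (\<integral>\<^sup>+ t. ennreal B * (g t * indicator {r k<..<\<epsilon>0} t) \<partial>lborel)"
    proof (rule nn_integral_mono)
      fix t
      show "surf_int Q x0 t * g t ^ DIM('a) * indicator {r k<..<\<epsilon>0} t \<le> ennreal B * (g t * indicator {r k<..<\<epsilon>0} t)"
      proof (cases "t \<in> {r k<..<\<epsilon>0}")
        case True
        then have t: "t > 0" using r[of k] by auto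
        define m where "m = DIM('a) - 1"
        have m: "m > 0" "DIM('a) = Suc m" using n by (auto simp: m_def)
        let ?R = "enn_root m (q_mean Q x0 t)"
        \<comment> \<open>The extreme values are treated apart: if \<open>ennreal t * ?R\<close> is
          0 the product vanishes, and if it is infinite its inverse is 0.\<close>
        have "ennreal t * ?R * g t \<le> 1"
        proof (cases "ennreal t * ?R = 0")
          case False
          have "ennreal t * ?R * g t \<le> ennreal t * ?R * inverse (ennreal t * ?R)"
            using gle[of t] unfolding m_def by (rule mult_left_mono) simp
          also have "\<dots> \<le> 1"
          proof (cases "ennreal t * ?R = top")
            case False
            then have "1 * (ennreal t * ?R) / (ennreal t * ?R) = 1"
              using \<open>ennreal t * ?R \<noteq> 0\<close> by (intro mult_divide_eq_ennreal) auto
            then show ?thesis by (simp add: divide_ennreal_def)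
          qed simp
          finally show ?thesis .
        qed auto
        then have "(ennreal t * ?R * g t) ^ m \<le> 1" by (rule power_le_one[rotated]) simp
        then have le: "ennreal (t ^ m) * q_mean Q x0 t * g t ^ m \<le> 1"
          using t enn_root_power[OF m(1)] by (simp add: power_mult_distrib ennreal_power)
        \<comment> \<open>As n = m + 1, one factor g is kept, and the remaining t^m q g^m is the
          m-th power of a number at most 1.\<close>
        have "surf_int Q x0 t * g t ^ DIM('a) = ennreal B * g t * (ennreal (t ^ m) * q_mean Q x0 t * g t ^ m)"
          using t by (subst surf_int_eq_q_mean) (auto simp: B(1) m mult_ac)
        also have "\<dots> \<le> ennreal B * g t * 1" using le by (rule mult_left_mono) simp
        finally show ?thesis using True by simp
      qed simp
    qed
    also have "\<dots> = ennreal B * (\<integral>\<^sup>+ t\<in>{r k<..<\<epsilon>0}. g t \<partial>lborel)" by (rule nn_integral_cmult) measurable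
    finally have "(\<integral>\<^sup>+ x\<in>ring (r k) \<epsilon>0 x0. Q x * g (dist x x0) ^ DIM('a) \<partial>lebesgue) \<le> ennreal B * (\<integral>\<^sup>+ t\<in>{r k<..<\<epsilon>0}. g t \<partial>lborel)" .
    then show "\<exists>r1 r2 \<psi>. 0 < r1 \<and> r1 < r2 \<and> ereal r2 < dist_bd x0 D \<and> \<psi> \<in> borel_measurable borel \<and>
      ennreal M \<le> (\<integral>\<^sup>+ r\<in>{r1<..<r2}. \<psi> r \<partial>lborel) \<and> (\<integral>\<^sup>+ r\<in>{r1<..<r2}. \<psi> r \<partial>lborel) < \<infinity> \<and>
      (\<integral>\<^sup>+ x\<in>ring r1 r2 x0. Q x * \<psi> (dist x x0) ^ DIM('a) \<partial>lebesgue) \<le> ennreal B * (\<integral>\<^sup>+ r\<in>{r1<..<r2}. \<psi> r \<partial>lborel)"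
      using r[of k] \<epsilon>0 gb k fin by (intro exI[of _ "r k"] exI[of _ \<epsilon>0] exI[of _ g]) (auto intro: less_imp_le)
  qed
qed

lemma inverse_ge_of_le_ennreal:
  assumes "x \<le> ennreal c" "c > 0" shows "ennreal (1 / c) \<le> inverse x"
proof -
  obtain y where y: "x = ennreal y" "y \<ge> 0" "y \<le> c"
    using assms by (cases x) (auto simp: top_unique)
  show ?thesis
  proof (cases "y = 0")
    case False
    then have "1 / c \<le> inverse y" using y assms by (simp add: inverse_eq_divide frac_le)
    then show ?thesis using y False by (simp add: inverse_ennreal ennreal_leI)
  qed (simp add: y)
qed

text \<open>The bound on q makes the integrand of the divergence condition at least 1/(K t log(1/t))
  with K = C^(1/(n-1)), and its primitive -log(log(1/t))/K is unbounded at 0.\<close>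

lemma small_ring_integrals_log:
  fixes Q :: "'a::euclidean_space \<Rightarrow> ennreal"
  assumes n: "DIM('a) \<ge> 2" and Q: "Q \<in> borel_measurable lebesgue" and R: "R > 0" "ereal R < dist_bd x0 D"
    and C: "C > 0" and \<epsilon>': "\<epsilon>' > 0"
    and q: "\<forall>r\<in>{0<..<\<epsilon>'}. q_mean Q x0 r \<le> ennreal (C * (ln (1 / r)) ^ (DIM('a) - 1))"
  shows "small_ring_integrals D Q x0"
proof -
  define m where "m = DIM('a) - 1"
  have m: "m > 0" using n by (simp add: m_def)
  \<comment> \<open>Below 1/2 the logarithm of 1/t is positive, and R keeps the rings inside
    D.\<close>
  define \<epsilon>0 where "\<epsilon>0 = min \<epsilon>' (min R (1/2))"
  have \<epsilon>0: "\<epsilon>0 > 0" "\<epsilon>0 \<le> \<epsilon>'" "\<epsilon>0 \<le> R" "\<epsilon>0 \<le> 1/2" using R \<epsilon>' by (auto simp: \<epsilon>0_def)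
  have "ereal \<epsilon>0 < dist_bd x0 D" using R(2) \<epsilon>0(3) by (meson ereal_less_eq(3) order_le_less_trans)
  define K where "K = root m C"
  have K: "K > 0" "K ^ m = C" using C m by (auto simp: K_def)
  define f where "f t = 1 / (K * t * (- ln t))" for t
  have ln_neg: "- ln t > 0" if "0 < t" "t < 1" for t :: real using that by simp
  have ge: "ennreal (f t) \<le> inverse (ennreal t * enn_root m (q_mean Q x0 t))" if t: "t \<in> {0<..<\<epsilon>0}" for t
  proof -
    have L: "- ln t > 0" using t \<epsilon>0 by (intro ln_neg) auto
    have "q_mean Q x0 t \<le> ennreal (C * (ln (1 / t)) ^ m)" using q t \<epsilon>0 unfolding m_def by auto
    also have "C * (ln (1 / t)) ^ m = (K * (- ln t)) ^ m"
    proof -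
      have "ln (1 / t) = - ln t" using t by (simp add: ln_div)
      then show ?thesis by (simp only: power_mult_distrib K(2))
    qed
    finally have "enn_root m (q_mean Q x0 t) \<le> ennreal (K * (- ln t))"
      using K(1) L by (intro enn_root_mono_real m mult_nonneg_nonneg) auto
    then have "ennreal t * enn_root m (q_mean Q x0 t) \<le> ennreal t * ennreal (K * (- ln t))"
      by (rule mult_left_mono) simp
    also have "\<dots> = ennreal (t * (K * (- ln t)))"
      using t K(1) L by (intro ennreal_mult[symmetric] mult_nonneg_nonneg less_imp_le) auto
    also have "t * (K * (- ln t)) = K * t * (- ln t)" by (simp only: mult_ac)
    finally show ?thesis unfolding f_def using t K(1) L by (intro inverse_ge_of_le_ennreal mult_pos_pos) auto
  qed
  have "of_nat N \<le> (\<integral>\<^sup>+ t\<in>{0<..<\<epsilon>0}. inverse (ennreal t * enn_root m (q_mean Q x0 t)) \<partial>lborel)" for N :: nat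
  proof -
    define b where "b = \<epsilon>0 / 2"
    have b: "0 < b" "b < \<epsilon>0" "b < 1" using \<epsilon>0 by (auto simp: b_def)
    \<comment> \<open>Chosen so that log(log(1/a)) = y: the integral of f over [a,b] is then exactly
      N.\<close>
    define y where "y = K * N + ln (- ln b)"
    define a where "a = exp (- exp y)"
    have "- ln b = exp (ln (- ln b))" using ln_neg[OF b(1,3)] by simp
    also have "\<dots> \<le> exp y" using K by (simp add: y_def)
    finally have "exp (- exp y) \<le> exp (ln b)" by simp
    then have a: "0 < a" "a \<le> b" using b by (auto simp: a_def)
    have "(\<integral>\<^sup>+t. ennreal (f t) * indicator {a..b} t \<partial>lborel) = (- ln (- ln b) / K) - (- ln (- ln a) / K)"
    proof (rule nn_integral_FTC_Icc)
      show "f \<in> borel_measurable borel" unfolding f_def[abs_def] by measurable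
      fix t assume t: "t \<in> {a..b}"
      then have t': "t > 0" "- ln t > 0" using a b by auto
      show "((\<lambda>t. - ln (- ln t) / K) has_real_derivative f t) (at t)"
        using t' K(1) unfolding f_def by (auto intro!: derivative_eq_intros simp: field_simps)
      show "0 \<le> f t" using t' K(1) unfolding f_def by (intro divide_nonneg_nonneg mult_nonneg_nonneg) auto
    qed (rule a)
    also have "(- ln (- ln b) / K) - (- ln (- ln a) / K) = N"
      using K(1) by (simp add: a_def y_def field_simps)
    finally have "of_nat N = (\<integral>\<^sup>+t. ennreal (f t) * indicator {a..b} t \<partial>lborel)"
      by (simp add: ennreal_of_nat_eq_real_of_nat)
    also have "\<dots> \<le> (\<integral>\<^sup>+ t\<in>{0<..<\<epsilon>0}. inverse (ennreal t * enn_root m (q_mean Q x0 t)) \<partial>lborel)"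
      using ge a b by (intro nn_integral_mono) (auto simp: indicator_def)
    finally show ?thesis .
  qed
  then have "(\<integral>\<^sup>+ t\<in>{0<..<\<epsilon>0}. inverse (ennreal t * enn_root m (q_mean Q x0 t)) \<partial>lborel) = \<infinity>"
    by (metis ennreal_Ex_less_of_nat infinity_ennreal_def not_le top.not_eq_extremum)
  then show ?thesis
    using small_ring_integrals_divergence[OF n Q \<epsilon>0(1) \<open>ereal \<epsilon>0 < dist_bd x0 D\<close>] unfolding m_def by simp
qed

text \<open>Bounded oscillation lets the mean of Q grow at most linearly under repeated halving of
  the radius. The weight 1/(\<rho>_k (k+1)) on the k-th dyadic shell, a discrete 1/(t log(1/t)), has
  half a harmonic sum as integral, while the k-th term of the ring integral is at most a constant
  times (k+1)^(1-n) <= 1/(k+1).\<close>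

lemma small_ring_integrals_FMO:
  fixes Q :: "'a::euclidean_space \<Rightarrow> ennreal"
  assumes n: "DIM('a) \<ge> 2" and Q: "Q \<in> borel_measurable lebesgue" and R: "R > 0" "ereal R < dist_bd x0 D"
    and FMO: "FMO_at Q x0"
  shows "small_ring_integrals D Q x0"
proof -
  define n where "n = DIM('a)"
  have n2: "n \<ge> 2" using n by (simp add: n_def)
  define \<Omega> where "\<Omega> = measure lebesgue (ball (0::'a) 1)"
  define q where "q x = enn2real (Q x)" for x
  define mean where "mean r = (LINT x:ball x0 r|lebesgue. q x) / (\<Omega> * r ^ n)" for r
  define osc where "osc r = (LINT x:ball x0 r|lebesgue. \<bar>q x - mean r\<bar>) / (\<Omega> * r ^ n)" for r
  obtain \<epsilon>0 where \<epsilon>0: "\<epsilon>0 > 0" "set_integrable lebesgue (ball x0 \<epsilon>0) q" "AE x\<in>ball x0 \<epsilon>0 in lebesgue. Q x \<noteq> \<infinity>"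
    and lim: "Limsup (at_right 0) (\<lambda>r. ereal (osc r)) < \<infinity>"
    using FMO unfolding FMO_at_def Let_def q_def[symmetric] \<Omega>_def[symmetric] n_def[symmetric] mean_def[symmetric] osc_def[symmetric]
    by blast
  obtain c where "Limsup (at_right 0) (\<lambda>r. ereal (osc r)) < ereal c"
    using lim less_PInf_Ex_of_nat by (metis ereal_dense2 less_ereal.simps(4))
  then have "\<forall>\<^sub>F r in at_right 0. ereal (osc r) < ereal c" by (rule Limsup_lessD)
  then obtain \<epsilon>1 where \<epsilon>1: "\<epsilon>1 > 0" "\<And>r. 0 < r \<Longrightarrow> r < \<epsilon>1 \<Longrightarrow> osc r < c"
    unfolding eventually_at_right_field by auto
  define C where "C = max c 0"
  have osc_le: "osc r \<le> C" if "0 < r" "r < \<epsilon>1" for r using \<epsilon>1(2)[OF that] by (simp add: C_def)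
  define \<rho>0 where "\<rho>0 = min (min \<epsilon>0 \<epsilon>1) R / 2"
  have \<rho>0: "\<rho>0 > 0" "\<rho>0 < \<epsilon>0" "\<rho>0 < \<epsilon>1" "\<rho>0 < R" using \<epsilon>0(1) \<epsilon>1(1) R by (auto simp: \<rho>0_def min_def)
  define \<rho> where "\<rho> k = \<rho>0 / 2 ^ k" for k :: nat
  have \<rho>: "\<rho> k > 0" "\<rho> (Suc k) = \<rho> k / 2" "\<rho> k \<le> \<rho>0" for k
    using \<rho>0 by (auto simp: \<rho>_def field_simps)
  have \<rho>_mono: "\<rho> j \<le> \<rho> i" if "i \<le> j" for i j
    using that \<rho>0 unfolding \<rho>_def by (intro divide_left_mono power_increasing) auto
  have \<Omega>: "\<Omega> > 0" unfolding \<Omega>_def using content_ball_pos[of 1 "0::'a"] by (simp add: measure_completion)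
  have vol: "measure lebesgue (ball x0 r) = \<Omega> * r ^ n" if "r > 0" for r
    using that by (simp add: \<Omega>_def n_def content_ball measure_completion)
  have ball_sets: "ball x0 r \<in> sets lebesgue" for r by simp
  have int: "set_integrable lebesgue (ball x0 r) q" if "r \<le> \<epsilon>0" for r
    using \<epsilon>0(2) by (rule set_integrable_subset) (use that in auto)
  have int_c: "set_integrable lebesgue (ball x0 r) (\<lambda>x. d)" for r and d :: real
    unfolding set_integrable_def using emeasure_lborel_ball_finite[of x0 r]
    by (intro integrable_scaleR_left integrable_real_indicator) auto
  have int_const: "(LINT x:ball x0 r|lebesgue. d) = d * measure lebesgue (ball x0 r)" for r and d :: real
    using emeasure_lborel_ball_finite[of x0 r]
    by (simp add: set_lebesgue_integral_def mult.commute)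
  \<comment> \<open>The half-size ball has 2^-n of the volume, so the mean deviation over it is at
    most 2^n times that over the larger ball.\<close>
  have step: "mean (\<rho> (Suc k)) \<le> mean (\<rho> k) + 2 ^ n * C" for k
  proof -
    let ?r = "\<rho> k" and ?s = "\<rho> (Suc k)" and ?a = "mean (\<rho> k)"
    have r: "?r > 0" "?s > 0" "?s \<le> ?r" "?r \<le> \<epsilon>0" "?r < \<epsilon>1" using \<rho>[of k] \<rho>(1)[of "Suc k"] \<rho>0 by auto
    have i1: "set_integrable lebesgue (ball x0 d) (\<lambda>x. q x - ?a)" if "d \<le> \<epsilon>0" for d
      using int[OF that] int_c by (rule set_integral_diff)
    have i2: "set_integrable lebesgue (ball x0 d) (\<lambda>x. \<bar>q x - ?a\<bar>)" if "d \<le> \<epsilon>0" for d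
      using i1[OF that] by (rule set_integrable_abs)
    have s0: "?s \<le> \<epsilon>0" using r by simp
    have "(LINT x:ball x0 ?s|lebesgue. q x) - ?a * (\<Omega> * ?s ^ n) = (LINT x:ball x0 ?s|lebesgue. q x - ?a)"
      using r int[OF s0] int_c[of ?s ?a] vol[OF r(2)]
      by (subst set_integral_diff) (auto simp: int_const)
    also have "\<dots> \<le> (LINT x:ball x0 ?s|lebesgue. \<bar>q x - ?a\<bar>)"
      using i1[OF s0] i2[OF s0] by (rule set_integral_mono) auto
    also have "\<dots> \<le> (LINT x:ball x0 ?r|lebesgue. \<bar>q x - ?a\<bar>)"
    proof -
      have "ball x0 ?s \<subseteq> ball x0 ?r" using r by auto
      then show ?thesis
        using i2[OF s0] i2[OF r(4)] unfolding set_lebesgue_integral_def set_integrable_def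
        by (intro integral_mono) (auto simp: indicator_def)
    qed
    also have "\<dots> = osc ?r * (\<Omega> * ?r ^ n)" using \<Omega> r by (simp add: osc_def)
    also have "\<dots> \<le> C * (\<Omega> * ?r ^ n)" using osc_le[of ?r] r \<Omega> by (intro mult_right_mono) auto
    also have "\<dots> = 2 ^ n * C * (\<Omega> * ?s ^ n)" unfolding \<rho>(2) by (simp add: power_divide)
    finally have "(LINT x:ball x0 ?s|lebesgue. q x) \<le> (?a + 2 ^ n * C) * (\<Omega> * ?s ^ n)"
      by (simp add: distrib_right)
    then show ?thesis unfolding mean_def[of ?s] using \<Omega> r by (simp add: pos_divide_le_eq)
  qed
  \<comment> \<open>A dominates the first mean as well as every increment, which makes the bound A
    (k+1) inductive.\<close>
  define A where "A = \<bar>mean \<rho>0\<bar> + 2 ^ n * C"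
  have A0: "A \<ge> 0" by (simp add: A_def C_def)
  have mean_le: "mean (\<rho> k) \<le> A * real (Suc k)" for k
  proof (induction k)
    case 0
    have "2 ^ n * C \<ge> 0" by (simp add: C_def)
    then have "mean \<rho>0 \<le> A" unfolding A_def by linarith
    then show ?case by (simp add: \<rho>_def)
  next
    case (Suc k)
    have "2 ^ n * C \<le> A" by (simp add: A_def)
    with Suc step[of k] show ?case by (simp add: distrib_left)
  qed
  have Qint: "(\<integral>\<^sup>+x\<in>ball x0 (\<rho> k). Q x \<partial>lebesgue) \<le> ennreal (A * real (Suc k) * (\<Omega> * \<rho> k ^ n))" for k
  proof -
    have k: "\<rho> k \<le> \<epsilon>0" using \<rho>(3)[of k] \<rho>0 by simp
    have "(\<integral>\<^sup>+x\<in>ball x0 (\<rho> k). Q x \<partial>lebesgue) = (\<integral>\<^sup>+x. ennreal (indicator (ball x0 (\<rho> k)) x *\<^sub>R q x) \<partial>lebesgue)"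
    proof (rule nn_integral_cong_AE)
      show "AE x in lebesgue. Q x * indicator (ball x0 (\<rho> k)) x = ennreal (indicator (ball x0 (\<rho> k)) x *\<^sub>R q x)"
        using \<epsilon>0(3)
      proof eventually_elim
        case (elim x)
        show ?case
        proof (cases "x \<in> ball x0 (\<rho> k)")
          case True
          then have "Q x \<noteq> \<infinity>" using elim k by auto
          then show ?thesis using True by (simp add: q_def less_top)
        qed simp
      qed
    qed
    also have "\<dots> = ennreal (LINT x:ball x0 (\<rho> k)|lebesgue. q x)"
      unfolding set_lebesgue_integral_def using int[OF k]
      by (intro nn_integral_eq_integral) (auto simp: set_integrable_def q_def)
    also have "(LINT x:ball x0 (\<rho> k)|lebesgue. q x) = mean (\<rho> k) * (\<Omega> * \<rho> k ^ n)"
      using \<Omega> \<rho>(1)[of k] by (simp add: mean_def)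
    also have "ennreal \<dots> \<le> ennreal (A * real (Suc k) * (\<Omega> * \<rho> k ^ n))"
      using \<Omega> \<rho>(1)[of k] mean_le[of k] by (intro ennreal_leI mult_right_mono) auto
    finally show ?thesis .
  qed
  define w where "w k = 1 / (\<rho> k * real (Suc k))" for k
  have w: "w k > 0" for k using \<rho>(1)[of k] by (simp add: w_def)
  \<comment> \<open>Half-open shells are pairwise disjoint; the k-th has width \<rho>_k / 2 and
    receives the mass 1/(2(k+1)) from its weight.\<close>
  define S where "S k = {\<rho> (Suc k)..<\<rho> k}" for k
  have S: "emeasure lborel (S k) = ennreal (\<rho> k / 2)" for k
    using \<rho>(1,2)[of k] by (simp add: S_def)
  have "2 * A * \<Omega> \<ge> 0" using A0 \<Omega> by simp
  then show ?thesis
  proof (rule small_ring_integralsI[OF assms(1) Q])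
    fix M :: real
    \<comment> \<open>The factor 2 compensates for the half in the integral of the weight.\<close>
    obtain N where N: "2 * M \<le> (\<Sum>k<N. 1 / real (Suc k))"
    proof (rule ccontr)
      assume "\<not> thesis"
      then have "(\<Sum>k<N. 1 / real (Suc k)) \<le> 2 * M" for N using that by (meson linear)
      then have "summable (\<lambda>k. 1 / real (Suc k))" by (intro summableI_nonneg_bounded) auto
      then have "summable (\<lambda>k. inverse (real (Suc k)))" by (simp add: inverse_eq_divide)
      then have "summable (\<lambda>k. inverse (real k))" by (subst (asm) summable_Suc_iff)
      then show False using not_summable_harmonic[where 'a=real] by simp
    qed
    define \<psi> where "\<psi> r = (\<Sum>k<N. ennreal (w k) * indicator (S k) r)" for r
    have \<psi>_meas: "\<psi> \<in> borel_measurable borel" unfolding \<psi>_def[abs_def] S_def by measurable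
    \<comment> \<open>One halving beyond the last shell, so that its closed left end \<rho>_N
      belongs to the open interval.\<close>
    define r1 where "r1 = \<rho> (Suc N)"
    have r1: "0 < r1" "r1 < \<rho>0" using \<rho>(1)[of N] \<rho>(1,2,3)[of N] by (auto simp: r1_def)
    have sub: "S k \<subseteq> {r1<..<\<rho>0}" if "k < N" for k
    proof -
      have "\<rho> N \<le> \<rho> (Suc k)" using that by (intro \<rho>_mono) auto
      moreover have "r1 < \<rho> N" using \<rho>(1,2)[of N] by (simp add: r1_def)
      ultimately show ?thesis using \<rho>(3)[of k] by (auto simp: S_def)
    qed
    have I: "(\<integral>\<^sup>+ r\<in>{r1<..<\<rho>0}. \<psi> r \<partial>lborel) = ennreal ((\<Sum>k<N. 1 / real (Suc k)) / 2)"
    proof -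
      have "(\<integral>\<^sup>+ r\<in>{r1<..<\<rho>0}. \<psi> r \<partial>lborel) = (\<integral>\<^sup>+r. (\<Sum>k<N. ennreal (w k) * indicator (S k) r) \<partial>lborel)"
      proof (rule nn_integral_cong)
        fix r
        have "indicator (S k) r * indicator {r1<..<\<rho>0} r = (indicator (S k) r :: ennreal)" if "k < N" for k
          using sub[OF that] by (auto simp: indicator_def)
        then show "\<psi> r * indicator {r1<..<\<rho>0} r = (\<Sum>k<N. ennreal (w k) * indicator (S k) r)"
          unfolding \<psi>_def sum_distrib_right by (intro sum.cong refl) (simp add: mult.assoc)
      qed
      also have "\<dots> = (\<Sum>k<N. ennreal (w k) * ennreal (\<rho> k / 2))"
        by (subst nn_integral_sum) (auto simp: nn_integral_cmult_indicator S, auto simp: S_def nn_integral_cmult_indicator S[unfolded S_def])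
      also have "\<dots> = (\<Sum>k<N. ennreal (1 / real (Suc k) / 2))"
      proof (intro sum.cong refl)
        fix k
        have *: "w k * (\<rho> k / 2) = 1 / real (Suc k) / 2" using \<rho>(1)[of k] by (simp add: w_def)
        show "ennreal (w k) * ennreal (\<rho> k / 2) = ennreal (1 / real (Suc k) / 2)"
          unfolding *[symmetric] by (rule ennreal_mult[symmetric]) (use w[of k] \<rho>(1)[of k] in auto)
      qed
      also have "\<dots> = ennreal (\<Sum>k<N. 1 / real (Suc k) / 2)" by (rule sum_ennreal) simp
      finally show ?thesis by (simp add: sum_divide_distrib)
    qed
    \<comment> \<open>At most one shell contains r, so the power of the sum is a single power;
      enlarging the shell to the full ball gives access to the means of Q over balls.\<close>
    have \<psi>_pow: "\<psi> r ^ n \<le> (\<Sum>k<N. ennreal (w k ^ n) * indicator {..<\<rho> k} r)" for r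
    proof (cases "\<exists>j<N. r \<in> S j")
      case True
      then obtain j where j: "j < N" "r \<in> S j" by blast
      have other: "r \<notin> S k" if "k \<noteq> j" for k
      proof (cases "k < j")
        case True
        then have "\<rho> j \<le> \<rho> (Suc k)" by (intro \<rho>_mono) auto
        then show ?thesis using j(2) by (auto simp: S_def)
      next
        case False
        with that have "\<rho> k \<le> \<rho> (Suc j)" by (intro \<rho>_mono) auto
        then show ?thesis using j(2) by (auto simp: S_def)
      qed
      have "\<psi> r = (\<Sum>k\<in>{j}. ennreal (w k) * indicator (S k) r)"
        unfolding \<psi>_def using j(1) other by (intro sum.mono_neutral_right) auto
      also have "\<dots> = ennreal (w j)" by (subst sum.insert) (use j(2) in auto)
      finally have "\<psi> r ^ n = ennreal (w j ^ n) * indicator {..<\<rho> j} r"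
        using j(2) w[of j] by (simp add: ennreal_power S_def)
      also have "\<dots> \<le> (\<Sum>k<N. ennreal (w k ^ n) * indicator {..<\<rho> k} r)"
        using j(1) by (intro member_le_sum) auto
      finally show ?thesis .
    next
      case False
      then have "\<psi> r = 0" unfolding \<psi>_def by (intro sum.neutral) auto
      then show ?thesis using n2 by (simp add: power_0_left)
    qed
    have "(\<integral>\<^sup>+ x\<in>ring r1 \<rho>0 x0. Q x * \<psi> (dist x x0) ^ n \<partial>lebesgue) \<le>
      (\<integral>\<^sup>+x. (\<Sum>k<N. ennreal (w k ^ n) * (Q x * indicator (ball x0 (\<rho> k)) x)) \<partial>lebesgue)"
    proof (rule nn_integral_mono)
      fix x
      have "Q x * \<psi> (dist x x0) ^ n * indicator (ring r1 \<rho>0 x0) x \<le> Q x * \<psi> (dist x x0) ^ n"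
        by (simp add: indicator_def)
      also have "\<dots> \<le> Q x * (\<Sum>k<N. ennreal (w k ^ n) * indicator {..<\<rho> k} (dist x x0))"
        using \<psi>_pow by (rule mult_left_mono) simp
      also have "\<dots> = (\<Sum>k<N. ennreal (w k ^ n) * (Q x * indicator (ball x0 (\<rho> k)) x))"
        unfolding sum_distrib_left by (intro sum.cong refl) (auto simp: indicator_def dist_commute mult.commute)
      finally show "Q x * \<psi> (dist x x0) ^ n * indicator (ring r1 \<rho>0 x0) x \<le> (\<Sum>k<N. ennreal (w k ^ n) * (Q x * indicator (ball x0 (\<rho> k)) x))" .
    qed
    also have "\<dots> = (\<Sum>k<N. ennreal (w k ^ n) * (\<integral>\<^sup>+x\<in>ball x0 (\<rho> k). Q x \<partial>lebesgue))"
    proof -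
      have "(\<lambda>x. Q x * indicator (ball x0 r) x) \<in> borel_measurable lebesgue" for r
        by (intro borel_measurable_times_ennreal borel_measurable_indicator Q ball_sets)
      note this [measurable]
      show ?thesis by (subst nn_integral_sum, measurable) (intro sum.cong refl nn_integral_cmult, measurable)
    qed
    also have "\<dots> \<le> (\<Sum>k<N. ennreal (A * \<Omega> * (1 / real (Suc k))))"
    proof (rule sum_mono)
      fix k
      have "ennreal (w k ^ n) * (\<integral>\<^sup>+x\<in>ball x0 (\<rho> k). Q x \<partial>lebesgue) \<le> ennreal (w k ^ n) * ennreal (A * real (Suc k) * (\<Omega> * \<rho> k ^ n))"
        using Qint by (rule mult_left_mono) simp
      also have "\<dots> = ennreal (w k ^ n * (A * real (Suc k) * (\<Omega> * \<rho> k ^ n)))"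
        using w[of k] A0 \<Omega> \<rho>(1)[of k] by (simp add: ennreal_mult[symmetric])
      also have "w k ^ n * (A * real (Suc k) * (\<Omega> * \<rho> k ^ n)) = A * \<Omega> * (real (Suc k) * (1 / real (Suc k)) ^ n)"
        using \<rho>(1)[of k] by (simp add: w_def power_divide power_mult_distrib)
      also have "ennreal \<dots> \<le> ennreal (A * \<Omega> * (1 / real (Suc k)))"
      proof (intro ennreal_leI mult_left_mono)
        have "(1 / real (Suc k)) ^ n \<le> (1 / real (Suc k)) ^ 2" using n2 by (intro power_decreasing) auto
        then have "real (Suc k) * (1 / real (Suc k)) ^ n \<le> real (Suc k) * (1 / real (Suc k)) ^ 2"
          by (rule mult_left_mono) simp
        also have "\<dots> = 1 / real (Suc k)" by (simp only: power2_eq_square) simp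
        finally show "real (Suc k) * (1 / real (Suc k)) ^ n \<le> 1 / real (Suc k)" .
      qed (use A0 \<Omega> in auto)
      finally show "ennreal (w k ^ n) * (\<integral>\<^sup>+x\<in>ball x0 (\<rho> k). Q x \<partial>lebesgue) \<le> ennreal (A * \<Omega> * (1 / real (Suc k)))" .
    qed
    also have "\<dots> = ennreal (\<Sum>k<N. A * \<Omega> * (1 / real (Suc k)))" using A0 \<Omega> by (intro sum_ennreal) auto
    also have "(\<Sum>k<N. A * \<Omega> * (1 / real (Suc k))) = (2 * A * \<Omega>) * ((\<Sum>k<N. 1 / real (Suc k)) / 2)"
      unfolding sum_distrib_left[symmetric] by simp
    also have "ennreal \<dots> = ennreal (2 * A * \<Omega>) * ennreal ((\<Sum>k<N. 1 / real (Suc k)) / 2)"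
      using A0 \<Omega> by (intro ennreal_mult) (auto intro!: sum_nonneg)
    finally have J: "(\<integral>\<^sup>+ x\<in>ring r1 \<rho>0 x0. Q x * \<psi> (dist x x0) ^ n \<partial>lebesgue) \<le>
       ennreal (2 * A * \<Omega>) * (\<integral>\<^sup>+ r\<in>{r1<..<\<rho>0}. \<psi> r \<partial>lborel)" unfolding I .
    have "ereal \<rho>0 < dist_bd x0 D" using R(2) \<rho>0(4) by (meson ereal_less_eq(3) less_imp_le order_le_less_trans)
    moreover have "ennreal M \<le> (\<integral>\<^sup>+ r\<in>{r1<..<\<rho>0}. \<psi> r \<partial>lborel)" unfolding I using N by (intro ennreal_leI) simp
    moreover have "(\<integral>\<^sup>+ r\<in>{r1<..<\<rho>0}. \<psi> r \<partial>lborel) < \<infinity>" unfolding I by simp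
    ultimately show "\<exists>r1 r2 \<psi>. 0 < r1 \<and> r1 < r2 \<and> ereal r2 < dist_bd x0 D \<and> \<psi> \<in> borel_measurable borel \<and>
      ennreal M \<le> (\<integral>\<^sup>+ r\<in>{r1<..<r2}. \<psi> r \<partial>lborel) \<and> (\<integral>\<^sup>+ r\<in>{r1<..<r2}. \<psi> r \<partial>lborel) < \<infinity> \<and>
      (\<integral>\<^sup>+ x\<in>ring r1 r2 x0. Q x * \<psi> (dist x x0) ^ DIM('a) \<partial>lebesgue) \<le> ennreal (2 * A * \<Omega>) * (\<integral>\<^sup>+ r\<in>{r1<..<r2}. \<psi> r \<partial>lborel)"
      using J r1 \<psi>_meas unfolding n_def by blast
  qed
qed

section \<open>Joining continua by short paths\<close>

text \<open>The selection is the continuous path composed with the first hitting time, which is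
  monotone in the radius and hence measurable. Levels up to q <= M see the true distance, and those
  below M exclude infinity.\<close>

lemma measurable_hitting_points:
  fixes g :: "real \<Rightarrow> 'a::euclidean_space option"
  assumes g: "continuous_on {a..b} (\<lambda>t. stereo (g t))" "a \<le> b"
    and pq: "trunc_dist M c (g a) \<le> p" "q \<le> trunc_dist M c (g b)" "q \<le> M"
  shows "\<exists>u. u \<in> borel_measurable borel \<and> (\<forall>r\<in>{p<..<q}. dist c (u r) = r \<and> (\<exists>t\<in>{a..b}. g t = Some (u r)))"
proof -
  obtain \<tau> where \<tau>: "\<And>r. r \<in> {p<..<q} \<Longrightarrow> \<tau> r \<in> {a..b} \<and> trunc_dist M c (g (\<tau> r)) = r" "mono_on {p<..<q} \<tau>"
    using hitting_time[OF continuous_on_trunc_dist[OF g(1)] g(2) pq(1,2)] by metis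
  \<comment> \<open>Clamping the parameter extends the path to a continuous, hence Borel, function
    on the line; hitting times lie in [a,b], where nothing changes.\<close>
  define G where "G t = stereo (g (max a (min t b)))" for t
  have "continuous_on UNIV G"
    unfolding G_def
    by (rule continuous_on_compose2[OF g(1)]) (use g(2) in \<open>auto intro!: continuous_intros\<close>)
  then have [measurable]: "G \<in> borel_measurable borel" by (rule borel_measurable_continuous_onI)
  have [measurable]: "(unstereo :: 'a \<times> real \<Rightarrow> 'a) \<in> borel_measurable borel"
    unfolding unstereo_def[abs_def] borel_prod[symmetric] by measurable
  have "\<tau> \<in> borel_measurable (restrict_space borel {p<..<q})"
    using \<tau>(2) by (rule borel_measurable_mono_on_fnc)
  then have "(\<lambda>r. unstereo (G (\<tau> r))) \<in> borel_measurable (restrict_space borel {p<..<q})" by measurable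
  \<comment> \<open>Outside the interval of radii the hitting time is unspecified; the value c there
    only serves measurability.\<close>
  then have "(\<lambda>r. if r \<in> {p<..<q} then unstereo (G (\<tau> r)) else c) \<in> borel_measurable borel"
    by (subst measurable_If_restrict_space_iff) (auto simp del: greaterThanLessThan_iff)
  moreover have "dist c (unstereo (G (\<tau> r))) = r \<and> (\<exists>t\<in>{a..b}. g t = Some (unstereo (G (\<tau> r))))"
    if r: "r \<in> {p<..<q}" for r
  proof -
    have t: "\<tau> r \<in> {a..b}" "trunc_dist M c (g (\<tau> r)) = r" using \<tau>(1)[OF r] by auto
    obtain y where y: "g (\<tau> r) = Some y" using t(2) r pq(3) by (cases "g (\<tau> r)") (auto simp: trunc_dist_def)
    have "max a (min (\<tau> r) b) = \<tau> r" using t(1) by auto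
    then have "unstereo (G (\<tau> r)) = y" by (simp only: G_def y unstereo_stereo)
    moreover have "dist c y = r" using t(2) r pq(3) by (auto simp: y trunc_dist_def min_def split: if_splits)
    ultimately show ?thesis using t(1) y by auto
  qed
  ultimately show ?thesis
    by (intro exI[of _ "\<lambda>r. if r \<in> {p<..<q} then unstereo (G (\<tau> r)) else c"]) simp
qed

text \<open>Two points at chordal distance \<sigma> cannot both be within \<sigma>/2 of infinity. An
  endpoint that is not becomes the centre c, whence |c| <= 2/\<sigma>; the other endpoint is
  infinite or at Euclidean distance at least \<sigma>, so all radii in (0,\<sigma>) are met.\<close>

lemma continuum_hitting_points:
  fixes g :: "real \<Rightarrow> 'a::euclidean_space option"
  assumes g: "continuous_on {0..1} (\<lambda>t. stereo (g t))" and \<sigma>: "\<sigma> > 0" "chordal (g 0) (g 1) \<ge> \<sigma>"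
  shows "\<exists>u c. norm c \<le> 2 / \<sigma> \<and> u \<in> borel_measurable borel \<and>
    (\<forall>r\<in>{0<..<\<sigma>}. dist c (u r) = r \<and> (\<exists>t\<in>{0..1}. g t = Some (u r)))"
proof -
  have main: "\<exists>u c. norm c \<le> 2 / \<sigma> \<and> u \<in> borel_measurable borel \<and>
    (\<forall>r\<in>{0<..<\<sigma>}. dist c (u r) = r \<and> (\<exists>t\<in>{0..1}. h t = Some (u r)))"
    if h: "continuous_on {0..1} (\<lambda>t. stereo (h t))" "chordal (h 0) (h 1) \<ge> \<sigma>" "chordal (h 0) None \<ge> \<sigma> / 2"
    for h :: "real \<Rightarrow> 'a option"
  proof -
    obtain c where c: "h 0 = Some c" using h(3) \<sigma>(1) by (cases "h 0") (auto simp: chordal_simps)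
    have "norm c \<le> sqrt (1 + (norm c)\<^sup>2)" by (rule real_le_rsqrt) simp
    moreover have "sqrt (1 + (norm c)\<^sup>2) \<le> 2 / \<sigma>"
      using h(3) \<sigma>(1) one_plus_norm_sq_pos[of c] by (simp add: c chordal_simps field_simps)
    ultimately have nc: "norm c \<le> 2 / \<sigma>" by linarith
    have "trunc_dist \<sigma> c (h 0) \<le> 0" using \<sigma>(1) by (simp add: c trunc_dist_def)
    moreover have "\<sigma> \<le> trunc_dist \<sigma> c (h 1)"
    proof (cases "h 1")
      case (Some y)
      have "\<sigma> \<le> dist c y" using h(2) chordal_le_dist[of c y] by (simp add: c Some)
      then show ?thesis by (simp add: Some trunc_dist_def)
    qed (simp add: trunc_dist_def)
    ultimately show ?thesis
      using measurable_hitting_points[OF h(1), of \<sigma> c 0 \<sigma>] nc by auto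
  qed
  show ?thesis
  proof (cases "chordal (g 0) None \<ge> \<sigma> / 2")
    case True
    then show ?thesis using main[OF g \<sigma>(2)] by blast
  next
    case False
    \<comment> \<open>The initial point is close to infinity, so the final one is not, and the
      reversed path is used.\<close>
    have 1: "chordal (g (1 - 0)) None \<ge> \<sigma> / 2"
      using False \<sigma>(2) chordal_triangle[of "g 0" "g 1" None] chordal_commute[of None "g 1"] by simp
    have 2: "continuous_on {0..1} (\<lambda>t. stereo (g (1 - t)))"
      by (rule continuous_on_compose2[OF g]) (auto intro!: continuous_intros)
    have 3: "chordal (g (1 - 0)) (g (1 - 1)) \<ge> \<sigma>" using \<sigma>(2) chordal_commute[of "g 0" "g 1"] by simp
    obtain u c where u: "norm c \<le> 2 / \<sigma>" "u \<in> borel_measurable borel"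
      "\<forall>r\<in>{0<..<\<sigma>}. dist c (u r) = r \<and> (\<exists>t\<in>{0..1}. g (1 - t) = Some (u r))"
      using main[OF 2 3 1] by blast
    have "\<exists>t\<in>{0..1}. g t = Some (u r)" if r: "r \<in> {0<..<\<sigma>}" for r
    proof -
      obtain t where "t \<in> {0..1}" "g (1 - t) = Some (u r)" using u(3) r by blast
      then show ?thesis by (intro bexI[of _ "1 - t"]) auto
    qed
    then show ?thesis using u by blast
  qed
qed

lemma chordal_ge_of_frontier:
  assumes "y \<in> ch_frontier (ch_ball x t)" shows "chordal x y \<ge> t"
proof (rule ccontr)
  assume "\<not> chordal x y \<ge> t"
  then have "y \<in> ch_ball x t" by (simp add: ch_ball_def)
  then have "y \<in> ch_interior (ch_ball x t)"
    using ch_open_ch_ball[of x t] unfolding ch_open_def ch_interior_def by blast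
  then show False using assms by (simp add: ch_frontier_def)
qed

lemma chordal_le_of_closure:
  assumes "y \<in> ch_closure (ch_ball x t)" shows "chordal x y \<le> t"
proof (rule field_le_epsilon)
  fix e :: real assume "e > 0"
  then obtain z where "chordal x z < t" "chordal y z < e"
    using assms unfolding ch_closure_def ch_ball_def by blast
  then show "chordal x y \<le> t + e"
    using chordal_triangle[of x y z] chordal_commute[of z y] by linarith
qed

lemma chordal_origin_sq:
  "(chordal (Some (0::'a::euclidean_space)) (Some y))\<^sup>2 = (norm y)\<^sup>2 / (1 + (norm y)\<^sup>2)"
  "(chordal (None :: 'a option) (Some y))\<^sup>2 = 1 / (1 + (norm y)\<^sup>2)"
  using one_plus_norm_sq_pos[of y] by (simp_all add: chordal_simps power_divide)

text \<open>In Euclidean terms chordal distance at least sqrt 3 / 2 from 0 means |y| >= sqrt 3, and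
  at most sqrt 2 / 2 means |y| <= 1; from infinity the conditions are |y| <= 1/sqrt 3 and |y| >= 1.
  With the rational bounds 17/10 < sqrt 3 and 3/5 > 1/sqrt 3 the radii fill (1, 17/10) or (3/5, 1),
  of length at least 2/5.\<close>

lemma shell_crossing_hitting_points:
  fixes g :: "real \<Rightarrow> 'a::euclidean_space option"
  assumes x: "x = Some 0 \<or> x = None"
    and p: "(a, b, g) \<in> Gam (ch_frontier (ch_ball x (sqrt 3 / 2))) (E \<inter> ch_closure (ch_ball x (sqrt 2 / 2))) UNIV"
  shows "\<exists>v p q. q - p \<ge> 2/5 \<and> q \<le> 2 \<and> v \<in> borel_measurable borel \<and>
    (\<forall>r\<in>{p<..<q}. dist 0 (v r) = r \<and> (\<exists>t\<in>{a..b}. g t = Some (v r)))"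
proof -
  have ab: "a < b" and g: "continuous_on {a..b} (\<lambda>t. stereo (g t))"
    and ends: "g a \<in> ch_frontier (ch_ball x (sqrt 3 / 2))" "g b \<in> ch_closure (ch_ball x (sqrt 2 / 2))"
    using p unfolding Gam_def ch_path_iff by auto
  have ga: "chordal x (g a) \<ge> sqrt 3 / 2" using ends(1) by (rule chordal_ge_of_frontier)
  have gb: "chordal x (g b) \<le> sqrt 2 / 2" using ends(2) by (rule chordal_le_of_closure)
  have ga': "(chordal x (g a))\<^sup>2 \<ge> 3 / 4"
    using power_mono[OF ga, of 2] by (simp add: power_divide)
  have gb': "(chordal x (g b))\<^sup>2 \<le> 1 / 2"
    using power_mono[OF gb, of 2] by (simp add: power_divide chordal_eq_dist)
  have ge1: "norm y \<ge> d" if "d\<^sup>2 \<le> (norm y)\<^sup>2" for y :: 'a and d :: real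
    using that by (rule power2_le_imp_le) simp
  from x show ?thesis
  proof
    assume x: "x = Some 0"
    \<comment> \<open>About 0 the given path runs inwards; reversal makes the distance rise from the
      first end to the last, as hitting times require.\<close>
    let ?g = "\<lambda>t. g (a + b - t)"
    have "continuous_on {a..b} (\<lambda>t. stereo (?g t))"
      by (rule continuous_on_compose2[OF g]) (auto intro!: continuous_intros)
    moreover have "trunc_dist 2 0 (?g a) \<le> 1"
    proof (cases "g b")
      case None
      then show ?thesis using gb' by (simp add: x chordal_simps)
    next
      case (Some y)
      then have "(norm y)\<^sup>2 \<le> 1\<^sup>2"
        using gb' one_plus_norm_sq_pos[of y] by (simp add: x chordal_origin_sq field_simps)
      then have "norm y \<le> 1" by (rule power2_le_imp_le) simp
      then show ?thesis by (simp add: Some trunc_dist_def)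
    qed
    moreover have "17/10 \<le> trunc_dist 2 0 (?g b)"
    proof (cases "g a")
      case (Some y)
      then have "(norm y)\<^sup>2 \<ge> 3"
        using ga' one_plus_norm_sq_pos[of y] by (simp add: x chordal_origin_sq field_simps)
      then have "(17/10)\<^sup>2 \<le> (norm y)\<^sup>2" by (simp add: power2_eq_square)
      then have "norm y \<ge> 17/10" by (rule ge1)
      then show ?thesis by (simp add: Some trunc_dist_def)
    qed (simp add: trunc_dist_def)
    ultimately obtain v where v: "v \<in> borel_measurable borel"
      "\<forall>r\<in>{1<..<17/10}. dist 0 (v r) = r \<and> (\<exists>t\<in>{a..b}. ?g t = Some (v r))"
      using measurable_hitting_points[of a b ?g 2 0 1 "17/10"] ab by auto
    have "\<exists>t\<in>{a..b}. g t = Some (v r)" if r: "r \<in> {1<..<17/10}" for r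
    proof -
      obtain t where "t \<in> {a..b}" "?g t = Some (v r)" using v(2) r by blast
      then show ?thesis by (intro bexI[of _ "a + b - t"]) auto
    qed
    with v show ?thesis by (intro exI[of _ v] exI[of _ 1] exI[of _ "17/10"]) auto
  next
    assume x: "x = None"
    have "trunc_dist 2 0 (g a) \<le> 3/5"
    proof (cases "g a")
      case None
      then show ?thesis using ga' by (simp add: x chordal_simps)
    next
      case (Some y)
      then have "(norm y)\<^sup>2 \<le> 1/3"
        using ga' one_plus_norm_sq_pos[of y] by (simp add: x chordal_origin_sq field_simps)
      then have "(norm y)\<^sup>2 \<le> (3/5)\<^sup>2" by (simp add: power2_eq_square)
      then have "norm y \<le> 3/5" by (rule power2_le_imp_le) simp
      then show ?thesis by (simp add: Some trunc_dist_def)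
    qed
    moreover have "1 \<le> trunc_dist 2 0 (g b)"
    proof (cases "g b")
      case (Some y)
      then have "1\<^sup>2 \<le> (norm y)\<^sup>2"
        using gb' one_plus_norm_sq_pos[of y] by (simp add: x chordal_origin_sq field_simps)
      then have "norm y \<ge> 1" by (rule ge1)
      then show ?thesis by (simp add: Some trunc_dist_def)
    qed (simp add: trunc_dist_def)
    ultimately obtain v where v: "v \<in> borel_measurable borel"
      "\<forall>r\<in>{3/5<..<1}. dist 0 (v r) = r \<and> (\<exists>t\<in>{a..b}. g t = Some (v r))"
      using measurable_hitting_points[of a b g 2 0 "3/5" 1] g ab by auto
    then show ?thesis by (intro exI[of _ v] exI[of _ "3/5"] exI[of _ 1]) auto
  qed
qed

text \<open>A segment from x0 to a point outside D meets the frontier no later than its end. An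
  empty frontier is covered too, as no segment can then leave D.\<close>

lemma cball_subset_of_dist_bd:
  assumes "x0 \<in> D" "ereal r < dist_bd x0 D"
  shows "cball x0 r \<subseteq> D"
proof
  fix y assume y: "y \<in> cball x0 r"
  show "y \<in> D"
  proof (rule ccontr)
    assume "y \<notin> D"
    then have "closed_segment x0 y \<inter> frontier D \<noteq> {}"
      using assms(1) by (intro connected_Int_frontier) auto
    then obtain w where w: "w \<in> closed_segment x0 y" "w \<in> frontier D" by blast
    then have "infdist x0 (frontier D) \<le> dist x0 w" by (intro infdist_le)
    also have "\<dots> \<le> dist x0 y" using w(1) by (metis dist_in_closed_segment dist_commute)
    also have "\<dots> \<le> r" using y by simp
    finally show False using assms(2) w(2) by (auto simp: dist_bd_def split: if_splits)
  qed
qed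

lemma dist_bd_pos:
  assumes "open D" "x0 \<in> D"
  obtains R where "R > 0" "ereal R < dist_bd x0 D"
proof (cases "frontier D = {}")
  case True
  then show ?thesis by (intro that[of 1]) (auto simp: dist_bd_def)
next
  case False
  have "x0 \<notin> frontier D" using assms by (simp add: frontier_def interior_open)
  then have "infdist x0 (frontier D) \<noteq> 0"
    using False in_closed_iff_infdist_zero[of "frontier D" x0] by simp
  then have "infdist x0 (frontier D) > 0" using infdist_nonneg[of x0 "frontier D"] by simp
  with False show ?thesis by (intro that[of "infdist x0 (frontier D) / 2"]) (auto simp: dist_bd_def)
qed

text \<open>The path h runs from U to V along two segments through z, and from V on along g.\<close>

lemma joining_path:
  fixes g :: "real \<Rightarrow> 'a::euclidean_space option"
  assumes g: "ch_path a b g" "loc_rectifiable (a, b, g)" and \<tau>: "\<tau> \<in> {a..b}" "g \<tau> = Some V"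
    and \<rho>: "\<rho> \<in> borel_measurable borel"
  obtains h where "ch_path (\<tau> - 2) b h" "loc_rectifiable (\<tau> - 2, b, h)" "h (\<tau> - 2) = Some U" "h b = g b"
    "ext_line_int (\<tau> - 2, b, h) \<rho> \<le>
       ennreal (norm (z - U)) * (\<integral>\<^sup>+t\<in>{0..1}. \<rho> (U + t *\<^sub>R (z - U)) \<partial>lborel) +
       (ennreal (norm (z - V)) * (\<integral>\<^sup>+t\<in>{0..1}. \<rho> (V + t *\<^sub>R (z - V)) \<partial>lborel) + ext_line_int (a, b, g) \<rho>)"
proof -
  note [measurable] = \<rho>
  \<comment> \<open>The two segments occupy one unit of time each before \<tau>, so that from \<tau>
    on g keeps its own parameter.\<close>
  define h where "h t = (if t \<le> \<tau> - 1 then Some (U + (t - (\<tau> - 2)) *\<^sub>R (z - U))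
     else if t \<le> \<tau> then Some (z + (t - (\<tau> - 1)) *\<^sub>R (V - z)) else g t)" for t
  have h1: "h t = Some (U + (t - (\<tau> - 2)) *\<^sub>R (z - U))" if "t \<in> {\<tau> - 2..\<tau> - 2 + 1}" for t
    using that by (simp add: h_def)
  have h2: "h t = Some (z + (t - (\<tau> - 1)) *\<^sub>R (V - z))" if "t \<in> {\<tau> - 1..\<tau> - 1 + 1}" for t
  proof (cases "t = \<tau> - 1")
    case True
    have "h t = Some (U + 1 *\<^sub>R (z - U))" by (simp add: h_def True)
    then show ?thesis by (simp add: True)
  qed (use that in \<open>auto simp: h_def\<close>)
  have h3: "h t = g t" if "t \<in> {\<tau>..b}" for t
  proof (cases "t = \<tau>")
    case True
    then show ?thesis using \<tau>(2) by (simp add: h_def)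
  qed (use that in \<open>auto simp: h_def\<close>)
  have seg: "continuous_on S (\<lambda>t. stereo (Some (p + (t - s) *\<^sub>R w)))" for S s and p w :: 'a
    by (rule continuous_on_compose2[OF continuous_on_stereo_Some[of UNIV]]) (auto intro!: continuous_intros)
  have cont: "continuous_on {\<tau> - 2..b} (\<lambda>t. stereo (h t))"
  proof -
    have c1: "continuous_on {\<tau> - 2..\<tau> - 1} (\<lambda>t. stereo (h t))"
      using seg[of _ U "\<tau> - 2" "z - U"] h1 by (subst continuous_on_cong[OF refl, of _ _ "\<lambda>t. stereo (Some (U + (t - (\<tau> - 2)) *\<^sub>R (z - U)))"]) auto
    have c2: "continuous_on {\<tau> - 1..\<tau>} (\<lambda>t. stereo (h t))"
      using seg[of _ z "\<tau> - 1" "V - z"] h2 by (subst continuous_on_cong[OF refl, of _ _ "\<lambda>t. stereo (Some (z + (t - (\<tau> - 1)) *\<^sub>R (V - z)))"]) auto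
    have "continuous_on {\<tau>..b} (\<lambda>t. stereo (g t))"
      using g(1) \<tau>(1) unfolding ch_path_iff by (auto intro: continuous_on_subset)
    then have c3: "continuous_on {\<tau>..b} (\<lambda>t. stereo (h t))"
      by (subst continuous_on_cong[OF refl, of _ _ "\<lambda>t. stereo (g t)"]) (auto simp: h3)
    have "{\<tau> - 2..b} = {\<tau> - 2..\<tau> - 1} \<union> ({\<tau> - 1..\<tau>} \<union> {\<tau>..b})" using \<tau>(1) by auto
    then show ?thesis using c1 c2 c3 by (metis closed_Un closed_atLeastAtMost continuous_on_closed_Un)
  qed
  have p1: "ch_path (\<tau> - 2) b h" using cont \<tau>(1) unfolding ch_path_iff by simp
  have p2: "ch_path (\<tau> - 1) b h" using cont \<tau>(1) unfolding ch_path_iff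
    by (auto intro: continuous_on_subset)
  have e1: "loc_rectifiable (\<tau> - 2, \<tau> - 1, h)"
    "ext_line_int (\<tau> - 2, \<tau> - 1, h) \<rho> \<le> ennreal (norm (z - U)) * (\<integral>\<^sup>+t\<in>{0..1}. \<rho> (U + t *\<^sub>R (z - U)) \<partial>lborel)"
    using segment_path[of "\<tau> - 2" h U "z - U", OF h1 \<rho>] by (simp_all add: algebra_simps)
  have e2: "loc_rectifiable (\<tau> - 1, \<tau>, h)"
    "ext_line_int (\<tau> - 1, \<tau>, h) \<rho> \<le> ennreal (norm (V - z)) * (\<integral>\<^sup>+t\<in>{0..1}. \<rho> (z + t *\<^sub>R (V - z)) \<partial>lborel)"
    using segment_path[of "\<tau> - 1" h z "V - z", OF h2 \<rho>] by (simp_all add: algebra_simps)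
  \<comment> \<open>The second segment is run from z to V, whereas the averages are based at V; t ->
    1 - t exchanges the two.\<close>
  have rev: "(\<integral>\<^sup>+t\<in>{0..1}. \<rho> (z + t *\<^sub>R (V - z)) \<partial>lborel) = (\<integral>\<^sup>+t\<in>{0..1}. \<rho> (V + t *\<^sub>R (z - V)) \<partial>lborel)"
    by (subst nn_integral_real_affine[where c = "-1" and t = 1])
      (auto intro!: nn_integral_cong simp: indicator_def algebra_simps)
  have e3: "loc_rectifiable (\<tau>, b, h)" "ext_line_int (\<tau>, b, h) \<rho> \<le> ext_line_int (a, b, g) \<rho>"
  proof -
    show "loc_rectifiable (\<tau>, b, h)"
      using loc_rectifiable_subpath[OF g(2), of \<tau> b] \<tau>(1) loc_rectifiable_cong[of \<tau> b h g] h3 by auto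
    show "ext_line_int (\<tau>, b, h) \<rho> \<le> ext_line_int (a, b, g) \<rho>"
      using ext_line_int_subpath[of a \<tau> b b g \<rho>] \<tau>(1) ext_line_int_cong[of \<tau> b h g \<rho>] h3 by auto
  qed
  have r2: "loc_rectifiable (\<tau> - 1, b, h)" using e2(1) e3(1) by (rule loc_rectifiable_concat)
  have r1: "loc_rectifiable (\<tau> - 2, b, h)" using e1(1) r2 by (rule loc_rectifiable_concat)
  have "ext_line_int (\<tau> - 2, b, h) \<rho> \<le> ext_line_int (\<tau> - 2, \<tau> - 1, h) \<rho> + ext_line_int (\<tau> - 1, b, h) \<rho>"
    using p1 r1 \<rho> by (rule ext_line_int_concat)
  also have "\<dots> \<le> ext_line_int (\<tau> - 2, \<tau> - 1, h) \<rho> + (ext_line_int (\<tau> - 1, \<tau>, h) \<rho> + ext_line_int (\<tau>, b, h) \<rho>)"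
    by (intro add_left_mono ext_line_int_concat p2 r2 \<rho>)
  also have "\<dots> \<le> ennreal (norm (z - U)) * (\<integral>\<^sup>+t\<in>{0..1}. \<rho> (U + t *\<^sub>R (z - U)) \<partial>lborel) +
       (ennreal (norm (z - V)) * (\<integral>\<^sup>+t\<in>{0..1}. \<rho> (V + t *\<^sub>R (z - V)) \<partial>lborel) + ext_line_int (a, b, g) \<rho>)"
    using e1(2) e2(2) e3(2) unfolding rev norm_minus_commute[of V z] by (intro add_mono)
  finally have len: "ext_line_int (\<tau> - 2, b, h) \<rho> \<le>
       ennreal (norm (z - U)) * (\<integral>\<^sup>+t\<in>{0..1}. \<rho> (U + t *\<^sub>R (z - U)) \<partial>lborel) +
       (ennreal (norm (z - V)) * (\<integral>\<^sup>+t\<in>{0..1}. \<rho> (V + t *\<^sub>R (z - V)) \<partial>lborel) + ext_line_int (a, b, g) \<rho>)" .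
  show ?thesis
    using h3[of b] \<tau>(1) h1[of "\<tau> - 2"] by (intro that[OF p1 r1 _ _ len]) auto
qed

text \<open>If the sum were at least k for every z, its integral over the unit ball would be at
  least k times the volume, more than the two averages allow.\<close>

lemma connecting_point:
  fixes u v :: "'a::euclidean_space" and \<rho> :: "'a \<Rightarrow> ennreal"
  defines "\<phi> \<equiv> \<lambda>u z. \<integral>\<^sup>+t\<in>{0..1}. \<rho> (u + t *\<^sub>R (z - u)) \<partial>lborel"
  assumes \<rho>: "\<rho> \<in> borel_measurable borel" and k: "k > 0"
    and u: "(\<integral>\<^sup>+z\<in>ball 0 1. \<phi> u z \<partial>lborel) < ennreal (measure lborel (ball (0::'a) 1) * k / 2)"
    and v: "(\<integral>\<^sup>+z\<in>ball 0 1. \<phi> v z \<partial>lborel) < ennreal (measure lborel (ball (0::'a) 1) * k / 2)"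
  shows "\<exists>z\<in>ball 0 1. \<phi> u z + \<phi> v z < ennreal k"
proof (rule ccontr)
  assume "\<not> ?thesis"
  then have ge: "ennreal k \<le> \<phi> u z + \<phi> v z" if "z \<in> ball 0 1" for z using that by (auto simp: not_less)
  note [measurable] = \<rho>
  have [measurable]: "ball (0::'a) 1 \<in> sets borel" by simp
  have [measurable]: "\<phi> w \<in> borel_measurable borel" for w unfolding \<phi>_def by measurable
  let ?b = "measure lborel (ball (0::'a) 1)"
  have eb: "emeasure lborel (ball (0::'a) 1) = ennreal ?b"
    using emeasure_lborel_ball_finite[of "0::'a" 1] by (intro emeasure_eq_ennreal_measure) auto
  have "ennreal (?b * k) = (\<integral>\<^sup>+z. ennreal k * indicator (ball (0::'a) 1) z \<partial>lborel)"
    using k by (subst nn_integral_cmult_indicator) (auto simp: eb ennreal_mult[symmetric] mult.commute)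
  also have "\<dots> \<le> (\<integral>\<^sup>+z. \<phi> u z * indicator (ball 0 1) z + \<phi> v z * indicator (ball 0 1) z \<partial>lborel)"
    using ge by (intro nn_integral_mono) (auto simp: indicator_def)
  also have "\<dots> = (\<integral>\<^sup>+z\<in>ball 0 1. \<phi> u z \<partial>lborel) + (\<integral>\<^sup>+z\<in>ball 0 1. \<phi> v z \<partial>lborel)"
    by (rule nn_integral_add) measurable
  also have "\<dots> < ennreal (?b * k / 2) + ennreal (?b * k / 2)"
    using u v by (rule add_strict_mono)
  also have "\<dots> = ennreal (?b * k)" using k by (simp flip: ennreal_plus)
  finally show False by simp
qed

section \<open>The estimate for the whole family\<close>

lemma chordal_bound:
  fixes Q :: "'a::euclidean_space \<Rightarrow> ennreal"
  assumes D: "open D" "x0 \<in> D" and \<delta>: "\<delta> > 0" and \<sigma>: "\<sigma> > 0"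
    and Q: "small_ring_integrals D Q x0"
  shows "\<exists>\<Delta>>0. \<forall>f\<in>fam D Q x0 \<delta>. \<forall>x\<in>D. dist x x0 < \<Delta> \<longrightarrow> chordal (f x) (f x0) < \<sigma>"
proof -
  define b where "b = measure lborel (ball (0::'a) 1)"
  have b: "b > 0" unfolding b_def by (rule content_ball_pos) simp
  \<comment> \<open>A bound for |z - w| with |z| < 1, where w is a point of the image continuum, of
    norm at most 2/\<sigma> + \<sigma>, or a selected point of g, of norm at most 2.\<close>
  define K where "K = 3 + 2 / \<sigma> + \<sigma>"
  have K: "K > 3" using \<sigma> by (simp add: K_def add_pos_pos)
  \<comment> \<open>The length budget: two segments through z cost at most K k = 1/4, the path into
    E less than 1/2, in total at most 3/4 < 1.\<close>
  define k where "k = 1 / (4 * K)"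
  have k: "k > 0" using K by (simp add: k_def)
  \<comment> \<open>A single threshold serves both curves: the radii fill an interval of length
    \<sigma> for the image of the segment and of length at least 2/5 for g.\<close>
  obtain \<mu>1 where \<mu>1: "\<mu>1 > 0" and short: "\<And>\<rho> (u :: real \<Rightarrow> 'a) c p q. \<rho> \<in> borel_measurable borel \<Longrightarrow> u \<in> borel_measurable borel \<Longrightarrow>
    min \<sigma> (2/5) \<le> q - p \<Longrightarrow> \<forall>r\<in>{p<..<q}. dist c (u r) = r \<Longrightarrow>
    \<forall>r\<in>{p<..<q}. \<forall>z\<in>ball 0 1. norm (z - u r) \<le> K \<Longrightarrow>
    (\<integral>\<^sup>+y. \<rho> y ^ DIM('a) \<partial>lborel) \<le> ennreal \<mu>1 \<Longrightarrow>
    \<exists>r\<in>{p<..<q}. (\<integral>\<^sup>+z\<in>ball 0 1. (\<integral>\<^sup>+t\<in>{0..1}. \<rho> (u r + t *\<^sub>R (z - u r)) \<partial>lborel) \<partial>lborel) < ennreal (b * k / 2)"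
    using short_segments[of K "min \<sigma> (2/5)" "b * k / 2", where 'a = 'a] K \<sigma> b k by auto
  \<comment> \<open>The first bound makes segments short on average, the second prevents
    \<open>2 * \<rho>\<close> from being admissible for the paths into E.\<close>
  define \<mu> where "\<mu> = min \<mu>1 (\<delta> / 2 ^ DIM('a))"
  have \<mu>: "\<mu> > 0" using \<mu>1 \<delta> by (simp add: \<mu>_def)
  obtain r1 r2 \<eta> where r: "0 < r1" "r1 < r2" "ereal r2 < dist_bd x0 D" and \<eta>: "\<eta> \<in> borel_measurable borel"
    "(\<integral>\<^sup>+ r\<in>{r1<..<r2}. \<eta> r \<partial>lborel) \<ge> 1"
    "(\<integral>\<^sup>+ x\<in>ring r1 r2 x0. Q x * \<eta> (dist x x0) ^ DIM('a) \<partial>lebesgue) < ennreal \<mu>"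
    using Q \<mu> unfolding small_ring_integrals_def by blast
  \<comment> \<open>A little room beyond r2, still inside D, for the compact ball in which lifts are
    constructed.\<close>
  obtain r3 where r3: "r2 < r3" "ereal r3 < dist_bd x0 D"
    using ereal_dense2[OF r(3)] by auto
  have cball: "cball x0 r3 \<subseteq> D" using D(2) r3(2) by (rule cball_subset_of_dist_bd)
  \<comment> \<open>The inner radius r1 was found before any f was chosen, so it is a uniform
    \<Delta>.\<close>
  show ?thesis
  proof (intro exI[of _ r1] conjI r(1) ballI impI)
    fix f x assume f: "f \<in> fam D Q x0 \<delta>" and x: "x \<in> D" "dist x x0 < r1"
    obtain E where f': "ch_continuous_on D f" "open_map D f" "discrete_map D f" "ring_Q_map D Q x0 f"
      and E: "c_set E \<ge> ennreal \<delta>" "f ` D \<inter> E = {}"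
      using f unfolding fam_def by blast
    show "chordal (f x) (f x0) < \<sigma>"
    proof (rule ccontr)
      assume "\<not> ?thesis"
      then have far: "chordal (f x0) (f x) \<ge> \<sigma>" using chordal_commute[of "f x0" "f x"] by linarith
      let ?\<Gamma> = "path_image_fam f (Gam (Some ` sphere x0 r1) (Some ` sphere x0 r2) (Some ` ring r1 r2 x0))"
      have "modulus ?\<Gamma> \<le> (\<integral>\<^sup>+ x\<in>ring r1 r2 x0. Q x * \<eta> (dist x x0) ^ DIM('a) \<partial>lebesgue)"
        using f'(4) r \<eta>(1,2) unfolding ring_Q_map_def by blast
      then have "modulus ?\<Gamma> < ennreal \<mu>" using \<eta>(3) by (rule le_less_trans)
      then obtain \<rho> where \<rho>: "admissible ?\<Gamma> \<rho>" "(\<integral>\<^sup>+ x. \<rho> x ^ DIM('a) \<partial>lborel) < ennreal \<mu>"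
        unfolding modulus_def INF_less_iff by blast
      have \<rho>b [measurable]: "\<rho> \<in> borel_measurable borel" using \<rho>(1) by (simp add: admissible_def)
      have \<rho>1: "(\<integral>\<^sup>+ x. \<rho> x ^ DIM('a) \<partial>lborel) \<le> ennreal \<mu>1"
        using \<rho>(2) by (rule order.trans[OF less_imp_le]) (simp add: \<mu>_def ennreal_leI)
      \<comment> \<open>The infimum is evaluated at 0, and \<open>tilde\<close> of 0 is infinity; so
        one of two fixed shells carries a path family of modulus at least \<delta>.\<close>
      have "c_set E \<le> max (m_set E (Some 0)) (m_set E (tilde (Some 0)))"
        unfolding c_set_def by (rule INF_lower) simp
      then have "ennreal \<delta> \<le> max (m_set E (Some 0)) (m_set E None)"
        using E(1) by (simp add: tilde_def)
      then obtain y where y: "y = Some 0 \<or> y = None" "ennreal \<delta> \<le> m_set E y"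
        by (auto simp: le_max_iff_disj)
      let ?\<Gamma>2 = "Gam (ch_frontier (ch_ball y (sqrt 3 / 2))) (E \<inter> ch_closure (ch_ball y (sqrt 2 / 2))) UNIV"
      \<comment> \<open>Doubling costs 2^n in the integral, which \<mu> allows for, and leaves a
        path whose length for \<open>\<rho>\<close> itself is below 1/2.\<close>
      have "\<not> admissible ?\<Gamma>2 (\<lambda>x. 2 * \<rho> x)"
      proof
        have two: "(2::ennreal) ^ DIM('a) = ennreal (2 ^ DIM('a))" by (simp add: ennreal_power[symmetric])
        assume "admissible ?\<Gamma>2 (\<lambda>x. 2 * \<rho> x)"
        then have "m_set E y \<le> (\<integral>\<^sup>+ x. (2 * \<rho> x) ^ DIM('a) \<partial>lborel)"
          unfolding m_set_def modulus_def by (intro INF_lower) simp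
        also have "\<dots> = 2 ^ DIM('a) * (\<integral>\<^sup>+ x. \<rho> x ^ DIM('a) \<partial>lborel)"
          unfolding power_mult_distrib by (rule nn_integral_cmult) measurable
        also have "\<dots> < 2 ^ DIM('a) * ennreal (\<delta> / 2 ^ DIM('a))"
        proof (rule ennreal_mult_strict_left_mono)
          show "(\<integral>\<^sup>+ x. \<rho> x ^ DIM('a) \<partial>lborel) < ennreal (\<delta> / 2 ^ DIM('a))"
            using \<rho>(2) by (rule order.strict_trans2) (simp add: \<mu>_def ennreal_leI)
        qed (simp_all add: two)
        also have "\<dots> = ennreal \<delta>"
          using \<delta> by (simp add: two ennreal_mult[symmetric])
        finally show False using y(2) by simp
      qed
      moreover have "(\<lambda>x. 2 * \<rho> x) \<in> borel_measurable borel" by measurable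
      ultimately obtain s t g where g: "(s, t, g) \<in> ?\<Gamma>2" "loc_rectifiable (s, t, g)"
        "ext_line_int (s, t, g) (\<lambda>x. 2 * \<rho> x) < 1"
        unfolding admissible_def by (auto simp: not_le)
      have gp: "ch_path s t g" "g t \<in> E" using g(1) by (auto simp: Gam_def)
      have half: "ext_line_int (s, t, g) \<rho> < ennreal (1/2)"
      proof (rule ccontr)
        assume "\<not> ?thesis"
        then have "2 * ennreal (1/2) \<le> 2 * ext_line_int (s, t, g) \<rho>" by (intro mult_left_mono) (auto simp: not_less)
        also have "\<dots> \<le> ext_line_int (s, t, g) (\<lambda>x. 2 * \<rho> x)" by (rule ext_line_int_cmult_ge[OF gp(1) \<rho>b])
        also have "\<dots> < 1" by (rule g(3))
        finally have "2 * ennreal (1/2) < 1" .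
        moreover have "2 * ennreal (1/2) = 1"
          by (metis ennreal_1 ennreal_mult ennreal_numeral mult_2 field_sum_of_halves zero_le_divide_1_iff zero_le_numeral)
        ultimately show False by simp
      qed
      obtain v p q where v: "q - p \<ge> 2/5" "q \<le> 2" "v \<in> borel_measurable borel"
        "\<forall>r\<in>{p<..<q}. dist 0 (v r) = r \<and> (\<exists>\<tau>\<in>{s..t}. g \<tau> = Some (v r))"
        using shell_crossing_hitting_points[OF y(1) g(1)] by blast
      \<comment> \<open>The whole segment stays within radius r1, so any of its points can be the
        start of a lift that has to cross the ring.\<close>
      define seg where "seg \<xi> = x0 + \<xi> *\<^sub>R (x - x0)" for \<xi> :: real
      have seg: "dist (seg \<xi>) x0 \<le> r1" if "\<xi> \<in> {0..1}" for \<xi>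
      proof -
        have "dist (seg \<xi>) x0 = \<bar>\<xi>\<bar> * dist x x0" by (simp add: seg_def dist_norm)
        also have "\<dots> \<le> 1 * dist x x0" using that by (intro mult_right_mono) auto
        finally show ?thesis using x(2) by simp
      qed
      have "continuous_on {0..1} (\<lambda>\<xi>. stereo (f (seg \<xi>)))"
      proof (rule continuous_on_compose2[of D "\<lambda>x. stereo (f x)" _ seg])
        show "continuous_on D (\<lambda>x. stereo (f x))" using f'(1) by (simp add: ch_continuous_on_iff)
        show "continuous_on {0..1} seg" unfolding seg_def by (intro continuous_intros)
        show "seg ` {0..1} \<subseteq> D"
        proof safe
          fix \<xi> :: real assume "\<xi> \<in> {0..1}"
          then have "seg \<xi> \<in> cball x0 r3" using seg[of \<xi>] r r3 by (simp add: dist_commute)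
          then show "seg \<xi> \<in> D" using cball by blast
        qed
      qed
      moreover have "chordal (f (seg 0)) (f (seg 1)) \<ge> \<sigma>" using far by (simp add: seg_def)
      ultimately obtain u c where u: "norm c \<le> 2 / \<sigma>" "u \<in> borel_measurable borel"
        "\<forall>r\<in>{0<..<\<sigma>}. dist c (u r) = r \<and> (\<exists>\<xi>\<in>{0..1}. f (seg \<xi>) = Some (u r))"
        using continuum_hitting_points[of "\<lambda>\<xi>. f (seg \<xi>)" \<sigma>] \<sigma> by blast
      have uK: "norm (z - u r) \<le> K" if "r \<in> {0<..<\<sigma>}" "z \<in> ball 0 1" for r z
      proof -
        have "dist c (u r) = r" using u(3) that(1) by blast
        then have "norm (u r) \<le> norm c + \<sigma>" using that(1) norm_triangle_sub[of "u r" c] by (simp add: dist_norm norm_minus_commute)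
        then show ?thesis using norm_triangle_ineq4[of z "u r"] that(2) u(1) by (simp add: K_def)
      qed
      have vK: "norm (z - v r) \<le> K" if "r \<in> {p<..<q}" "z \<in> ball 0 1" for r z
      proof -
        have "norm (v r) = r" using v(4) that(1) by (metis dist_0_norm)
        then have "norm (v r) \<le> 2" using v(2) that(1) by simp
        then show ?thesis using norm_triangle_ineq4[of z "v r"] that(2) K by simp
      qed
      obtain r where r': "r \<in> {0<..<\<sigma>}"
        "(\<integral>\<^sup>+z\<in>ball 0 1. (\<integral>\<^sup>+t\<in>{0..1}. \<rho> (u r + t *\<^sub>R (z - u r)) \<partial>lborel) \<partial>lborel) < ennreal (b * k / 2)"
        using short[OF \<rho>b u(2), of \<sigma> 0 c] u(3) uK \<rho>1 by auto
      obtain r'' where r'': "r'' \<in> {p<..<q}"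
        "(\<integral>\<^sup>+z\<in>ball 0 1. (\<integral>\<^sup>+t\<in>{0..1}. \<rho> (v r'' + t *\<^sub>R (z - v r'')) \<partial>lborel) \<partial>lborel) < ennreal (b * k / 2)"
      proof -
        have "min \<sigma> (2/5) \<le> q - p" using v(1) by linarith
        then show ?thesis using short[OF \<rho>b v(3), of q p 0] v(4) vK \<rho>1 that by auto
      qed
      let ?\<phi> = "\<lambda>w z. \<integral>\<^sup>+t\<in>{0..1}. \<rho> (w + t *\<^sub>R (z - w)) \<partial>lborel"
      obtain z where z: "z \<in> ball 0 1" "?\<phi> (u r) z + ?\<phi> (v r'') z < ennreal k"
        using connecting_point[OF \<rho>b k r'(2)[unfolded b_def] r''(2)[unfolded b_def]] by blast
      obtain \<xi> where \<xi>: "\<xi> \<in> {0..1}" "f (seg \<xi>) = Some (u r)" using u(3) r'(1) by blast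
      obtain \<tau> where \<tau>: "\<tau> \<in> {s..t}" "g \<tau> = Some (v r'')" using v(4) r''(1) by blast
      obtain h where h: "ch_path (\<tau> - 2) t h" "loc_rectifiable (\<tau> - 2, t, h)" "h (\<tau> - 2) = Some (u r)" "h t = g t"
        and len: "ext_line_int (\<tau> - 2, t, h) \<rho> \<le> ennreal (norm (z - u r)) * ?\<phi> (u r) z +
          (ennreal (norm (z - v r'')) * ?\<phi> (v r'') z + ext_line_int (s, t, g) \<rho>)"
        using joining_path[OF gp(1) g(2) \<tau> \<rho>b, of "u r" z] by blast
      have "ext_line_int (\<tau> - 2, t, h) \<rho> \<le> ennreal K * ?\<phi> (u r) z + (ennreal K * ?\<phi> (v r'') z + ext_line_int (s, t, g) \<rho>)"
        using uK[OF r'(1) z(1)] vK[OF r''(1) z(1)]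
        by (intro order.trans[OF len] add_mono mult_right_mono ennreal_leI) auto
      also have "\<dots> = ennreal K * (?\<phi> (u r) z + ?\<phi> (v r'') z) + ext_line_int (s, t, g) \<rho>"
        by (simp add: distrib_left add.assoc)
      also have "\<dots> \<le> ennreal K * ennreal k + ext_line_int (s, t, g) \<rho>"
        using z(2) by (intro add_right_mono mult_left_mono) auto
      also have "ennreal K * ennreal k = ennreal (1/4)"
        using K k by (simp add: ennreal_mult[symmetric] k_def)
      also have "ennreal (1/4) + ext_line_int (s, t, g) \<rho> \<le> ennreal (1/4) + ennreal (1/2)"
        using half by (intro add_left_mono) simp
      also have "\<dots> = ennreal (3/4)" by (subst ennreal_plus[symmetric]) auto
      finally have short_h: "ext_line_int (\<tau> - 2, t, h) \<rho> \<le> ennreal (3/4)" .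
      have "h t \<notin> f ` D" using h(4) gp(2) E(2) by auto
      moreover have "f (seg \<xi>) = h (\<tau> - 2)" using \<xi>(2) h(3) by simp
      ultimately obtain c' d' \<alpha> where lift: "\<tau> - 2 \<le> c'" "c' < d'" "d' \<le> t"
        "(c', d', Some \<circ> \<alpha>) \<in> Gam (Some ` sphere x0 r1) (Some ` sphere x0 r2) (Some ` ring r1 r2 x0)"
        "\<And>\<theta>. \<theta> \<in> {c'..d'} \<Longrightarrow> f (\<alpha> \<theta>) = h \<theta>"
        using ring_crossing_lift[OF D(1) cball r(2) r3(1) f'(1-3) h(1) _ seg[OF \<xi>(1)]] by metis
      \<comment> \<open>The image of the lifted crossing coincides with a part of h. As a member of
        the image family it has length at least 1, as a part of h at most 3/4.\<close>
      let ?p = "f \<circ> the \<circ> (Some \<circ> \<alpha>)"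
      have eq: "?p \<theta> = h \<theta>" if "\<theta> \<in> {c'..d'}" for \<theta> using lift(5)[OF that] by simp
      have "(c', d', ?p) \<in> ?\<Gamma>" using lift(4) unfolding path_image_fam_def by blast
      moreover have "loc_rectifiable (c', d', ?p)"
        using loc_rectifiable_subpath[OF h(2) lift(1,3)] loc_rectifiable_cong[of c' d' ?p h] eq by blast
      ultimately have "1 \<le> ext_line_int (c', d', ?p) \<rho>"
        using \<rho>(1) unfolding admissible_def by blast
      also have "\<dots> = ext_line_int (c', d', h) \<rho>" using eq by (rule ext_line_int_cong)
      also have "\<dots> \<le> ext_line_int (\<tau> - 2, t, h) \<rho>" using lift(1,3) by (rule ext_line_int_subpath)
      also have "\<dots> \<le> ennreal (3/4)" by (rule short_h)
      finally have "ennreal 1 \<le> ennreal (3/4)" by simp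
      then show False by (subst (asm) ennreal_le_iff) auto
    qed
  qed
qed

theorem theorem2:
  fixes D :: "'a::euclidean_space set" and Q :: "'a \<Rightarrow> ennreal" and x0 :: 'a and \<delta> :: real
  assumes "DIM('a) \<ge> 2"
    and "open D" and "connected D" and "x0 \<in> D" and "\<delta> > 0"
    and "Q \<in> borel_measurable lebesgue"
    and "\<forall>x. x \<notin> D \<longrightarrow> Q x = 0"
    and "FMO_at Q x0
         \<or> (\<exists>C>0. \<exists>\<epsilon>'>0. \<forall>r\<in>{0<..<\<epsilon>'}. q_mean Q x0 r \<le> ennreal (C * (ln (1 / r)) ^ (DIM('a) - 1)))
         \<or> (\<exists>\<epsilon>0>0. ereal \<epsilon>0 < dist_bd x0 D \<and>
              (\<integral>\<^sup>+ t\<in>{0<..<\<epsilon>0}. inverse (ennreal t * enn_root (DIM('a) - 1) (q_mean Q x0 t)) \<partial>lborel) = \<infinity>)"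
  shows "equicont_at D (fam D Q x0 \<delta>) x0"
proof -
  \<comment> \<open>Conditions (1) and (2) are silent about the distance to the frontier; R confines
    their rings to D, while (3) brings its own \<epsilon>0.\<close>
  obtain R where R: "R > 0" "ereal R < dist_bd x0 D" using dist_bd_pos[OF assms(2,4)] .
  have "small_ring_integrals D Q x0"
    using assms(8)
  proof (elim disjE)
    assume "FMO_at Q x0"
    then show ?thesis by (rule small_ring_integrals_FMO[OF assms(1,6) R])
  next
    assume "\<exists>C>0. \<exists>\<epsilon>'>0. \<forall>r\<in>{0<..<\<epsilon>'}. q_mean Q x0 r \<le> ennreal (C * (ln (1 / r)) ^ (DIM('a) - 1))"
    then show ?thesis using small_ring_integrals_log[OF assms(1,6) R] by blast
  next
    assume "\<exists>\<epsilon>0>0. ereal \<epsilon>0 < dist_bd x0 D \<and>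
      (\<integral>\<^sup>+ t\<in>{0<..<\<epsilon>0}. inverse (ennreal t * enn_root (DIM('a) - 1) (q_mean Q x0 t)) \<partial>lborel) = \<infinity>"
    then show ?thesis using small_ring_integrals_divergence[OF assms(1,6)] by blast
  qed
  then show ?thesis
    unfolding equicont_at_def using chordal_bound[OF assms(2,4,5)] by blast
qed

end
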